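(* Let $\mathcal A$ be an essential arrangement of $d$ lines in $\mathbb P^2_k$, let $H$ be any line in $\mathcal A$, and let $(\mathcal A',\mathcal A,\mathcal A'')$ be the corresponding triple. Then: 1. If $d$ is odd, then $\mathcal D$ is stable if $\mathcal D'$ is stable and $|\mathcal A''|>\frac{d+1}{2}$. 2. If $d$ is odd, then $\mathcal D$ is semistable if $\mathcal D'$ is semistable and $|\mathcal A''|>\frac{d-1}{2}$. 3. If $d$ is even, then $\mathcal D$ is stable if $\mathcal D'$ is semistable and $|\mathcal A''|>\frac d2$.
   Context: $k$ is a field of characteristic $0$, $R=k[x_0,x_1,x_2]$. An arrangement $\mathcal A$ of $d$ lines in $\mathbb P^2_k$ is a set of $d$ distinct lines, with defining polynomial $Q\in R_d$ the product of the $d$ linear forms; it is essential if the lines do not all pass through one point. $D_0=\{\theta=\sum f_i\,\partial/\partial x_i\in\mathrm{Der}_k(R):\theta(Q)=0\}$ is the module of syzygies on the partial derivatives of $Q$, graded by $\deg\theta=\deg f_i$, and $\mathcal D$ is the associated sheaf on $\mathbb P^2$ (a rank two vector bundle). For $H\in\mathcal A$, the triple is: $\mathcal A'=\mathcal A\setminus\{H\}$, and $\mathcal A''=\mathcal A|_H$, the set of distinct points $\{H\cap H':H'\in\mathcal A'\}$ on $H$ (so $|\mathcal A''|=|\mathcal A'\cap H|$, multiplicities ignored). $\mathcal D'$ is the sheaf constructed in the same way from $\mathcal A'$. The slope of a bundle (or torsion-free sheaf) $\mathcal M$ is $c_1(\mathcal M)/\mathrm{rk}\,\mathcal M$. A bundle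 $\mathcal M$ on $\mathbb P^n$ is stable (respectively semistable) if $\mathrm{slope}(\mathcal N)<\mathrm{slope}(\mathcal M)$ (respectively $\le$) for every subsheaf $\mathcal N\subseteq\mathcal M$ with $0<\mathrm{rk}\,\mathcal N<\mathrm{rk}\,\mathcal M$. *)

theory Defs
  imports
    "HOL-Analysis.Analysis"
    "HOL-Library.Poly_Mapping"
    "HOL-Computational_Algebra.Fraction_Field"
begin

section \<open>The polynomial ring in three variables and its fraction field\<close>

text \<open>Exponent vectors and polynomials over \<open>k\<close>; the numeral type \<open>3\<close> indexes the variables.\<close>

type_synonym expo = "3 \<Rightarrow>\<^sub>0 nat"
type_synonym 'k poly3 = "expo \<Rightarrow>\<^sub>0 'k"
type_synonym 'k frac3 = "'k poly3 fract"

definition tdeg :: "expo \<Rightarrow> nat" where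
  "tdeg m = (\<Sum>i\<in>UNIV. Poly_Mapping.lookup m i)"

definition homogeneous :: "nat \<Rightarrow> 'k::zero poly3 \<Rightarrow> bool" where
  "homogeneous n f \<longleftrightarrow> (\<forall>m\<in>Poly_Mapping.keys f. tdeg m = n)"

definition hcomp :: "nat \<Rightarrow> 'k::comm_monoid_add poly3 \<Rightarrow> 'k poly3" where
  "hcomp n f =
    (\<Sum>m\<in>{m \<in> Poly_Mapping.keys f. tdeg m = n}. Poly_Mapping.single m (Poly_Mapping.lookup f m))"

definition pvar :: "3 \<Rightarrow> 'k::zero_neq_one poly3" where
  "pvar i = Poly_Mapping.single (Poly_Mapping.single i 1) 1"

text \<open>In the formal partial derivative below, the exponent \<open>m - e\<^sub>i\<close> is truncated when \<open>x\<^sub>i\<close> does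
  not occur in the monomial, but then the coefficient is \<open>0\<close>.\<close>

definition pdiff :: "3 \<Rightarrow> 'k::comm_semiring_1 poly3 \<Rightarrow> 'k poly3" where
  "pdiff i f = (\<Sum>m\<in>Poly_Mapping.keys f.
     Poly_Mapping.single (m - Poly_Mapping.single i 1)
       (of_nat (Poly_Mapping.lookup m i) * Poly_Mapping.lookup f m))"


section \<open>The projective plane as the scheme \<open>Proj R\<close>\<close>

definition hom_prime :: "'k::field poly3 set \<Rightarrow> bool" where
  "hom_prime p \<longleftrightarrow>
     0 \<in> p \<and> 1 \<notin> p \<and>
     (\<forall>f\<in>p. \<forall>g\<in>p. f + g \<in> p) \<and> (\<forall>f. \<forall>g\<in>p. f * g \<in> p) \<and>
     (\<forall>f g. f * g \<in> p \<longrightarrow> f \<in> p \<or> g \<in> p) \<and>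
     (\<forall>f\<in>p. \<forall>n. hcomp n f \<in> p)"

definition Proj3 :: "'k::field poly3 set set" where
  "Proj3 = {p. hom_prime p \<and> (\<exists>i. pvar i \<notin> p)}"

definition zariski :: "'k::field poly3 set topology" where
  "zariski = topology_generated_by {{p \<in> Proj3. f \<notin> p} | f. \<exists>n. homogeneous n f}"

abbreviation zopen :: "'k::field poly3 set set \<Rightarrow> bool" where
  "zopen U \<equiv> openin zariski U \<and> U \<noteq> {}"

text \<open>The points of codimension one, i.e. the generic points of the integral curves. The zero ideal is
  the generic point of the plane.\<close>

definition codim_one :: "'k::field poly3 set \<Rightarrow> bool" where
  "codim_one p \<longleftrightarrow> p \<in> Proj3 \<and> p \<noteq> {0} \<and> (\<forall>q\<in>Proj3. q \<subseteq> p \<longrightarrow> q = {0} \<or> q = p)"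

text \<open>Since the plane is integral, the line bundle \<open>O(a)\<close> is realised inside the constant sheaf given by
  the fraction field of \<open>R\<close>: its stalk at \<open>p\<close> consists of the fractions \<open>g / h\<close> of forms with
  \<open>deg g = deg h + a\<close> and \<open>h \<notin> p\<close>. In particular \<open>O(0)\<close> is the structure sheaf, inside the function field.\<close>

definition twist_stalk :: "int \<Rightarrow> 'k::field poly3 set \<Rightarrow> 'k frac3 set" where
  "twist_stalk a p = {Fract g h | g h m n.
     homogeneous m g \<and> homogeneous n h \<and> h \<notin> p \<and> int m = int n + a}"

definition structure_sheaf :: "'k::field poly3 set set \<Rightarrow> 'k frac3 set" where
  "structure_sheaf U = (\<Inter>p\<in>U. twist_stalk 0 p)"


section \<open>Torsion-free coherent sheaves\<close>

text \<open>A sheaf of \<open>O\<close>-modules contained in the constant sheaf of vectors of length three over the function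
  field is given by its sets of sections over the nonempty open sets. The restriction maps are
  inclusions, and as nonempty open sets meet, a family of sections that agree on overlaps is a
  single vector. Every subsheaf of such a sheaf is again of this form.

  Values at the empty set and at non-open sets carry no information and are never used.\<close>

type_synonym 'k sheaf = "'k poly3 set set \<Rightarrow> ('k frac3 ^ 3) set"

definition module_sheaf :: "'k::field sheaf \<Rightarrow> bool" where
  "module_sheaf N \<longleftrightarrow>
     (\<forall>U. zopen U \<longrightarrow>
        0 \<in> N U \<and> (\<forall>s\<in>N U. \<forall>t\<in>N U. s + t \<in> N U) \<and>
        (\<forall>c\<in>structure_sheaf U. \<forall>s\<in>N U. c *s s \<in> N U)) \<and>
     (\<forall>U V. zopen U \<longrightarrow> zopen V \<longrightarrow> U \<subseteq> V \<longrightarrow> N V \<subseteq> N U) \<and>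
     (\<forall>\<U> s. \<U> \<noteq> {} \<longrightarrow> (\<forall>U\<in>\<U>. zopen U \<and> s \<in> N U) \<longrightarrow> s \<in> N (\<Union>\<U>))"

text \<open>Finite type: locally there is a surjection of sheaves from a finite free module. A submodule of
  finite type of a coherent module is coherent, so this is the coherence condition for subsheaves.\<close>

definition finite_type :: "'k::field sheaf \<Rightarrow> bool" where
  "finite_type N \<longleftrightarrow>
     (\<forall>p\<in>Proj3. \<exists>U G. zopen U \<and> p \<in> U \<and> finite G \<and> G \<subseteq> N U \<and>
        (\<forall>V s q. zopen V \<longrightarrow> V \<subseteq> U \<longrightarrow> s \<in> N V \<longrightarrow> q \<in> V \<longrightarrow>
           (\<exists>W c. zopen W \<and> q \<in> W \<and> W \<subseteq> V \<and> (\<forall>g\<in>G. c g \<in> structure_sheaf W) \<and>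
              s = (\<Sum>g\<in>G. c g *s g))))"

definition coherent_subsheaf :: "'k::field sheaf \<Rightarrow> 'k sheaf \<Rightarrow> bool" where
  "coherent_subsheaf N M \<longleftrightarrow>
     module_sheaf N \<and> finite_type N \<and> (\<forall>U. zopen U \<longrightarrow> N U \<subseteq> M U)"

definition stalk :: "'k::field sheaf \<Rightarrow> 'k poly3 set \<Rightarrow> ('k frac3 ^ 3) set" where
  "stalk N p = \<Union>{N U | U. zopen U \<and> p \<in> U}"

text \<open>The sheaf associated with a graded submodule \<open>M\<close> of \<open>R\<^sup>3\<close>, with sections that are locally fractions
  \<open>\<theta> / h\<close> with \<open>\<theta> \<in> M\<close> and \<open>h\<close> homogeneous of the same degree.\<close>

definition associated_sheaf :: "('k::field poly3 ^ 3) set \<Rightarrow> 'k sheaf" where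
  "associated_sheaf M U = {s. \<forall>p\<in>U. \<exists>\<theta>\<in>M. \<exists>h n.
     (\<forall>i. homogeneous n (\<theta> $ i)) \<and> homogeneous n h \<and> h \<notin> p \<and> s = (\<chi> i. Fract (\<theta> $ i) h)}"


section \<open>Rank, first Chern class, slope and stability\<close>

text \<open>The rank is the dimension of the generic stalk over the function field \<open>K\<close>, the field of fractions
  of degree \<open>0\<close>. The generic stalk lies in \<open>K\<^sup>3\<close>, and independence of vectors of \<open>K\<^sup>3\<close> is
  unaffected by extending scalars from \<open>K\<close> to the fraction field \<open>F\<close> of \<open>R\<close>, over which the
  dimension is taken here.\<close>

definition sheaf_rank :: "'k::field sheaf \<Rightarrow> nat" where
  "sheaf_rank N = vec.dim (stalk N {0})"

text \<open>The exterior product \<open>v\<^sub>0 \<and> \<dots> \<and> v\<^bsub>r-1\<^esub>\<close> is represented by its coordinates, the \<open>r \<times> r\<close> minors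
  for all choices \<open>\<iota>\<close> of \<open>r\<close> coordinates.\<close>

definition wedge :: "nat \<Rightarrow> (nat \<Rightarrow> 'a::comm_ring_1 ^ 3) \<Rightarrow> (nat \<Rightarrow> 3) \<Rightarrow> 'a" where
  "wedge r v = (\<lambda>\<iota>. \<Sum>\<pi> | \<pi> permutes {..<r}. of_int (sign \<pi>) * (\<Prod>j<r. v j $ \<iota> (\<pi> j)))"

text \<open>The stalk at \<open>p\<close> of the top exterior power of \<open>N\<close> modulo torsion.\<close>

definition top_exterior_stalk :: "'k::field sheaf \<Rightarrow> 'k poly3 set \<Rightarrow> ((nat \<Rightarrow> 3) \<Rightarrow> 'k frac3) set" where
  "top_exterior_stalk N p = {(\<lambda>\<iota>. \<Sum>j<n. c j * wedge (sheaf_rank N) (v j) \<iota>) | (n::nat) c v.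
     \<forall>j<n. c j \<in> twist_stalk 0 p \<and> (\<forall>i<sheaf_rank N. v j i \<in> stalk N p)}"

text \<open>For a torsion-free coherent sheaf, \<open>c\<^sub>1(N) = c\<^sub>1(det N)\<close>, where \<open>det N\<close> is the reflexive hull of the
  top exterior power. This is a line bundle \<open>O(a)\<close>, and \<open>c\<^sub>1(O(a)) = a\<close>. A reflexive sheaf is determined by
  its stalks in codimension one, so \<open>det N \<cong> O(a)\<close> means that in codimension one the top exterior power is
  \<open>O(a) w\<close> for some rational \<open>w\<close> (which is then necessarily of degree \<open>-a\<close>).\<close>

definition has_c1 :: "'k::field sheaf \<Rightarrow> int \<Rightarrow> bool" where
  "has_c1 N a \<longleftrightarrow>
     (\<exists>w. \<forall>p. codim_one p \<longrightarrow> top_exterior_stalk N p = {(\<lambda>\<iota>. f * w \<iota>) | f. f \<in> twist_stalk a p})"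

definition c1 :: "'k::field sheaf \<Rightarrow> int" where
  "c1 N = (THE a. has_c1 N a)"

definition slope :: "'k::field sheaf \<Rightarrow> rat" where
  "slope N = of_int (c1 N) / of_nat (sheaf_rank N)"

definition slope_stable :: "'k::field sheaf \<Rightarrow> bool" where
  "slope_stable M \<longleftrightarrow> (\<forall>N. coherent_subsheaf N M \<longrightarrow> 0 < sheaf_rank N \<longrightarrow> sheaf_rank N < sheaf_rank M \<longrightarrow>
     slope N < slope M)"

definition slope_semistable :: "'k::field sheaf \<Rightarrow> bool" where
  "slope_semistable M \<longleftrightarrow> (\<forall>N. coherent_subsheaf N M \<longrightarrow> 0 < sheaf_rank N \<longrightarrow> sheaf_rank N < sheaf_rank M \<longrightarrow>
     slope N \<le> slope M)"


section \<open>Line arrangements\<close>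

text \<open>A line of the plane is given by the coefficient vector \<open>a\<close> of a linear form, and is recorded as the
  plane of zeros of the form in \<open>k\<^sup>3\<close>. An arrangement is a finite set of such vectors defining pairwise
  distinct lines. Points are one-dimensional subspaces of \<open>k\<^sup>3\<close>.\<close>

definition line :: "'k::field ^ 3 \<Rightarrow> ('k ^ 3) set" where
  "line a = {v. (\<Sum>i\<in>UNIV. a $ i * v $ i) = 0}"

definition linear_form :: "'k::field ^ 3 \<Rightarrow> 'k poly3" where
  "linear_form a = (\<Sum>i\<in>UNIV. Poly_Mapping.single (Poly_Mapping.single i 1) (a $ i))"

definition arrangement :: "('k::field ^ 3) set \<Rightarrow> bool" where
  "arrangement A \<longleftrightarrow> finite A \<and> 0 \<notin> A \<and> inj_on line A"

definition essential :: "('k::field ^ 3) set \<Rightarrow> bool" where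
  "essential A \<longleftrightarrow> \<not> (\<exists>v. v \<noteq> 0 \<and> (\<forall>a\<in>A. v \<in> line a))"

definition defining_poly :: "('k::field ^ 3) set \<Rightarrow> 'k poly3" where
  "defining_poly A = (\<Prod>a\<in>A. linear_form a)"

text \<open>The derivation \<open>\<Sum>\<^sub>i f\<^sub>i \<partial>/\<partial>x\<^sub>i\<close> is represented by its coefficient vector \<open>(f\<^sub>i)\<close>.\<close>

definition D0 :: "('k::field ^ 3) set \<Rightarrow> ('k poly3 ^ 3) set" where
  "D0 A = {\<theta>. (\<Sum>i\<in>UNIV. \<theta> $ i * pdiff i (defining_poly A)) = 0}"

definition D_sheaf :: "('k::field ^ 3) set \<Rightarrow> 'k sheaf" where
  "D_sheaf A = associated_sheaf (D0 A)"

definition deletion :: "('k::field ^ 3) set \<Rightarrow> 'k ^ 3 \<Rightarrow> ('k ^ 3) set" where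
  "deletion A h = A - {h}"

definition restriction :: "('k::field ^ 3) set \<Rightarrow> 'k ^ 3 \<Rightarrow> ('k ^ 3) set set" where
  "restriction A h = {line h \<inter> line a | a. a \<in> deletion A h}"

end

theory Submission
  imports Defs "Berlekamp_Zassenhaus.Unique_Factorization_Poly"
begin

text \<open>A rank one subsheaf of the bundle of an arrangement is, in codimension one, \<open>O(-m)\<close> spanned by a
  syzygy of degree \<open>m\<close>, because the polynomial ring is factorial. As the first Chern class of the bundle is
  \<open>1 - |A|\<close>, (semi)stability says that every nonzero syzygy has degree \<open>m\<close> with \<open>2m > |A| - 1\<close>
  (resp. \<open>\<ge>\<close>).

  A syzygy \<open>\<theta>\<close> of \<open>A\<close> gives one of \<open>A'\<close> of the same degree after correction by a multiple of the Euler
  derivation. Its restriction to \<open>H\<close> is tangent to the points of \<open>A''\<close>, so if \<open>m + 1 < |A''|\<close> the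
  restriction is a multiple of the Euler derivation. Subtracting this multiple and dividing by the
  equation of \<open>H\<close> gives a syzygy of \<open>A'\<close> of degree \<open>m - 1\<close>. The rest is parity of \<open>d\<close>.\<close>

no_notation Matrix.vec_index (infixl "$" 100)
hide_fact (open) Matrix.vec_eq_iff

section \<open>Polynomials in three variables\<close>

text \<open>Stability tests all coherent subsheaves, which need be neither locally free nor
  saturated. The first Chern class sees only codimension one, where the local rings are discrete
  valuation rings: a rank one subsheaf is generated there by one rational vector, whose entries have
  no poles and hence are forms. So the possible slopes in rank one are exactly the negatives of
  degrees of syzygies.

  The thresholds come from the degree m + 1 of the bivector of \<theta> and the Euler derivation on
  H. In the two cases that conclude stability, deletion leaves one degree m for a destabilizing
  syzygy: (d - 1)/2 for odd d and (d - 2)/2 for even d. So m + 1 is (d + 1)/2 or d/2, and degree m -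
  1 is too small for A'.

  Neither \<theta> nor the quotient by the equation of H need kill the defining polynomial Q' of A';
  each maps it to a multiple of itself. A multiple of the Euler derivation corrects this, since the
  number of lines is nonzero in characteristic 0.\<close>

lemma poly_mapping_sum_single:
  fixes f :: "'a \<Rightarrow>\<^sub>0 'b::comm_monoid_add"
  shows "f = (\<Sum>m\<in>Poly_Mapping.keys f. Poly_Mapping.single m (Poly_Mapping.lookup f m))"
  by (rule poly_mapping_eqI) (simp add: lookup_sum lookup_single when_def in_keys_iff)

lemma poly_mapping_induct_add [case_names zero single add]:
  fixes f :: "'a \<Rightarrow>\<^sub>0 'b::comm_monoid_add"
  assumes "P 0" "\<And>m c. P (Poly_Mapping.single m c)" "\<And>f g. P f \<Longrightarrow> P g \<Longrightarrow> P (f + g)"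
  shows "P f"
proof -
  have "P (\<Sum>m\<in>S. Poly_Mapping.single m (c m))" if "finite S" for S and c
    using that by (induction S) (auto intro: assms)
  then show ?thesis
    by (subst poly_mapping_sum_single) simp
qed

text \<open>The homomorphism given by the universal property of the polynomial ring. The grading,
  the comparison with iterated univariate polynomials and the restriction to a line are all
  instances of it.\<close>

definition insertion :: "('k::comm_ring_1 \<Rightarrow> 'r::comm_ring_1) \<Rightarrow> (3 \<Rightarrow> 'r) \<Rightarrow> 'k poly3 \<Rightarrow> 'r" where
  "insertion \<kappa> y f =
    (\<Sum>m\<in>Poly_Mapping.keys f. \<kappa> (Poly_Mapping.lookup f m) * (\<Prod>i\<in>UNIV. y i ^ Poly_Mapping.lookup m i))"

context
  fixes \<kappa> :: "'k::comm_ring_1 \<Rightarrow> 'r::comm_ring_1"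
  assumes hom: "comm_ring_hom \<kappa>"
begin

interpretation comm_ring_hom \<kappa> by (rule hom)

lemma insertion_superset:
  assumes "finite S" "Poly_Mapping.keys f \<subseteq> S"
  shows "insertion \<kappa> y f =
    (\<Sum>m\<in>S. \<kappa> (Poly_Mapping.lookup f m) * (\<Prod>i\<in>UNIV. y i ^ Poly_Mapping.lookup m i))"
  unfolding insertion_def using assms
  by (intro sum.mono_neutral_left) (auto simp: in_keys_iff)

lemma insertion_single:
  "insertion \<kappa> y (Poly_Mapping.single m c) = \<kappa> c * (\<Prod>i\<in>UNIV. y i ^ Poly_Mapping.lookup m i)"
  by (subst insertion_superset[of "{m}"]) (auto split: if_splits)

lemma insertion_add: "insertion \<kappa> y (f + g) = insertion \<kappa> y f + insertion \<kappa> y g"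
proof -
  let ?S = "Poly_Mapping.keys f \<union> Poly_Mapping.keys g"
  have "insertion \<kappa> y h =
      (\<Sum>m\<in>?S. \<kappa> (Poly_Mapping.lookup h m) * (\<Prod>i\<in>UNIV. y i ^ Poly_Mapping.lookup m i))"
    if "Poly_Mapping.keys h \<subseteq> ?S" for h
    using that by (intro insertion_superset) auto
  note this[of f] this[of g] this[of "f + g"]
  then show ?thesis
    using keys_add[of f g] by (simp add: lookup_add hom_add distrib_right sum.distrib)
qed

lemma insertion_zero: "insertion \<kappa> y 0 = 0"
  by (simp add: insertion_def)

lemma insertion_mult: "insertion \<kappa> y (f * g) = insertion \<kappa> y f * insertion \<kappa> y g"
proof (induction f rule: poly_mapping_induct_add)
  case (single m c)
  show ?case
    by (induction g rule: poly_mapping_induct_add)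
      (simp_all add: insertion_zero insertion_add insertion_single mult_single hom_mult lookup_add
        power_add prod.distrib distrib_left mult.assoc mult.left_commute)
qed (simp_all add: insertion_zero insertion_add distrib_right)

lemma comm_ring_hom_insertion: "comm_ring_hom (insertion \<kappa> y)"
proof
  show "insertion \<kappa> y 1 = 1"
    using insertion_single[of y 0 1] by simp
qed (simp_all add: insertion_zero insertion_add insertion_mult)

end

abbreviation pconst :: "'k::zero \<Rightarrow> 'k poly3" where
  "pconst c \<equiv> Poly_Mapping.single 0 c"

lemma comm_ring_hom_pconst: "comm_ring_hom (pconst :: 'k::comm_ring_1 \<Rightarrow> 'k poly3)"
  by standard (simp_all add: single_add mult_single)

lemma pvar_power: "(pvar i :: 'k::comm_ring_1 poly3) ^ n = Poly_Mapping.single (Poly_Mapping.single i n) 1"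
  by (induction n) (simp_all add: pvar_def mult_single flip: single_add)

lemma prod_single:
  "finite S \<Longrightarrow> (\<Prod>i\<in>S. Poly_Mapping.single (f i) (1::'k::comm_ring_1)) =
    Poly_Mapping.single (\<Sum>i\<in>S. f i :: expo) 1"
  by (induction S rule: finite_induct) (simp_all add: mult_single)

lemma prod_pvar_power:
  "(\<Prod>i\<in>UNIV. (pvar i :: 'k::comm_ring_1 poly3) ^ Poly_Mapping.lookup m i) = Poly_Mapping.single m 1"
proof -
  have "(\<Sum>i\<in>UNIV. Poly_Mapping.single i (Poly_Mapping.lookup m i)) = m"
    by (rule poly_mapping_eqI) (simp add: lookup_sum lookup_single when_def)
  then show ?thesis by (simp add: pvar_power prod_single)
qed

section \<open>Homogeneous components and the grading\<close>

lemma tdeg_add: "tdeg (m + n) = tdeg m + tdeg n"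
  by (simp add: tdeg_def lookup_add sum.distrib)

lemma lookup_hcomp: "Poly_Mapping.lookup (hcomp n f) m = (if tdeg m = n then Poly_Mapping.lookup f m else 0)"
  by (simp add: hcomp_def lookup_sum lookup_single when_def in_keys_iff)

lemma hcomp_add: "hcomp n (f + g) = hcomp n f + hcomp n g"
  by (rule poly_mapping_eqI) (simp add: lookup_hcomp lookup_add)

lemma hcomp_zero [simp]: "hcomp n 0 = 0"
  by (rule poly_mapping_eqI) (simp add: lookup_hcomp)

lemma homogeneous_iff: "homogeneous n f \<longleftrightarrow> (\<forall>m. tdeg m \<noteq> n \<longrightarrow> Poly_Mapping.lookup f m = 0)"
  by (auto simp: homogeneous_def in_keys_iff)

lemma homogeneous_hcomp: "homogeneous n (hcomp n f)"
  by (simp add: homogeneous_iff lookup_hcomp)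

lemma hcomp_homogeneous: "homogeneous n f \<Longrightarrow> hcomp k f = (if k = n then f else 0)"
  by (intro poly_mapping_eqI) (auto simp: homogeneous_iff lookup_hcomp)

text \<open>The substitution x_i -> x_i t. The coefficient of t^n is the component of degree n, so
  questions about homogeneity become questions about univariate polynomials over a domain.\<close>

definition grading :: "'k::comm_ring_1 poly3 \<Rightarrow> 'k poly3 poly" where
  "grading = insertion (\<lambda>c. [:pconst c:]) (\<lambda>i. monom (pvar i) 1)"

lemma comm_ring_hom_pCons_pconst: "comm_ring_hom (\<lambda>c::'k::comm_ring_1. [:pconst c:])"
  by standard (simp_all add: single_add mult_single mult.commute)

interpretation grading: comm_ring_hom "grading :: 'k::comm_ring_1 poly3 \<Rightarrow> 'k poly3 poly"
  unfolding grading_def by (intro comm_ring_hom_insertion comm_ring_hom_pCons_pconst)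

lemma monom_prod: "finite S \<Longrightarrow> (\<Prod>i\<in>S. monom (a i :: 'a::comm_ring_1) (k i)) = monom (\<Prod>i\<in>S. a i) (\<Sum>i\<in>S. k i)"
  by (induction S rule: finite_induct) (simp_all add: mult_monom)

lemma grading_single: "grading (Poly_Mapping.single m c) = monom (Poly_Mapping.single m c) (tdeg m)"
  unfolding grading_def
  by (simp add: insertion_single[OF comm_ring_hom_pCons_pconst] monom_power monom_prod prod_pvar_power
      tdeg_def smult_monom mult_single)

lemma coeff_grading: "coeff (grading f) n = hcomp n f"
proof (induction f rule: poly_mapping_induct_add)
  case (single m c)
  then show ?case
    by (intro poly_mapping_eqI) (auto simp: grading_single lookup_hcomp lookup_single when_def)
qed (simp_all add: grading.hom_add hcomp_add)

lemma grading_homogeneous: "homogeneous n f \<Longrightarrow> grading f = monom f n"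
  by (rule poly_eqI) (simp add: coeff_grading hcomp_homogeneous)

lemma homogeneous_grading: "grading f = monom f n \<Longrightarrow> homogeneous n f"
  using coeff_grading[of f n] homogeneous_hcomp[of n f] by simp

lemma grading_eq_0_iff: "grading f = 0 \<longleftrightarrow> f = 0"
proof
  assume 0: "grading f = 0"
  have "hcomp n f = 0" for n
    using 0 by (simp flip: coeff_grading)
  then show "f = 0"
    by (intro poly_mapping_eqI) (metis lookup_hcomp lookup_zero)
qed simp

lemma homogeneous_zero [simp]: "homogeneous n 0"
  by (simp add: homogeneous_def)

lemma homogeneous_add: "homogeneous n f \<Longrightarrow> homogeneous n g \<Longrightarrow> homogeneous n (f + g)"
  by (simp add: homogeneous_iff lookup_add)

lemma homogeneous_uminus: "homogeneous n f \<Longrightarrow> homogeneous n (- f :: 'k::ab_group_add poly3)"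
  by (simp add: homogeneous_iff)

lemma homogeneous_diff:
  "homogeneous n f \<Longrightarrow> homogeneous n g \<Longrightarrow> homogeneous n (f - g :: 'k::ab_group_add poly3)"
  by (simp add: homogeneous_iff lookup_minus)

lemma homogeneous_sum: "(\<And>i. i \<in> S \<Longrightarrow> homogeneous n (f i)) \<Longrightarrow> homogeneous n (\<Sum>i\<in>S. f i)"
  by (induction S rule: infinite_finite_induct) (auto intro: homogeneous_add)

lemma homogeneous_mult:
  "homogeneous m f \<Longrightarrow> homogeneous n g \<Longrightarrow> homogeneous (m + n) (f * g :: 'k::comm_ring_1 poly3)"
  by (intro homogeneous_grading) (simp add: grading.hom_mult grading_homogeneous mult_monom)

lemma homogeneous_pconst: "homogeneous 0 (pconst c)"
  by (simp add: homogeneous_def tdeg_def)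

lemma homogeneous_one: "homogeneous 0 (1 :: 'k::comm_ring_1 poly3)"
  using homogeneous_pconst[of "1::'k"] by simp

lemma homogeneous_power:
  "homogeneous m f \<Longrightarrow> homogeneous (n * m) (f ^ n :: 'k::comm_ring_1 poly3)"
  by (induction n) (auto intro: homogeneous_one homogeneous_mult)

lemma homogeneous_prod:
  "(\<And>i. i \<in> S \<Longrightarrow> homogeneous (n i) (f i :: 'k::comm_ring_1 poly3)) \<Longrightarrow>
    homogeneous (\<Sum>i\<in>S. n i) (\<Prod>i\<in>S. f i)"
  by (induction S rule: infinite_finite_induct) (simp_all add: homogeneous_one homogeneous_mult)

lemma homogeneous_unique: "homogeneous m f \<Longrightarrow> homogeneous n f \<Longrightarrow> f \<noteq> 0 \<Longrightarrow> m = n"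
  unfolding homogeneous_iff by (metis lookup_zero poly_mapping_eqI)

lemma homogeneous_0_imp_pconst:
  assumes "homogeneous 0 f"
  shows "f = pconst (Poly_Mapping.lookup f 0)"
proof (rule poly_mapping_eqI)
  fix m
  have "tdeg m = 0 \<longleftrightarrow> m = 0"
    by (auto simp: tdeg_def intro!: poly_mapping_eqI)
  then show "Poly_Mapping.lookup f m = Poly_Mapping.lookup (pconst (Poly_Mapping.lookup f 0)) m"
    using assms by (auto simp: homogeneous_iff lookup_single when_def)
qed

lemma homogeneous_0_dvd_1:
  assumes "homogeneous 0 (f :: 'k::field poly3)" "f \<noteq> 0"
  shows "f dvd 1"
proof -
  obtain c where c: "f = pconst c" using homogeneous_0_imp_pconst[OF assms(1)] by blast
  then have "1 = f * pconst (inverse c)" using assms(2) by (cases "c = 0") (simp_all add: mult_single)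
  then show ?thesis by (rule dvdI)
qed

text \<open>The order at 0 is the least exponent that occurs and the degree is the largest one; if
  they agree, only one exponent is left.\<close>

lemma monom_if_order_0_eq_degree:
  assumes "Polynomial.order (0::'a::idom) p = degree p" "p \<noteq> 0"
  shows "p = monom (lead_coeff p) (degree p)"
proof (rule poly_eqI)
  fix k
  have "monom 1 (degree p) dvd p"
    using order_1[of 0 p] assms by (simp add: monom_altdef)
  then obtain q where q: "p = monom 1 (degree p) * q" by (elim dvdE)
  have "coeff p k = 0" if "k < degree p"
    using that q by (metis coeff_monom_mult not_le)
  moreover have "coeff p k = 0" if "k > degree p"
    using that by (rule coeff_eq_0)
  ultimately show "coeff p k = coeff (monom (lead_coeff p) (degree p)) k"
    by (cases k "degree p" rule: linorder_cases) auto
qed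

text \<open>Degree and order at \<open>0\<close> of the grading polynomial are the largest and the least degree of a
  homogeneous component; both are additive under multiplication.\<close>

lemma homogeneous_factor:
  fixes f g :: "'k::idom poly3"
  assumes "homogeneous n (f * g)" "f \<noteq> 0" "g \<noteq> 0"
  obtains i j where "homogeneous i f" "homogeneous j g" "i + j = n"
proof -
  let ?f = "grading f" and ?g = "grading g"
  have eq: "?f * ?g = monom (f * g) n"
    using assms(1) by (simp add: grading_homogeneous flip: grading.hom_mult)
  have nz: "?f \<noteq> 0" "?g \<noteq> 0" "f * g \<noteq> 0"
    using assms by (auto simp: grading_eq_0_iff)
  have "degree ?f + degree ?g = n"
    using nz degree_mult_eq[of ?f ?g] by (simp add: eq degree_monom_eq)
  moreover have "Polynomial.order 0 (?f * ?g) = n"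
    unfolding eq using nz
    by simp
  then have "Polynomial.order 0 ?f + Polynomial.order 0 ?g = n"
    using nz by (simp add: order_mult)
  \<comment> \<open>The order never exceeds the degree, and both sums over the two factors are n, so
    equality holds for each factor.\<close>
  ultimately have o: "Polynomial.order 0 ?f = degree ?f" "Polynomial.order 0 ?g = degree ?g"
    using order_degree[OF nz(1), of 0] order_degree[OF nz(2), of 0] by auto
  have *: "homogeneous (degree (grading h)) h" if "grading h \<noteq> 0" "Polynomial.order 0 (grading h) = degree (grading h)" for h :: "'k poly3"
  proof -
    have "grading h = monom (lead_coeff (grading h)) (degree (grading h))"
      using monom_if_order_0_eq_degree[OF that(2,1)] .
    then have "hcomp k h = (if k = degree (grading h) then lead_coeff (grading h) else 0)" for k
      by (metis coeff_grading coeff_monom)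
    then show ?thesis
      unfolding homogeneous_iff by (metis lookup_hcomp lookup_zero)
  qed
  show ?thesis
    using that[OF *[OF nz(1) o(1)] *[OF nz(2) o(2)]] \<open>degree ?f + degree ?g = n\<close> by blast
qed


section \<open>Factoriality of the polynomial ring\<close>

definition expo3 :: "nat \<Rightarrow> nat \<Rightarrow> nat \<Rightarrow> expo" where
  "expo3 i j l = Poly_Mapping.single 1 i + Poly_Mapping.single 2 j + Poly_Mapping.single 3 l"

lemma prod_UNIV_3: "(\<Prod>i\<in>(UNIV::3 set). f i) = f 1 * f 2 * f 3"
  unfolding UNIV_3 by (simp add: ac_simps)

lemma lookup_expo3:
  "Poly_Mapping.lookup (expo3 i j l) 1 = i" "Poly_Mapping.lookup (expo3 i j l) 2 = j"
  "Poly_Mapping.lookup (expo3 i j l) 3 = l"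
  by (simp_all add: expo3_def lookup_add lookup_single)

lemma expo3_lookup: "expo3 (Poly_Mapping.lookup m 1) (Poly_Mapping.lookup m 2) (Poly_Mapping.lookup m 3) = m"
proof (rule poly_mapping_eqI)
  fix k :: 3
  have "k \<in> {1, 2, 3}" by (simp flip: UNIV_3)
  then show "Poly_Mapping.lookup (expo3 (Poly_Mapping.lookup m 1) (Poly_Mapping.lookup m 2)
      (Poly_Mapping.lookup m 3)) k = Poly_Mapping.lookup m k"
    by (auto simp: lookup_expo3)
qed

text \<open>The isomorphism with univariate polynomials iterated three times: the variable 1 becomes
  the outermost indeterminate, 2 the middle one and 3 the innermost. On that side factoriality is
  known by iterating the lemma of Gauss.\<close>

definition to_poly :: "'k::comm_ring_1 poly3 \<Rightarrow> 'k poly poly poly" where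
  "to_poly = insertion (\<lambda>c. monom (monom (monom c 0) 0) 0)
    (\<lambda>i. if i = 1 then monom 1 1 else if i = 2 then monom (monom 1 1) 0 else monom (monom (monom 1 1) 0) 0)"

lemma comm_ring_hom_monom3: "comm_ring_hom (\<lambda>c::'k::comm_ring_1. monom (monom (monom c 0) 0) 0)"
  by standard (simp_all add: mult_monom add_monom)

interpretation to_poly: comm_ring_hom "to_poly :: 'k::comm_ring_1 poly3 \<Rightarrow> 'k poly poly poly"
  unfolding to_poly_def by (intro comm_ring_hom_insertion comm_ring_hom_monom3)

lemma to_poly_single: "to_poly (Poly_Mapping.single m c) =
  monom (monom (monom c (Poly_Mapping.lookup m 3)) (Poly_Mapping.lookup m 2)) (Poly_Mapping.lookup m 1)"
  by (simp add: to_poly_def insertion_single[OF comm_ring_hom_monom3] prod_UNIV_3 monom_power mult_monom)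

lemma coeff_to_poly: "coeff (coeff (coeff (to_poly f) i) j) l = Poly_Mapping.lookup f (expo3 i j l)"
proof (induction f rule: poly_mapping_induct_add)
  case (single m c)
  have "m = expo3 i j l \<longleftrightarrow> Poly_Mapping.lookup m 1 = i \<and> Poly_Mapping.lookup m 2 = j \<and> Poly_Mapping.lookup m 3 = l"
    by (metis lookup_expo3 expo3_lookup)
  then show ?case by (auto simp: to_poly_single lookup_single when_def)
qed (simp_all add: to_poly.hom_add lookup_add)

lemma inj_to_poly: "inj to_poly"
  by (intro injI poly_mapping_eqI) (metis coeff_to_poly expo3_lookup)

lemma poly_in_subring:
  fixes p :: "'a::comm_ring_1 poly"
  assumes "\<And>q r. q \<in> S \<Longrightarrow> r \<in> S \<Longrightarrow> q + r \<in> S" "\<And>q r. q \<in> S \<Longrightarrow> r \<in> S \<Longrightarrow> q * r \<in> S"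
    and "h (monom 1 1) \<in> S" "\<And>c. h [:c:] \<in> S" "comm_ring_hom h"
  shows "h p \<in> S"
proof (induction p)
  case 0
  then show ?case using assms(4)[of 0] by simp
next
  case (pCons a p)
  interpret comm_ring_hom h by fact
  have "pCons a p = [:a:] + monom 1 1 * p"
    by (simp add: monom_altdef)
  then have "h (pCons a p) = h [:a:] + h (monom 1 1) * h p"
    by (simp only: hom_add hom_mult)
  with pCons assms show ?case by auto
qed

text \<open>The range is a subring with all monomials. \<open>poly_in_subring\<close> is used once
  for each layer, from the innermost coefficients outwards: the layer below supplies the constants
  of the next one.\<close>

lemma surj_to_poly: "surj (to_poly :: 'k::comm_ring_1 poly3 \<Rightarrow> _)"
proof -
  let ?S = "range (to_poly :: 'k poly3 \<Rightarrow> _)"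
  have add: "q + r \<in> ?S" if "q \<in> ?S" "r \<in> ?S" for q r
    using that by (auto simp flip: to_poly.hom_add)
  have mult: "q * r \<in> ?S" if "q \<in> ?S" "r \<in> ?S" for q r
    using that by (auto simp flip: to_poly.hom_mult)
  have mon: "monom (monom (monom c l) j) i \<in> ?S" for c l j i
    using to_poly_single[of "expo3 i j l" c] by (metis lookup_expo3 rangeI)
  note ring = poly_in_subring[where S = ?S, OF add mult]
  have "comm_ring_hom (\<lambda>p::'k poly. [:[:p:]:])" by standard (simp_all add: mult.commute)
  then have 1: "[:[:p:]:] \<in> ?S" for p
    by (rule ring[rotated -1]) (use mon[of _ 0 0 0] mon[of 1 1 0 0] in \<open>simp_all add: monom_0\<close>)
  have "comm_ring_hom (\<lambda>p::'k poly poly. [:p:])" by standard (simp_all add: mult.commute)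
  then have 2: "[:p:] \<in> ?S" for p
    by (rule ring[rotated -1]) (use mon[of 1 0 1 0] 1 in \<open>simp_all add: monom_0\<close>)
  have "comm_ring_hom (\<lambda>p::'k poly poly poly. p)" by standard simp_all
  then have "p \<in> ?S" for p
    by (rule ring[rotated -1]) (use mon[of 1 0 0 1] 2 in \<open>simp_all add: monom_0\<close>)
  then show ?thesis by auto
qed

lemma to_poly_dvd_iff: "to_poly f dvd to_poly g \<longleftrightarrow> f dvd (g :: 'k::comm_ring_1 poly3)"
proof
  assume "to_poly f dvd to_poly g"
  then obtain q where "to_poly g = to_poly f * q" by (elim dvdE)
  moreover obtain h where "q = to_poly h" using surj_to_poly by (metis surjD)
  ultimately have "to_poly g = to_poly (f * h)" by (simp add: to_poly.hom_mult)
  then show "f dvd g" using inj_to_poly by (metis injD dvdI)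
qed (auto simp: to_poly.hom_mult)

lemma irreducible_imp_prime_elem_poly3:
  assumes "irreducible (f :: 'k::field poly3)"
  shows "prime_elem f"
proof -
  have unit: "to_poly g dvd 1 \<longleftrightarrow> g dvd 1" for g :: "'k poly3"
    using to_poly_dvd_iff[of g 1] by simp
  have zero: "to_poly g = 0 \<longleftrightarrow> g = 0" for g :: "'k poly3"
    using to_poly_dvd_iff[of 0 g] by simp
  have "irreducible (to_poly f)"
  proof (rule irreducibleI)
    fix a b assume ab: "to_poly f = a * b"
    obtain a' b' where [simp]: "a = to_poly a'" "b = to_poly b'"
      using surj_to_poly by (metis surjD)
    have "f = a' * b'"
      using ab injD[OF inj_to_poly] by (simp flip: to_poly.hom_mult)
    then have "a' dvd 1 \<or> b' dvd 1" using assms by (auto dest: irreducibleD)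
    then show "a dvd 1 \<or> b dvd 1" by (simp add: unit)
  qed (use assms in \<open>simp_all add: unit zero irreducible_def\<close>)
  \<comment> \<open>The iterated polynomial ring over a field is factorial, so irreducible and prime
    coincide there.\<close>
  then have prime: "prime_elem (to_poly f)" by simp
  show ?thesis
  proof (rule prime_elemI)
    fix a b assume "f dvd a * b"
    then have "to_poly f dvd to_poly a * to_poly b"
      by (simp add: to_poly_dvd_iff flip: to_poly.hom_mult)
    then have "to_poly f dvd to_poly a \<or> to_poly f dvd to_poly b"
      using prime by (simp add: prime_elem_dvd_mult_iff)
    then show "f dvd a \<or> f dvd b" by (simp add: to_poly_dvd_iff)
  qed (use assms in \<open>simp_all add: irreducible_def\<close>)
qed

lemma homogeneous_not_unit:
  assumes "homogeneous n (f :: 'k::field poly3)" "0 < n"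
  shows "\<not> f dvd 1"
proof
  assume "f dvd 1"
  then obtain g where g: "1 = f * g" by (elim dvdE)
  then have "f \<noteq> 0" "g \<noteq> 0" by auto
  moreover have "homogeneous 0 (f * g)" by (simp add: homogeneous_one flip: g)
  ultimately obtain i j where "homogeneous i f" "i + j = 0" using homogeneous_factor by metis
  then show False using homogeneous_unique[OF assms(1)] assms(2) \<open>f \<noteq> 0\<close> by auto
qed

text \<open>Factors of a form are forms, and a form of degree 0 is a unit. So a proper factorization
  of f has factors of smaller positive degree, and the induction ends at an irreducible form, which
  is prime.\<close>

lemma homogeneous_prime_divisor:
  assumes "homogeneous n (f :: 'k::field poly3)" "0 < n" "f \<noteq> 0"
  shows "\<exists>g m. prime_elem g \<and> homogeneous m g \<and> 0 < m \<and> g dvd f"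
  using assms
proof (induction n arbitrary: f rule: less_induct)
  case (less n)
  show ?case
  proof (cases "irreducible f")
    case True
    then show ?thesis
      using less.prems irreducible_imp_prime_elem_poly3[OF True]
      by (intro exI[of _ f] exI[of _ n]) simp
  next
    case False
    then obtain a b where ab: "f = a * b" "\<not> a dvd 1" "\<not> b dvd 1"
      using homogeneous_not_unit[OF less.prems(1,2)] less.prems(3)
      by (auto simp: irreducible_def simp del: prime_elem_iff_irreducible)
    then have nz: "a \<noteq> 0" "b \<noteq> 0" using less.prems(3) by auto
    have "homogeneous n (a * b)" using less.prems(1) ab(1) by simp
    then obtain i j where ij: "homogeneous i a" "homogeneous j b" "i + j = n"
      using nz by (rule homogeneous_factor)
    have "i \<noteq> 0"
      using ij(1) ab(2) nz(1) homogeneous_0_dvd_1[of a] by (cases "i = 0") auto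
    moreover have "j \<noteq> 0"
      using ij(2) ab(3) nz(2) homogeneous_0_dvd_1[of b] by (cases "j = 0") auto
    ultimately obtain g m where "prime_elem g" "homogeneous m g" "0 < m" "g dvd a"
      using less.IH[of i a] ij nz by auto
    then show ?thesis unfolding ab(1) by (metis dvd_mult2)
  qed
qed

section \<open>Homogeneous primes and twists\<close>

declare prime_elem_iff_irreducible [iff del]

lemma hom_prime_zero: "hom_prime p \<Longrightarrow> 0 \<in> p"
  by (simp add: hom_prime_def)

lemma hom_prime_one: "hom_prime p \<Longrightarrow> 1 \<notin> p"
  by (simp add: hom_prime_def)

lemma hom_prime_add: "hom_prime p \<Longrightarrow> f \<in> p \<Longrightarrow> g \<in> p \<Longrightarrow> f + g \<in> p"
  by (simp add: hom_prime_def)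

lemma hom_prime_hcomp: "hom_prime p \<Longrightarrow> f \<in> p \<Longrightarrow> hcomp n f \<in> p"
  by (simp add: hom_prime_def)

lemma hom_prime_mult_iff:
  assumes "hom_prime p"
  shows "f * g \<in> p \<longleftrightarrow> f \<in> p \<or> g \<in> p"
proof -
  have "f * g \<in> p" if "g \<in> p" for f g
    using that assms by (simp add: hom_prime_def)
  from this[of g f] this[of f g] show ?thesis
    using assms unfolding hom_prime_def by (metis mult.commute)
qed

lemma hom_prime_power: "hom_prime p \<Longrightarrow> f \<notin> p \<Longrightarrow> f ^ n \<notin> p"
  by (induction n) (simp_all add: hom_prime_one hom_prime_mult_iff)

lemma Proj3_hom_prime: "p \<in> Proj3 \<Longrightarrow> hom_prime p"
  by (simp add: Proj3_def)

lemma codim_one_Proj3: "codim_one p \<Longrightarrow> p \<in> Proj3"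
  by (simp add: codim_one_def)

lemma homogeneous_pvar: "homogeneous 1 (pvar i :: 'k::zero_neq_one poly3)"
  by (simp add: homogeneous_def pvar_def tdeg_def lookup_single when_def)

lemma pvar_nonzero: "(pvar i :: 'k::zero_neq_one poly3) \<noteq> 0"
  unfolding pvar_def by (metis lookup_single_eq lookup_zero zero_neq_one)

lemma zero_Proj3: "{0 :: 'k::field poly3} \<in> Proj3"
  by (simp add: Proj3_def hom_prime_def pvar_nonzero)

text \<open>A point of the plane omits some coordinate, and by primality it omits all powers of this
  coordinate. These serve as denominators of any prescribed degree.\<close>

lemma Proj3_form:
  assumes "(p :: 'k::field poly3 set) \<in> Proj3"
  obtains l where "homogeneous n l" "l \<notin> p"
proof -
  obtain i where "pvar i \<notin> p" "hom_prime p" using assms by (auto simp: Proj3_def)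
  then have "pvar i ^ n \<notin> p" by (simp add: hom_prime_power)
  moreover have "homogeneous n (pvar i ^ n :: 'k poly3)" using homogeneous_power[OF homogeneous_pvar[of i, where 'k = 'k], of n] by simp
  ultimately show ?thesis using that by blast
qed

lemma twist_stalkI:
  "homogeneous m g \<Longrightarrow> homogeneous n h \<Longrightarrow> h \<notin> p \<Longrightarrow> int m = int n + a \<Longrightarrow> Fract g h \<in> twist_stalk a p"
  unfolding twist_stalk_def by blast

lemma twist_stalkE:
  assumes "f \<in> twist_stalk a p"
  obtains g h m n where "homogeneous m g" "homogeneous n h" "h \<notin> p" "int m = int n + a" "f = Fract g h"
  using assms unfolding twist_stalk_def by blast

lemma twist_stalk_add:
  assumes "p \<in> Proj3" "f \<in> twist_stalk a p" "g \<in> twist_stalk a p"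
  shows "f + g \<in> twist_stalk a p"
proof -
  note p = Proj3_hom_prime[OF assms(1)]
  obtain u v m n where f: "homogeneous m u" "homogeneous n v" "v \<notin> p" "int m = int n + a" "f = Fract u v"
    using assms(2) by (rule twist_stalkE)
  obtain u' v' m' n' where g: "homogeneous m' u'" "homogeneous n' v'" "v' \<notin> p" "int m' = int n' + a" "g = Fract u' v'"
    using assms(3) by (rule twist_stalkE)
  have "m' + n = m + n'" using f(4) g(4) by linarith
  then have "homogeneous (m + n') (u * v' + u' * v)"
    using homogeneous_mult[OF f(1) g(2)] homogeneous_mult[OF g(1) f(2)] by (auto intro: homogeneous_add)
  moreover have "homogeneous (n + n') (v * v')" using homogeneous_mult[OF f(2) g(2)] .
  moreover have "v * v' \<notin> p" using f g by (simp add: hom_prime_mult_iff[OF p])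
  ultimately have "Fract (u * v' + u' * v) (v * v') \<in> twist_stalk a p"
    by (rule twist_stalkI) (use f(4) in simp)
  moreover have "v \<noteq> 0" "v' \<noteq> 0" using f(3) g(3) hom_prime_zero[OF p] by auto
  ultimately show ?thesis unfolding f(5) g(5) by simp
qed

lemma twist_stalk_mult:
  assumes "p \<in> Proj3" "f \<in> twist_stalk a p" "g \<in> twist_stalk b p"
  shows "f * g \<in> twist_stalk (a + b) p"
proof -
  note p = Proj3_hom_prime[OF assms(1)]
  obtain u v m n where f: "homogeneous m u" "homogeneous n v" "v \<notin> p" "int m = int n + a" "f = Fract u v"
    using assms(2) by (rule twist_stalkE)
  obtain u' v' m' n' where g: "homogeneous m' u'" "homogeneous n' v'" "v' \<notin> p" "int m' = int n' + b" "g = Fract u' v'"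
    using assms(3) by (rule twist_stalkE)
  have "v * v' \<notin> p" using f g by (simp add: hom_prime_mult_iff[OF p])
  with homogeneous_mult[OF f(1) g(1)] homogeneous_mult[OF f(2) g(2)]
  have "Fract (u * u') (v * v') \<in> twist_stalk (a + b) p"
    by (rule twist_stalkI) (use f(4) g(4) in simp)
  then show ?thesis unfolding f(5) g(5) by simp
qed

lemma twist_stalk_mult_eq:
  "p \<in> Proj3 \<Longrightarrow> f \<in> twist_stalk a p \<Longrightarrow> g \<in> twist_stalk b p \<Longrightarrow> c = a + b \<Longrightarrow> f * g \<in> twist_stalk c p"
  by (simp add: twist_stalk_mult)

lemma twist_stalk_form: "p \<in> Proj3 \<Longrightarrow> homogeneous n h \<Longrightarrow> Fract h 1 \<in> twist_stalk (int n) p"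
  by (rule twist_stalkI[where n = 0]) (simp_all add: homogeneous_one hom_prime_one Proj3_hom_prime)

lemma twist_stalk_inverse_form:
  "homogeneous n h \<Longrightarrow> h \<notin> p \<Longrightarrow> Fract 1 h \<in> twist_stalk (- int n) p"
  by (rule twist_stalkI[where m = 0]) (simp_all add: homogeneous_one)

lemma twist_stalk_one: "p \<in> Proj3 \<Longrightarrow> 1 \<in> twist_stalk 0 p"
  using twist_stalk_form[of p 0 1] by (simp add: homogeneous_one One_fract_def)

lemma twist_stalk_zero:
  assumes "p \<in> Proj3"
  shows "0 \<in> twist_stalk a p"
proof -
  obtain l where l: "homogeneous (nat (- a)) l" "l \<notin> p" using assms by (rule Proj3_form)
  have "Fract 0 l \<in> twist_stalk a p"
    by (rule twist_stalkI[OF homogeneous_zero[of "nat a"] l]) simp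
  then show ?thesis by (simp add: fract_collapse)
qed

lemma twist_stalk_uminus: "p \<in> Proj3 \<Longrightarrow> f \<in> twist_stalk a p \<Longrightarrow> - f \<in> twist_stalk a p"
  by (elim twist_stalkE) (auto intro!: twist_stalkI homogeneous_uminus)

lemma twist_stalk_diff:
  "p \<in> Proj3 \<Longrightarrow> f \<in> twist_stalk a p \<Longrightarrow> g \<in> twist_stalk a p \<Longrightarrow> f - g \<in> twist_stalk a p"
  using twist_stalk_add[of p f a "- g"] twist_stalk_uminus[of p g a] by simp

lemma twist_stalk_sum:
  "p \<in> Proj3 \<Longrightarrow> (\<And>i. i \<in> S \<Longrightarrow> f i \<in> twist_stalk a p) \<Longrightarrow> (\<Sum>i\<in>S. f i) \<in> twist_stalk a p"
  by (induction S rule: infinite_finite_induct) (simp_all add: twist_stalk_zero twist_stalk_add)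

lemma Fract_eq_0_iff: "b \<noteq> 0 \<Longrightarrow> Fract a b = 0 \<longleftrightarrow> a = (0 :: 'a::idom)"
  by (simp add: Zero_fract_def eq_fract)

text \<open>Local triviality of O(a): a power of a coordinate that is nonzero at p, or its inverse,
  generates the stalk. Multiplying by u moves between degree a and degree 0 without leaving the
  stalks at p.\<close>

lemma twist_stalk_unit:
  assumes "p \<in> Proj3"
  obtains u where "u \<noteq> 0" "u \<in> twist_stalk a p" "inverse u \<in> twist_stalk (- a) p"
proof -
  obtain l where l: "homogeneous (nat \<bar>a\<bar>) l" "l \<notin> p" using assms by (rule Proj3_form)
  then have nz: "l \<noteq> 0" using hom_prime_zero[OF Proj3_hom_prime[OF assms]] by auto
  note tw = twist_stalk_form[OF assms l(1)] twist_stalk_inverse_form[OF l]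
  show ?thesis
  proof (cases "a \<ge> 0")
    case True
    then show ?thesis using that[of "Fract l 1"] tw nz by (simp add: Fract_eq_0_iff)
  next
    case False
    then show ?thesis using that[of "Fract 1 l"] tw nz by (simp add: Fract_eq_0_iff)
  qed
qed

lemma twist_stalk_generic_inverse:
  assumes "f \<in> twist_stalk a {0}" "f \<noteq> 0"
  shows "inverse f \<in> twist_stalk (- a) {0}"
proof -
  obtain u v m n where f: "homogeneous m u" "homogeneous n v" "v \<notin> {0}" "int m = int n + a" "f = Fract u v"
    using assms(1) by (rule twist_stalkE)
  moreover have "u \<noteq> 0" using assms(2) f(5) by (auto simp: fract_collapse)
  ultimately show ?thesis by (auto intro!: twist_stalkI)
qed

lemma homogeneous_prime_divisorE:
  assumes "homogeneous n (f :: 'k::field poly3)" "0 < n" "f \<noteq> 0"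
  obtains g m where "prime_elem g" "homogeneous m g" "0 < m" "g dvd f"
  using homogeneous_prime_divisor[OF assms] by metis

section \<open>Points of codimension one\<close>

lemma hcomp_mult_homogeneous:
  assumes "homogeneous m (g :: 'k::comm_ring_1 poly3)"
  shows "hcomp n (g * f) = (if m \<le> n then g * hcomp (n - m) f else 0)"
proof -
  have "hcomp n (g * f) = coeff (monom g m * grading f) n"
    by (simp add: grading.hom_mult grading_homogeneous[OF assms] flip: coeff_grading)
  then show ?thesis by (simp add: coeff_monom_mult coeff_grading)
qed

lemma hom_prime_principal:
  assumes "prime_elem g" "homogeneous m (g :: 'k::field poly3)"
  shows "hom_prime {f. g dvd f}"
  unfolding hom_prime_def
proof (intro conjI ballI allI impI)
  fix f n assume "f \<in> {f. g dvd f}"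
  then obtain h where "f = g * h" by (auto elim: dvdE)
  then show "hcomp n f \<in> {f. g dvd f}"
    by (simp add: hcomp_mult_homogeneous[OF assms(2)])
qed (use assms(1) in \<open>auto simp: prime_elem_def\<close>)

lemma homogeneous_degree_one_dvd:
  assumes "homogeneous 1 (f :: 'k::field poly3)" "homogeneous m g" "0 < m" "g dvd f" "f \<noteq> 0"
  obtains c where "c \<noteq> 0" "f = g * pconst c"
proof -
  obtain h where h: "f = g * h" using assms(4) by (elim dvdE)
  then have nz: "g \<noteq> 0" "h \<noteq> 0" using assms(5) by auto
  have "homogeneous 1 (g * h)" using assms(1) h by simp
  then obtain i j where ij: "homogeneous i g" "homogeneous j h" "i + j = 1"
    using nz by (rule homogeneous_factor)
  have "i = m" using homogeneous_unique[OF ij(1) assms(2) nz(1)] .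
  then have "homogeneous 0 h" using ij assms(3) by (cases j) auto
  then have c: "h = pconst (Poly_Mapping.lookup h 0)" by (rule homogeneous_0_imp_pconst)
  with nz(2) have "Poly_Mapping.lookup h 0 \<noteq> 0" by auto
  with c h show ?thesis using that by metis
qed

lemma lookup_pvar_mult_pconst:
  "Poly_Mapping.lookup (pvar i * pconst c) (Poly_Mapping.single j 1) = (if i = j then c else (0::'k::comm_ring_1))"
proof -
  have "Poly_Mapping.single i (1::nat) = Poly_Mapping.single j 1 \<longleftrightarrow> i = j"
    by (metis lookup_single_eq lookup_single_not_eq zero_neq_one)
  then show ?thesis by (simp add: pvar_def mult_single lookup_single when_def)
qed

text \<open>If g divided two coordinates, both would be constant multiples of g, hence proportional.
  So the ideal of g omits a coordinate and is a point of the plane.\<close>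

lemma principal_Proj3:
  assumes "prime_elem g" "homogeneous m (g :: 'k::field poly3)" "0 < m"
  shows "{f. g dvd f} \<in> Proj3"
proof -
  have "\<not> (g dvd pvar 1 \<and> g dvd pvar 2)"
  proof
    assume "g dvd pvar 1 \<and> g dvd pvar 2"
    then obtain c d where cd: "c \<noteq> 0" "pvar 1 = g * pconst c" "d \<noteq> 0" "pvar 2 = g * pconst d"
      using homogeneous_degree_one_dvd[OF homogeneous_pvar assms(2,3)] pvar_nonzero by metis
    then have "pvar 1 * pconst d = pvar 2 * pconst c" by (simp add: mult_ac)
    then have "Poly_Mapping.lookup (pvar 1 * pconst d) (Poly_Mapping.single 1 1) =
        Poly_Mapping.lookup (pvar 2 * pconst c) (Poly_Mapping.single 1 1)" by simp
    then show False using cd(3) unfolding lookup_pvar_mult_pconst by simp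
  qed
  then show ?thesis using hom_prime_principal[OF assms(1,2)] by (auto simp: Proj3_def)
qed

lemma hom_prime_homogeneous_element:
  assumes "hom_prime p" "p \<noteq> {0}"
  obtains n f where "homogeneous n f" "f \<in> p" "f \<noteq> 0"
proof -
  obtain f where f: "f \<in> p" "f \<noteq> 0" using assms hom_prime_zero by blast
  obtain m where "Poly_Mapping.lookup f m \<noteq> 0" using f(2) by (metis lookup_zero poly_mapping_eqI)
  then have "Poly_Mapping.lookup (hcomp (tdeg m) f) m \<noteq> 0" by (simp add: lookup_hcomp)
  then have "hcomp (tdeg m) f \<noteq> 0" by auto
  then show ?thesis using that homogeneous_hcomp hom_prime_hcomp[OF assms(1) f(1)] by blast
qed

lemma principal_subset:
  assumes "hom_prime p" "g \<in> p"
  shows "{f. g dvd f} \<subseteq> p"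
  using assms by (auto simp: hom_prime_mult_iff elim!: dvdE)

text \<open>Let q be a nonzero homogeneous prime inside the ideal of g. A nonzero form in q is g
  times a form of smaller degree, and primality puts g or the cofactor into q. Descent on the degree
  ends with g in q.\<close>

lemma codim_one_principal:
  assumes "prime_elem g" "homogeneous m (g :: 'k::field poly3)" "0 < m"
  shows "codim_one {f. g dvd f}"
  unfolding codim_one_def
proof (intro conjI ballI impI)
  show "{f. g dvd f} \<in> Proj3" using assms by (rule principal_Proj3)
  have "g \<noteq> 0" using assms(1) by auto
  moreover have "g \<in> {f. g dvd f}" by simp
  ultimately show "{f. g dvd f} \<noteq> {0}" by blast
  fix q :: "'k poly3 set" assume q: "q \<in> Proj3" "q \<subseteq> {f. g dvd f}"
  note hq = Proj3_hom_prime[OF q(1)]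
  have "g \<in> q" if "homogeneous n f" "f \<in> q" "f \<noteq> 0" for n f
    using that
  proof (induction n arbitrary: f rule: less_induct)
    case (less n)
    have "g dvd f" using less.prems(2) q(2) by blast
    then obtain h where h: "f = g * h" by (elim dvdE)
    then have nz: "h \<noteq> 0" using less.prems(3) by auto
    have "homogeneous n (g * h)" using less.prems(1) h by simp
    then obtain i j where ij: "homogeneous i g" "homogeneous j h" "i + j = n"
      using \<open>g \<noteq> 0\<close> nz by (rule homogeneous_factor)
    have "i = m" using homogeneous_unique[OF ij(1) assms(2) \<open>g \<noteq> 0\<close>] .
    then have "j < n" using ij assms(3) by simp
    moreover have "g \<in> q \<or> h \<in> q" using less.prems(2) h hom_prime_mult_iff[OF hq] by simp
    ultimately show ?case using less.IH[OF _ ij(2) _ nz] by blast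
  qed
  then show "q = {0} \<or> q = {f. g dvd f}"
    using hom_prime_homogeneous_element[OF hq] principal_subset[OF hq] q(2) by (metis subset_antisym)
qed

lemma codim_one_eq_principal:
  assumes "codim_one p" "prime_elem g" "homogeneous m (g :: 'k::field poly3)" "0 < m" "g \<in> p"
  shows "p = {f. g dvd f}"
proof -
  have "{f. g dvd f} \<subseteq> p"
    using principal_subset[OF Proj3_hom_prime[OF codim_one_Proj3[OF assms(1)]] assms(5)] .
  moreover have "g \<in> {f. g dvd f}" "g \<noteq> 0" using assms(2) by auto
  then have "{f. g dvd f} \<noteq> {0}" by blast
  ultimately show ?thesis
    using assms(1) principal_Proj3[OF assms(2-4)] unfolding codim_one_def by metis
qed

lemma hom_prime_homogeneous_0:
  assumes "hom_prime (p :: 'k::field poly3 set)" "homogeneous 0 f" "f \<in> p"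
  shows "f = 0"
proof (rule ccontr)
  assume "f \<noteq> 0"
  then obtain g where "1 = f * g" using homogeneous_0_dvd_1[OF assms(2)] by (auto elim: dvdE)
  then show False using assms(3) hom_prime_one[OF assms(1)] hom_prime_mult_iff[OF assms(1), of f g] by simp
qed

lemma hom_prime_prime_element:
  assumes "hom_prime (p :: 'k::field poly3 set)" "homogeneous n f" "f \<in> p" "f \<noteq> 0"
  shows "\<exists>g m. prime_elem g \<and> homogeneous m g \<and> 0 < m \<and> g \<in> p"
  using assms(2-)
proof (induction n arbitrary: f rule: less_induct)
  case (less n)
  have "0 < n" using hom_prime_homogeneous_0[OF assms(1), of f] less.prems by (cases "n = 0") auto
  then obtain g m where g: "prime_elem g" "homogeneous m g" "0 < m" "g dvd f"
    using homogeneous_prime_divisorE[OF less.prems(1) _ less.prems(3)] by metis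
  then obtain h where h: "f = g * h" by (elim dvdE)
  then have nz: "g \<noteq> 0" "h \<noteq> 0" using less.prems(3) by auto
  have "homogeneous n (g * h)" using less.prems(1) h by simp
  then obtain i j where ij: "homogeneous i g" "homogeneous j h" "i + j = n"
    using nz by (rule homogeneous_factor)
  have "i = m" using homogeneous_unique[OF ij(1) g(2) nz(1)] .
  then have "j < n" using ij g(3) by simp
  show ?case
  proof (cases "g \<in> p")
    case True
    then show ?thesis using g(1-3) by metis
  next
    case False
    then have "h \<in> p" using less.prems(2) h hom_prime_mult_iff[OF assms(1), of g h] by simp
    then show ?thesis by (rule less.IH[OF \<open>j < n\<close> ij(2) _ nz(2)])
  qed
qed

text \<open>The converse of \<open>codim_one_principal\<close>, by factoriality: a nonzero
  homogeneous prime contains a nonzero form, hence a prime factor g of it, and minimality makes it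
  the ideal of g.\<close>

lemma codim_one_generator:
  assumes "codim_one (p :: 'k::field poly3 set)"
  obtains g m where "prime_elem g" "homogeneous m g" "0 < m" "p = {f. g dvd f}"
proof -
  have hp: "hom_prime p" "p \<noteq> {0}"
    using assms Proj3_hom_prime unfolding codim_one_def by blast+
  then obtain n f where "homogeneous n f" "f \<in> p" "f \<noteq> 0" by (rule hom_prime_homogeneous_element)
  then obtain g m where g: "prime_elem g" "homogeneous m g" "0 < m" "g \<in> p"
    using hom_prime_prime_element[OF hp(1)] by metis
  show ?thesis by (rule that[OF g(1-3) codim_one_eq_principal[OF assms g]])
qed

lemma codim_one_exists: "\<exists>p :: 'k::field poly3 set. codim_one p"
proof -
  have "\<exists>g m. prime_elem g \<and> homogeneous m g \<and> 0 < m \<and> g dvd (pvar 1 :: 'k poly3)"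
    by (rule homogeneous_prime_divisor[OF homogeneous_pvar _ pvar_nonzero]) simp
  then show ?thesis using codim_one_principal by metis
qed

text \<open>These points are the prime factors of f: each induction step splits off one prime form
  and accounts for one point.\<close>

lemma finite_codim_one_containing:
  assumes "homogeneous n (f :: 'k::field poly3)" "f \<noteq> 0"
  shows "finite {p. codim_one p \<and> f \<in> p}"
  using assms
proof (induction n arbitrary: f rule: less_induct)
  case (less n)
  show ?case
  proof (cases "n = 0")
    case True
    then have "{p. codim_one p \<and> f \<in> p} = {}"
      using less.prems hom_prime_homogeneous_0 Proj3_hom_prime codim_one_Proj3 by blast
    then show ?thesis by (simp only: finite.emptyI)
  next
    case False
    then have "0 < n" by simp
    then obtain g m where g: "prime_elem g" "homogeneous m g" "0 < m" "g dvd f"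
      using homogeneous_prime_divisorE[OF less.prems(1) _ less.prems(2)] by metis
    then obtain h where h: "f = g * h" by (elim dvdE)
    then have nz: "g \<noteq> 0" "h \<noteq> 0" using less.prems(2) by auto
    have "homogeneous n (g * h)" using less.prems(1) h by simp
    then obtain i j where ij: "homogeneous i g" "homogeneous j h" "i + j = n"
      using nz by (rule homogeneous_factor)
    have "i = m" using homogeneous_unique[OF ij(1) g(2) nz(1)] .
    then have "j < n" using ij g(3) by simp
    then have "finite {p. codim_one p \<and> h \<in> p}" by (rule less.IH[OF _ ij(2) nz(2)])
    moreover have "{p. codim_one p \<and> f \<in> p} \<subseteq> insert {f. g dvd f} {p. codim_one p \<and> h \<in> p}"
    proof
      fix p assume "p \<in> {p. codim_one p \<and> f \<in> p}"
      then have p: "codim_one p" "g * h \<in> p" using h by auto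
      then have "g \<in> p \<or> h \<in> p"
        by (simp add: hom_prime_mult_iff[OF Proj3_hom_prime[OF codim_one_Proj3]])
      then show "p \<in> insert {f. g dvd f} {p. codim_one p \<and> h \<in> p}"
        using p(1) codim_one_eq_principal[OF p(1) g(1-3)] by (metis insertCI mem_Collect_eq)
    qed
    ultimately show ?thesis by (meson finite_insert finite_subset)
  qed
qed

text \<open>If a prime g divides the denominator, regularity at the point of g forces g to divide
  the numerator as well. Cancelling g lowers the degree of the denominator until it is constant. In
  particular a nonzero section exists only for nonnegative a, which is the source of the uniqueness
  of Chern classes.\<close>

lemma Fract_no_poles:
  assumes "\<And>p. codim_one p \<Longrightarrow> Fract P Q \<in> twist_stalk a p"
    and "homogeneous n Q" "homogeneous m (P :: 'k::field poly3)" "P \<noteq> 0" "Q \<noteq> 0" "int m = int n + a"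
  shows "\<exists>R r. Fract P Q = Fract R 1 \<and> homogeneous r R \<and> int r = a"
  using assms
proof (induction n arbitrary: P Q m rule: less_induct)
  case (less n)
  show ?case
  proof (cases "n = 0")
    case True
    then obtain S where S: "1 = Q * S" using homogeneous_0_dvd_1[of Q] less.prems by (auto elim: dvdE)
    have "S \<noteq> 0" "Q \<noteq> 0" using S by auto
    moreover have "homogeneous 0 (Q * S)" using S homogeneous_one by simp
    ultimately obtain i j where "homogeneous j S" "i + j = 0" using homogeneous_factor by metis
    then have "homogeneous m (P * S)" using homogeneous_mult[OF less.prems(3), of j S] by simp
    moreover have "Fract P Q = Fract (P * S) 1"
    proof -
      have "P * 1 = P * S * Q" by (simp add: S mult_ac)
      then show ?thesis using less.prems(5) by (simp only: eq_fract(1) one_neq_zero not_False_eq_True)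
    qed
    moreover have "int m = a" using less.prems(6) True by simp
    ultimately show ?thesis by blast
  next
    case False
    then have "0 < n" by simp
    then obtain g k where g: "prime_elem g" "homogeneous k g" "0 < k" "g dvd Q"
      using homogeneous_prime_divisorE[OF less.prems(2) _ less.prems(5)] by metis
    then obtain Q1 where Q1: "Q = g * Q1" by (elim dvdE)
    let ?p = "{f. g dvd f}"
    obtain u v where uv: "v \<notin> ?p" "Fract P Q = Fract u v"
      using twist_stalkE[OF less.prems(1)[OF codim_one_principal[OF g(1-3)]]] by metis
    then have "v \<noteq> 0" by auto
    then have "P * v = u * Q" using uv(2) less.prems(5) by (simp add: eq_fract)
    then have "g dvd P * v" using g(4) by simp
    then have "g dvd P" using uv(1) g(1) by (simp add: prime_elem_dvd_mult_iff)
    then obtain P1 where P1: "P = g * P1" by (elim dvdE)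
    have nz: "g \<noteq> 0" "P1 \<noteq> 0" "Q1 \<noteq> 0" using Q1 P1 less.prems by auto
    have eq: "Fract P Q = Fract P1 Q1" unfolding P1 Q1 using nz by (simp add: eq_fract mult_ac)
    have "homogeneous n (g * Q1)" using less.prems(2) Q1 by simp
    then obtain i j where ij: "homogeneous i g" "homogeneous j Q1" "i + j = n"
      using nz(1,3) by (rule homogeneous_factor)
    have "homogeneous m (g * P1)" using less.prems(3) P1 by simp
    then obtain i' j' where ij': "homogeneous i' g" "homogeneous j' P1" "i' + j' = m"
      using nz(1,2) by (rule homogeneous_factor)
    have "i = k" "i' = k" using homogeneous_unique[OF _ g(2) nz(1)] ij(1) ij'(1) by auto
    then have "j < n" "int j' = int j + a" using ij(3) ij'(3) g(3) less.prems(6) by auto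
    then show ?thesis
      unfolding eq using less.IH[of j P1 Q1 j'] less.prems(1) eq ij(2) ij'(2) nz by auto
  qed
qed

lemma no_poles_imp_polynomial:
  assumes "\<And>p. codim_one p \<Longrightarrow> f \<in> twist_stalk a p" "f \<noteq> 0"
  obtains R r where "f = Fract R (1 :: 'k::field poly3)" "homogeneous r R" "int r = a"
proof -
  obtain p :: "'k poly3 set" where p: "codim_one p" using codim_one_exists by blast
  then obtain P Q m n where PQ: "homogeneous m P" "homogeneous n Q" "Q \<notin> p" "int m = int n + a" "f = Fract P Q"
    using twist_stalkE[OF assms(1)[OF p]] by metis
  have "P \<noteq> 0" using assms(2) PQ(5) by (auto simp: fract_collapse)
  moreover have "Q \<noteq> 0" using PQ(3) p hom_prime_zero Proj3_hom_prime codim_one_Proj3 by blast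
  ultimately show ?thesis using Fract_no_poles[of P Q a n m] assms(1) PQ that by auto
qed

section \<open>Fractional ideals and line bundles in codimension one\<close>

definition twist_span :: "int \<Rightarrow> 'k::field frac3 \<Rightarrow> 'k poly3 set \<Rightarrow> 'k frac3 set" where
  "twist_span a w p = {f * w | f. f \<in> twist_stalk a p}"

lemma twist_span_mult_unit:
  assumes "p \<in> Proj3" "u \<noteq> 0" "u \<in> twist_stalk b p" "inverse u \<in> twist_stalk (- b) p"
  shows "twist_span a (w * u) p = twist_span (a + b) w p"
proof (intro equalityI subsetI)
  fix x assume "x \<in> twist_span a (w * u) p"
  then obtain f where "f \<in> twist_stalk a p" "x = (f * u) * w"
    by (auto simp: twist_span_def mult_ac)
  then show "x \<in> twist_span (a + b) w p"
    unfolding twist_span_def using twist_stalk_mult[OF assms(1) _ assms(3)] by blast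
next
  fix x assume "x \<in> twist_span (a + b) w p"
  then obtain f where f: "f \<in> twist_stalk (a + b) p" "x = f * w"
    by (auto simp: twist_span_def)
  then have "x = (f * inverse u) * (w * u)" using assms(2) by simp
  moreover have "f * inverse u \<in> twist_stalk a p"
    by (rule twist_stalk_mult_eq[OF assms(1) f(1) assms(4)]) simp
  ultimately show "x \<in> twist_span a (w * u) p" unfolding twist_span_def by blast
qed

lemma Fract_power: "Fract (a ^ n) 1 = Fract (a :: 'a::idom) 1 ^ n"
proof (induction n)
  case (Suc n)
  then show ?case by (simp flip: Suc.IH)
qed (simp add: One_fract_def)

lemma power_divide_power_int:
  "(x :: 'a::field) \<noteq> 0 \<Longrightarrow> (x ^ k * a) / (x ^ l * b) = x powi (int k - int l) * (a / b)"
  by (simp add: power_int_diff)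

lemma Fract_nonzero: "a \<noteq> 0 \<Longrightarrow> Fract a 1 \<noteq> (0 :: 'a::idom fract)"
  by (simp add: Fract_eq_0_iff)

lemma form_prime_power:
  assumes "prime_elem g" "homogeneous m (g :: 'k::field poly3)" "0 < m" "homogeneous n f" "f \<noteq> 0"
  shows "\<exists>k j h. f = g ^ k * h \<and> \<not> g dvd h \<and> homogeneous j h \<and> n = k * m + j"
  using assms(4-)
proof (induction n arbitrary: f rule: less_induct)
  case (less n)
  show ?case
  proof (cases "g dvd f")
    case False
    then have "f = g ^ 0 * f \<and> \<not> g dvd f \<and> homogeneous n f \<and> n = 0 * m + n" using less.prems by simp
    then show ?thesis by metis
  next
    case True
    then obtain h where h: "f = g * h" by (elim dvdE)
    then have nz: "g \<noteq> 0" "h \<noteq> 0" using less.prems by auto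
    have "homogeneous n (g * h)" using less.prems(1) h by simp
    then obtain i j where ij: "homogeneous i g" "homogeneous j h" "i + j = n"
      using nz by (rule homogeneous_factor)
    have "i = m" using homogeneous_unique[OF ij(1) assms(2) nz(1)] .
    then have "j < n" using ij assms(3) by simp
    from less.IH[OF this ij(2) nz(2)] obtain k l h' where
      k: "h = g ^ k * h'" "\<not> g dvd h'" "homogeneous l h'" "j = k * m + l" by metis
    have "f = g ^ Suc k * h'" unfolding h k(1) by (simp add: mult.assoc)
    moreover have "n = Suc k * m + l" using k(4) ij(3) \<open>i = m\<close> by simp
    ultimately show ?thesis using k(2,3) by metis
  qed
qed

context
  fixes g :: "'k::field poly3" and m :: nat and p :: "'k poly3 set"
  assumes prime: "prime_elem g" and hom: "homogeneous m g" and pos: "0 < m"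
    and p_eq: "p = {f. g dvd f}"
begin

lemma principal_in_Proj3: "p \<in> Proj3"
  unfolding p_eq using prime hom pos by (rule principal_Proj3)

lemma generator_nonzero: "Fract g 1 \<noteq> 0"
  using prime by (intro Fract_nonzero) auto

lemma generator_power: "Fract g 1 ^ n \<in> twist_stalk (int n * int m) p"
  using twist_stalk_form[OF principal_in_Proj3 homogeneous_power[OF hom, of n]] by (simp add: Fract_power)

text \<open>The exponent k is the order of f along the curve g = 0, obtained by splitting the powers
  of g off numerator and denominator. The rest y is a unit at p up to twist; its degree is a - km
  because g has degree m.\<close>

lemma fraction_valuation:
  assumes "f \<in> twist_stalk a {0}" "f \<noteq> 0"
  shows "\<exists>k y. f = Fract g 1 powi k * y \<and> y \<noteq> 0 \<and> y \<in> twist_stalk (a - k * int m) p \<and>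
    inverse y \<in> twist_stalk (k * int m - a) p"
proof -
  obtain P Q i j where PQ: "homogeneous i P" "homogeneous j Q" "Q \<notin> {0}" "int i = int j + a" "f = Fract P Q"
    using assms(1) by (rule twist_stalkE)
  have nz: "P \<noteq> 0" "Q \<noteq> 0" using PQ(3,5) assms(2) by (auto simp: fract_collapse)
  obtain k r P' where P': "P = g ^ k * P'" "\<not> g dvd P'" "homogeneous r P'" "i = k * m + r"
    using form_prime_power[OF prime hom pos PQ(1) nz(1)] by metis
  obtain l s Q' where Q': "Q = g ^ l * Q'" "\<not> g dvd Q'" "homogeneous s Q'" "j = l * m + s"
    using form_prime_power[OF prime hom pos PQ(2) nz(2)] by metis
  have nz': "P' \<noteq> 0" "Q' \<noteq> 0" using P'(2) Q'(2) by auto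
  have "f = Fract P 1 / Fract Q 1" by (simp add: PQ(5))
  also have "\<dots> = (Fract g 1 ^ k * Fract P' 1) / (Fract g 1 ^ l * Fract Q' 1)"
    unfolding P'(1) Q'(1) by (simp flip: Fract_power)
  also have "\<dots> = Fract g 1 powi (int k - int l) * (Fract P' 1 / Fract Q' 1)"
    using generator_nonzero by (rule power_divide_power_int)
  also have "Fract P' 1 / Fract Q' 1 = Fract P' Q'" by simp
  finally have "f = Fract g 1 powi (int k - int l) * Fract P' Q'" .
  moreover have "Fract P' Q' \<noteq> 0" using nz' by (simp add: Fract_eq_0_iff)
  moreover have "Fract P' Q' \<in> twist_stalk (a - (int k - int l) * int m) p"
    using PQ(4) P' Q' by (intro twist_stalkI[OF P'(3) Q'(3)]) (auto simp: p_eq algebra_simps)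
  moreover have "Fract Q' P' \<in> twist_stalk ((int k - int l) * int m - a) p"
    using PQ(4) P' Q' by (intro twist_stalkI[OF Q'(3) P'(3)]) (auto simp: p_eq algebra_simps)
  ultimately show ?thesis by (metis inverse_fract)
qed

text \<open>A negative power of g times a unit would be regular at p, and multiplying by further
  powers of g would make 1/g itself regular there.\<close>

lemma generator_power_int_nonneg:
  assumes "Fract g 1 powi k * y \<in> twist_stalk b p" "y \<noteq> 0" "inverse y \<in> twist_stalk c p"
  shows "0 \<le> k"
proof (rule ccontr)
  assume "\<not> 0 \<le> k"
  \<comment> \<open>Chosen so that g^k g^j = 1/g.\<close>
  define j where "j = nat (- k) - 1"
  have k: "k = - int (Suc j)" using \<open>\<not> 0 \<le> k\<close> by (simp add: j_def)
  have "(Fract g 1 powi k * y) * inverse y \<in> twist_stalk (b + c) p"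
    using twist_stalk_mult[OF principal_in_Proj3 assms(1,3)] .
  moreover have "(Fract g 1 powi k * y) * inverse y = Fract g 1 powi k" using assms(2) by (simp add: mult.assoc)
  ultimately have "Fract g 1 powi k \<in> twist_stalk (b + c) p" by simp
  then have "Fract g 1 powi k * Fract g 1 ^ j \<in> twist_stalk (b + c + int j * int m) p"
    using twist_stalk_mult[OF principal_in_Proj3 _ generator_power] by blast
  also have "Fract g 1 powi k * Fract g 1 ^ j = inverse (Fract g 1)"
    unfolding k power_int_minus power_int_of_nat using generator_nonzero by (simp add: field_simps)
  finally obtain u v where uv: "v \<notin> p" "Fract 1 g = Fract u v"
    by (auto elim: twist_stalkE)
  moreover have "v \<noteq> 0" "g \<noteq> 0" using uv(1) prime by (auto simp: p_eq)
  ultimately have "v = u * g" by (simp add: eq_fract)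
  then show False using uv(1) by (simp add: p_eq)
qed

text \<open>The local ring at p is a discrete valuation ring with uniformizer g, up to twist. The
  form V bounds the denominators in I, hence the orders of its elements from below. An element of
  least order then generates I, and it can be replaced by the pure power of g.\<close>

lemma fractional_ideal_codim_one:
  assumes I: "I \<subseteq> twist_stalk 0 {0}" "\<And>c x. c \<in> twist_stalk 0 p \<Longrightarrow> x \<in> I \<Longrightarrow> c * x \<in> I"
    and x0: "x0 \<in> I" "x0 \<noteq> 0"
    and V: "V \<noteq> 0" "homogeneous v V" "\<And>x. x \<in> I \<Longrightarrow> Fract V 1 * x \<in> twist_stalk (int v) p"
  shows "\<exists>k. I = twist_span (- k * int m) (Fract g 1 powi k) p"
proof -
  note p3 = principal_in_Proj3
  let ?G = "Fract g 1"
  define S where "S = {k. \<exists>y. ?G powi k * y \<in> I \<and> y \<noteq> 0 \<and> y \<in> twist_stalk (- k * int m) p \<and>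
    inverse y \<in> twist_stalk (k * int m) p}"
  have val: "\<exists>k\<in>S. \<exists>y. x = ?G powi k * y \<and> y \<in> twist_stalk (- k * int m) p" if "x \<in> I" "x \<noteq> 0" for x
  proof -
    have "x \<in> twist_stalk 0 {0}" using I(1) that(1) by blast
    from fraction_valuation[OF this that(2)] obtain k y where ky: "x = ?G powi k * y" "y \<noteq> 0"
      "y \<in> twist_stalk (- k * int m) p" "inverse y \<in> twist_stalk (k * int m) p" by auto
    have "k \<in> S" unfolding S_def using ky that(1) by auto
    then show ?thesis using ky by blast
  qed
  have "Fract V 1 \<in> twist_stalk (int v) {0}" using twist_stalk_form[OF zero_Proj3 V(2)] .
  from fraction_valuation[OF this Fract_nonzero[OF V(1)]] obtain l z where z: "Fract V 1 = ?G powi l * z" "z \<noteq> 0"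
    "z \<in> twist_stalk (int v - l * int m) p" "inverse z \<in> twist_stalk (l * int m - int v) p" by metis
  \<comment> \<open>Here l is the order of V along the curve, and V times an element of order k is
    regular.\<close>
  have bound: "0 \<le> l + k" if k: "k \<in> S" for k
  proof -
    obtain y where y: "?G powi k * y \<in> I" "y \<noteq> 0" "inverse y \<in> twist_stalk (k * int m) p"
      using k unfolding S_def by blast
    have "?G powi (l + k) * (z * y) = Fract V 1 * (?G powi k * y)"
      unfolding z(1) using generator_nonzero by (simp add: power_int_add mult_ac)
    then have "?G powi (l + k) * (z * y) \<in> twist_stalk (int v) p" using V(3)[OF y(1)] by (simp only:)
    moreover have "inverse (z * y) \<in> twist_stalk (l * int m - int v + k * int m) p"
      using twist_stalk_mult[OF p3 z(4) y(3)] by simp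
    ultimately show ?thesis using generator_power_int_nonneg[of "l + k" "z * y"] z(2) y(2) by auto
  qed
  obtain k1 where "k1 \<in> S" using val[OF x0] by blast
  \<comment> \<open>By \<open>bound\<close> the numbers l + k are nonnegative, so a least one
    exists.\<close>
  from ex_has_least_nat[of "\<lambda>k. k \<in> S" k1 "\<lambda>k. nat (l + k)", OF this]
  obtain k0 where k0: "k0 \<in> S" "\<And>k. k \<in> S \<Longrightarrow> nat (l + k0) \<le> nat (l + k)" by metis
  have least: "k0 \<le> k" if "k \<in> S" for k
    using k0(2)[OF that] bound[OF that] bound[OF k0(1)] by simp
  obtain y0 where y0: "?G powi k0 * y0 \<in> I" "y0 \<noteq> 0" "inverse y0 \<in> twist_stalk (k0 * int m) p"
    using k0(1) unfolding S_def by blast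
  have "I = twist_span (- k0 * int m) (?G powi k0) p"
  proof (intro equalityI subsetI)
    fix x assume x: "x \<in> I"
    show "x \<in> twist_span (- k0 * int m) (?G powi k0) p"
    proof (cases "x = 0")
      case True
      then have "x = 0 * ?G powi k0" by simp
      then show ?thesis unfolding twist_span_def using twist_stalk_zero[OF p3] by blast
    next
      case False
      then obtain k y where k: "k \<in> S" "x = ?G powi k * y" "y \<in> twist_stalk (- k * int m) p"
        using val[OF x] by blast
      have "?G powi k = ?G powi (k - k0) * ?G powi k0"
        using generator_nonzero by (simp flip: power_int_add)
      moreover have "?G powi (k - k0) = ?G ^ nat (k - k0)"
        using least[OF k(1)] by (simp add: power_int_def)
      ultimately have "x = (?G ^ nat (k - k0) * y) * ?G powi k0"
        unfolding k(2) by (simp add: mult_ac)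
      moreover have "?G ^ nat (k - k0) * y \<in> twist_stalk (- k0 * int m) p"
        by (rule twist_stalk_mult_eq[OF p3 generator_power k(3)])
          (use least[OF k(1)] in \<open>simp add: algebra_simps\<close>)
      ultimately show ?thesis unfolding twist_span_def by blast
    qed
  next
    fix x assume "x \<in> twist_span (- k0 * int m) (?G powi k0) p"
    then obtain f where f: "f \<in> twist_stalk (- k0 * int m) p" "x = f * ?G powi k0"
      by (auto simp: twist_span_def)
    have "x = (f * inverse y0) * (?G powi k0 * y0)" unfolding f(2) using y0(2) by simp
    moreover have "f * inverse y0 \<in> twist_stalk 0 p"
      by (rule twist_stalk_mult_eq[OF p3 f(1) y0(3)]) simp
    ultimately show "x \<in> I" using I(2) y0(1) by simp
  qed
  then show ?thesis by blast
qed

text \<open>Away from the curve g = 0, a power of g is a unit up to twist. So a power of g used as a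
  generator at p leaves the stalks at all other points of codimension one trivial, as
  \<open>divisor_principal\<close> demands.\<close>

lemma generator_power_int_unit:
  assumes "q \<in> Proj3" "g \<notin> q"
  shows "Fract g 1 powi k \<in> twist_stalk (k * int m) q"
proof (cases "0 \<le> k")
  case True
  then have k: "k = int (nat k)" by simp
  show ?thesis
    using twist_stalk_form[OF assms(1) homogeneous_power[OF hom, of "nat k"]] k
    by (metis Fract_power of_nat_mult power_int_of_nat)
next
  case False
  have "g ^ nat (- k) \<notin> q" using hom_prime_power[OF Proj3_hom_prime[OF assms(1)] assms(2)] .
  from twist_stalk_inverse_form[OF homogeneous_power[OF hom] this]
  have "Fract 1 (g ^ nat (- k)) \<in> twist_stalk (k * int m) q"
    using False by simp
  also have "Fract 1 (g ^ nat (- k)) = inverse (Fract g 1 ^ nat (- k))"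
    by (simp flip: Fract_power)
  also have "\<dots> = Fract g 1 powi k"
    using False by (simp add: power_int_def power_inverse del: inverse_fract)
  finally show ?thesis .
qed

end

text \<open>For \<open>p \<in> S\<close>, the stalk at \<open>p\<close> of the line bundle of a divisor supported on \<open>S\<close> is \<open>J p\<close>.\<close>

lemma divisor_principal:
  fixes J :: "'k::field poly3 set \<Rightarrow> 'k frac3 set"
  assumes "finite S"
    and "\<And>p. p \<in> S \<Longrightarrow> codim_one p \<and> (\<exists>c b. c \<noteq> 0 \<and> J p = twist_span b c p \<and>
      (\<forall>q. codim_one q \<longrightarrow> q \<noteq> p \<longrightarrow> c \<in> twist_stalk (- b) q \<and> inverse c \<in> twist_stalk b q))"
  shows "\<exists>w a. w \<noteq> 0 \<and>
    (\<forall>q. codim_one q \<longrightarrow> twist_span a w q = (if q \<in> S then J q else twist_stalk 0 q))"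
  using assms
proof (induction S rule: finite_induct)
  case empty
  have "twist_span 0 1 q = twist_stalk 0 q" for q :: "'k poly3 set"
    by (simp add: twist_span_def)
  then show ?case by (metis empty_iff zero_neq_one)
next
  case (insert p S)
  have "p \<in> insert p S" by simp
  from insert.prems[OF this] obtain c b where p: "codim_one p" and cb: "c \<noteq> 0" "J p = twist_span b c p"
    "\<And>q. codim_one q \<Longrightarrow> q \<noteq> p \<Longrightarrow> c \<in> twist_stalk (- b) q \<and> inverse c \<in> twist_stalk b q"
    by metis
  have "\<exists>w a. w \<noteq> 0 \<and>
      (\<forall>q. codim_one q \<longrightarrow> twist_span a w q = (if q \<in> S then J q else twist_stalk 0 q))"
    by (rule insert.IH, rule insert.prems) simp
  then obtain w a where w: "w \<noteq> 0"
    "\<forall>q. codim_one q \<longrightarrow> twist_span a w q = (if q \<in> S then J q else twist_stalk 0 q)"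
    by (elim exE conjE)
  \<comment> \<open>The solution for S is multiplied by the local generator c at p. As c is a unit
    at every other point, only the stalk at p changes.\<close>
  have "twist_span (a + b) (w * c) q = (if q \<in> insert p S then J q else twist_stalk 0 q)" if q: "codim_one q" for q
  proof (cases "q = p")
    case False
    have "twist_span (a + b) (w * c) q = twist_span (a + b + - b) w q"
      using cb(1) cb(3)[OF q False] by (intro twist_span_mult_unit codim_one_Proj3 q) auto
    then show ?thesis using w(2) q False by simp
  next
    case True
    have p3: "p \<in> Proj3" using codim_one_Proj3[OF p] .
    have eq: "twist_span a w p = twist_stalk 0 p" using w(2) p insert.hyps(2) by simp
    then obtain f where f: "f \<in> twist_stalk a p" "1 = f * w"
      using twist_stalk_one[OF p3] unfolding twist_span_def by blast
    have inv: "inverse w = f" using f(2) w(1) by (simp add: field_simps)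
    obtain u where u: "u \<noteq> 0" "u \<in> twist_stalk a p" "inverse u \<in> twist_stalk (- a) p"
      using twist_stalk_unit[OF p3] by metis
    have "u * w \<in> twist_stalk 0 p" using u(2) eq unfolding twist_span_def by blast
    then have "inverse u * (u * w) \<in> twist_stalk (- a) p" by (rule twist_stalk_mult_eq[OF p3 u(3)]) simp
    moreover have "inverse u * (u * w) = w" using u(1) by simp
    ultimately have "w \<in> twist_stalk (- a) p" by (simp only:)
    then have "twist_span (a + b) (c * w) p = twist_span (a + b + - a) c p"
      using f(1) inv w(1) by (intro twist_span_mult_unit[OF p3]) auto
    then show ?thesis using True cb(2) by (simp add: mult.commute)
  qed
  moreover have "w * c \<noteq> 0" using w(1) cb(1) by simp
  ultimately show ?case by blast
qed

section \<open>Stalks and first Chern classes\<close>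

definition basic_open :: "'k::field poly3 \<Rightarrow> 'k poly3 set set" where
  "basic_open f = {p \<in> Proj3. f \<notin> p}"

text \<open>The basic open sets are closed under finite intersection: by primality the product of
  two forms is nonzero at p exactly when both are. So they form a basis and not only a
  subbasis.\<close>

lemma generated_basic_open:
  assumes "generate_topology_on {basic_open f | f. \<exists>n. homogeneous n f} U" "p \<in> U"
  shows "p \<in> Proj3 \<and> (\<exists>n f. homogeneous n f \<and> f \<notin> p \<and> basic_open f \<subseteq> U)"
  using assms
proof (induction rule: generate_topology_on.induct)
  case (Int a b)
  obtain n f where f: "homogeneous n f" "f \<notin> p" "basic_open f \<subseteq> a" using Int by blast
  obtain m g where g: "homogeneous m g" "g \<notin> p" "basic_open g \<subseteq> b" using Int by blast
  have p: "p \<in> Proj3" using Int by blast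
  have "f * g \<notin> p" using f g p by (simp add: hom_prime_mult_iff Proj3_hom_prime)
  moreover have "basic_open (f * g) \<subseteq> a \<inter> b"
    using f(3) g(3) by (auto simp: basic_open_def hom_prime_mult_iff Proj3_hom_prime)
  ultimately show ?case using homogeneous_mult[OF f(1) g(1)] p by blast
next
  case (UN K)
  then show ?case by blast
next
  case (Basis s)
  then show ?case by (auto simp: basic_open_def)
qed simp

lemma zariski_eq: "zariski = topology_generated_by {basic_open f | f. \<exists>n. homogeneous n f}"
  by (simp add: zariski_def basic_open_def)

lemma zopen_subset_Proj3: "zopen U \<Longrightarrow> U \<subseteq> Proj3"
  unfolding zariski_eq openin_topology_generated_by_iff using generated_basic_open by blast

lemma zopen_contains_basic_open:
  assumes "zopen U" "p \<in> U"
  obtains n f where "homogeneous n f" "f \<notin> p" "basic_open f \<subseteq> U"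
proof -
  have "generate_topology_on {basic_open f | f. \<exists>n. homogeneous n f} U"
    using assms(1) unfolding zariski_eq openin_topology_generated_by_iff by simp
  from generated_basic_open[OF this assms(2)] obtain n f where
    "homogeneous n f" "f \<notin> p" "basic_open f \<subseteq> U" by (elim conjE exE)
  then show ?thesis by (rule that)
qed

lemma zero_in_basic_open: "f \<noteq> 0 \<Longrightarrow> {0} \<in> basic_open f"
  by (simp add: basic_open_def zero_Proj3)

lemma zopen_basic_open:
  assumes "homogeneous n f" "f \<noteq> 0"
  shows "zopen (basic_open f)"
proof
  show "openin zariski (basic_open f)"
    unfolding zariski_eq by (rule topology_generated_by_Basis) (use assms(1) in blast)
  show "basic_open f \<noteq> {}" using zero_in_basic_open[OF assms(2)] by blast
qed

text \<open>A basic open set around any point belongs to a nonzero form, which does not vanish at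
  the generic point either. Consequently nonempty open sets meet, and every stalk lies in the
  generic one.\<close>

lemma zero_in_zopen: "zopen U \<Longrightarrow> {0} \<in> U"
proof -
  assume U: "zopen U"
  then obtain p where p: "p \<in> U" by blast
  then obtain n f where f: "f \<notin> p" "basic_open f \<subseteq> U"
    using zopen_contains_basic_open[OF U] by metis
  have "f \<noteq> 0" using f(1) p U zopen_subset_Proj3 hom_prime_zero Proj3_hom_prime by blast
  then show "{0} \<in> U" using zero_in_basic_open f(2) by blast
qed

lemma zopen_Int: "zopen U \<Longrightarrow> zopen V \<Longrightarrow> zopen (U \<inter> V)"
  using zero_in_zopen by blast

lemma zopen_basic_open_not_in: "homogeneous n f \<Longrightarrow> f \<notin> p \<Longrightarrow> p \<in> Proj3 \<Longrightarrow> zopen (basic_open f) \<and> p \<in> basic_open f"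
  by (metis (lifting) Proj3_hom_prime basic_open_def hom_prime_zero mem_Collect_eq zopen_basic_open)

lemma exists_zopen:
  assumes "p \<in> Proj3"
  obtains U where "zopen U" "p \<in> U"
  using zopen_basic_open_not_in[OF homogeneous_one _ assms] hom_prime_one[OF Proj3_hom_prime[OF assms]] by blast

lemma stalkI: "zopen U \<Longrightarrow> p \<in> U \<Longrightarrow> s \<in> N U \<Longrightarrow> s \<in> stalk N p"
  unfolding stalk_def by blast

lemma stalkE:
  assumes "s \<in> stalk N p"
  obtains U where "zopen U" "p \<in> U" "s \<in> N U"
  using assms unfolding stalk_def by blast

lemma stalk_generic: "stalk N p \<subseteq> stalk N {0}"
  using zero_in_zopen by (auto elim!: stalkE intro: stalkI)

lemma module_sheaf_closed:
  assumes "module_sheaf N" "zopen U"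
  shows module_sheaf_zero: "0 \<in> N U"
    and module_sheaf_add: "s \<in> N U \<Longrightarrow> t \<in> N U \<Longrightarrow> s + t \<in> N U"
    and module_sheaf_scale: "c \<in> structure_sheaf U \<Longrightarrow> s \<in> N U \<Longrightarrow> c *s s \<in> N U"
  using assms(1)[unfolded module_sheaf_def, THEN conjunct1, THEN spec[of _ U], THEN mp, OF assms(2)]
  by simp_all

lemma module_sheaf_restrict: "module_sheaf N \<Longrightarrow> zopen U \<Longrightarrow> zopen V \<Longrightarrow> U \<subseteq> V \<Longrightarrow> s \<in> N V \<Longrightarrow> s \<in> N U"
  unfolding module_sheaf_def by blast

lemma stalk_zero:
  assumes "module_sheaf N" "p \<in> Proj3"
  shows "0 \<in> stalk N p"
proof -
  obtain U where "zopen U" "p \<in> U" using assms(2) by (rule exists_zopen)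
  then show ?thesis by (intro stalkI[of U] module_sheaf_zero[OF assms(1)])
qed

lemma stalk_add:
  assumes N: "module_sheaf N" and "s \<in> stalk N p" "t \<in> stalk N p"
  shows "s + t \<in> stalk N p"
proof -
  obtain U V where U: "zopen U" "p \<in> U" "s \<in> N U" and V: "zopen V" "p \<in> V" "t \<in> N V"
    using assms by (metis stalkE)
  have UV: "zopen (U \<inter> V)" using zopen_Int[OF U(1) V(1)] .
  have "s \<in> N (U \<inter> V)" using module_sheaf_restrict[OF N UV U(1)] U(3) by simp
  moreover have "t \<in> N (U \<inter> V)" using module_sheaf_restrict[OF N UV V(1)] V(3) by simp
  ultimately have "s + t \<in> N (U \<inter> V)" by (rule module_sheaf_add[OF N UV])
  then show ?thesis using UV U(2) V(2) by (intro stalkI) auto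
qed

lemma stalk_scale:
  assumes N: "module_sheaf N" and "p \<in> Proj3" "c \<in> twist_stalk 0 p" "s \<in> stalk N p"
  shows "c *s s \<in> stalk N p"
proof -
  obtain U where U: "zopen U" "p \<in> U" "s \<in> N U" using assms(4) by (rule stalkE)
  obtain g h m n where c: "homogeneous m g" "homogeneous n h" "h \<notin> p" "int m = int n + 0" "c = Fract g h"
    using assms(3) by (rule twist_stalkE)
  have h: "zopen (basic_open h)" "p \<in> basic_open h" using zopen_basic_open_not_in[OF c(2,3) assms(2)] by auto
  have Uh: "zopen (U \<inter> basic_open h)" using zopen_Int[OF U(1) h(1)] .
  have "s \<in> N (U \<inter> basic_open h)" using module_sheaf_restrict[OF N Uh U(1)] U(3) by simp
  moreover have "c \<in> structure_sheaf (U \<inter> basic_open h)"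
    unfolding structure_sheaf_def c(5) using twist_stalkI[OF c(1,2) _ c(4)] by (auto simp: basic_open_def)
  ultimately have "c *s s \<in> N (U \<inter> basic_open h)" by (intro module_sheaf_scale[OF N Uh])
  then show ?thesis using Uh U(2) h(2) by (intro stalkI) auto
qed

lemma stalk_sum:
  assumes "module_sheaf N" "p \<in> Proj3" "\<And>i. i \<in> S \<Longrightarrow> f i \<in> stalk N p"
  shows "(\<Sum>i\<in>S. f i) \<in> stalk N p"
  using assms(3) by (induction S rule: infinite_finite_induct)
    (simp_all add: stalk_zero[OF assms(1,2)] stalk_add[OF assms(1)])

text \<open>The consequence of \<open>finite_type\<close> for stalks, with coefficients in the local
  ring at each point of U in place of sections over a smaller open set.\<close>

definition stalk_generators :: "'k::field sheaf \<Rightarrow> 'k poly3 set set \<Rightarrow> ('k frac3 ^ 3) set \<Rightarrow> bool" where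
  "stalk_generators N U G \<longleftrightarrow> zopen U \<and> finite G \<and> G \<subseteq> N U \<and>
    (\<forall>q\<in>U. \<forall>s\<in>stalk N q. \<exists>c. (\<forall>g\<in>G. c g \<in> twist_stalk 0 q) \<and> s = (\<Sum>g\<in>G. c g *s g))"

lemma stalk_generatorsD:
  assumes "stalk_generators N U G"
  shows "zopen U" "finite G" "G \<subseteq> N U"
  using assms by (simp_all add: stalk_generators_def)

lemma stalk_generatorsE:
  assumes "stalk_generators N U G" "q \<in> U" "s \<in> stalk N q"
  obtains c where "\<forall>g\<in>G. c g \<in> twist_stalk 0 q" "s = (\<Sum>g\<in>G. c g *s g)"
  using assms unfolding stalk_generators_def by blast

lemma exists_stalk_generators:
  assumes N: "module_sheaf N" "finite_type N" and p: "p \<in> Proj3"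
  obtains U G where "stalk_generators N U G" "p \<in> U"
proof -
  obtain U G where U: "zopen U" "p \<in> U" "finite G" "G \<subseteq> N U"
    and gen: "\<forall>V s q. zopen V \<longrightarrow> V \<subseteq> U \<longrightarrow> s \<in> N V \<longrightarrow> q \<in> V \<longrightarrow>
           (\<exists>W c. zopen W \<and> q \<in> W \<and> W \<subseteq> V \<and> (\<forall>g\<in>G. c g \<in> structure_sheaf W) \<and>
              s = (\<Sum>g\<in>G. c g *s g))"
    using N(2)[unfolded finite_type_def, rule_format, OF p]
    by (elim exE conjE) (rule that; (intro conjI)?; assumption)
  have "\<exists>c. (\<forall>g\<in>G. c g \<in> twist_stalk 0 q) \<and> s = (\<Sum>g\<in>G. c g *s g)"
    if q: "q \<in> U" and "s \<in> stalk N q" for q s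
  proof -
    from \<open>s \<in> stalk N q\<close> obtain V where V: "zopen V" "q \<in> V" "s \<in> N V" by (rule stalkE)
    have UV: "zopen (U \<inter> V)" using zopen_Int[OF U(1) V(1)] .
    have s: "s \<in> N (U \<inter> V)" using module_sheaf_restrict[OF N(1) UV V(1)] V(3) by simp
    have "q \<in> U \<inter> V" using q V(2) by simp
    from gen[rule_format, OF UV _ s this] obtain W c where
      W: "q \<in> W" "\<forall>g\<in>G. c g \<in> structure_sheaf W" "s = (\<Sum>g\<in>G. c g *s g)" by auto
    then show "\<exists>c. (\<forall>g\<in>G. c g \<in> twist_stalk 0 q) \<and> s = (\<Sum>g\<in>G. c g *s g)"
      unfolding structure_sheaf_def by (intro exI[of _ c]) auto
  qed
  then have "stalk_generators N U G"
    unfolding stalk_generators_def by (intro conjI ballI U(3,4) U(1)[THEN conjunct1] U(1)[THEN conjunct2])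
  then show ?thesis using U(2) by (rule that)
qed

section \<open>Uniqueness and computation of the first Chern class\<close>

lemma twist_spanI: "f \<in> twist_stalk a p \<Longrightarrow> f * w \<in> twist_span a w p"
  unfolding twist_span_def by blast

lemma twist_span_quotient:
  assumes "p \<in> Proj3" "twist_span a w p = twist_span b w' p" "w' \<noteq> 0"
  shows "w / w' \<in> twist_stalk (b - a) p"
proof -
  obtain u where u: "u \<noteq> 0" "u \<in> twist_stalk a p" "inverse u \<in> twist_stalk (- a) p"
    using assms(1) by (rule twist_stalk_unit)
  then have "u * w \<in> twist_span b w' p" using twist_spanI[OF u(2), of w] assms(2) by simp
  then obtain f where f: "f \<in> twist_stalk b p" "u * w = f * w'" unfolding twist_span_def by blast
  then have "w / w' = f * inverse u" using u(1) assms(3) by (simp add: field_simps)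
  also have "\<dots> \<in> twist_stalk (b - a) p" by (rule twist_stalk_mult_eq[OF assms(1) f(1) u(3)]) simp
  finally show ?thesis .
qed

text \<open>The quotient of the two generators is a nonzero rational section of O(b - a) without
  poles in codimension one, hence a form of degree b - a. So b - a is nonnegative, and by symmetry
  it is 0.\<close>

lemma twist_span_unique:
  assumes "\<And>p. codim_one p \<Longrightarrow> twist_span a w p = twist_span b w' p" "w \<noteq> 0" "w' \<noteq> (0 :: 'k::field frac3)"
  shows "a = b"
proof -
  have "b - a \<ge> 0" if eq: "\<And>p. codim_one p \<Longrightarrow> twist_span a w p = twist_span b w' p" and nz: "w \<noteq> 0" "w' \<noteq> 0"
    for a b and w w' :: "'k frac3"
  proof -
    have "w / w' \<in> twist_stalk (b - a) p" if "codim_one p" for p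
      by (rule twist_span_quotient[OF codim_one_Proj3[OF that] eq[OF that] nz(2)])
    moreover have "w / w' \<noteq> 0" using nz by simp
    ultimately obtain r where "int r = b - a" using no_poles_imp_polynomial[of "w / w'" "b - a"] by metis
    then show ?thesis by simp
  qed
  from this[of a w b w'] this[of b w' a w] show ?thesis using assms by auto
qed

text \<open>The definite description in \<open>c1\<close> is justified by looking at one coordinate
  where w is nonzero: there any other choice of generator and twist spans the same fractional
  ideals, and \<open>twist_span_unique\<close> applies.\<close>

lemma c1_eqI:
  assumes w: "\<And>p. codim_one p \<Longrightarrow> top_exterior_stalk N p = {(\<lambda>\<iota>. f * w \<iota>) | f. f \<in> twist_stalk a p}"
    and nz: "w \<iota> \<noteq> (0 :: 'k::field frac3)"
  shows "c1 N = a"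
  unfolding c1_def
proof (rule the_equality)
  show "has_c1 N a" unfolding has_c1_def using w by blast
  fix b assume "has_c1 N b"
  then obtain w' where w': "\<And>p. codim_one p \<Longrightarrow> top_exterior_stalk N p = {(\<lambda>\<iota>. f * w' \<iota>) | f. f \<in> twist_stalk b p}"
    unfolding has_c1_def by blast
  have span: "twist_span a (v \<iota>) p = (\<lambda>x. x \<iota>) ` {(\<lambda>\<iota>. f * v \<iota>) | f. f \<in> twist_stalk a p}"
    for v :: "(nat \<Rightarrow> 3) \<Rightarrow> 'k frac3" and a p
    by (simp add: twist_span_def Setcompr_eq_image image_image)
  have eq: "twist_span b (w' \<iota>) p = twist_span a (w \<iota>) p" if "codim_one p" for p
    unfolding span using w[OF that] w'[OF that] by simp
  have "w' \<iota> \<noteq> 0"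
  proof
    assume 0: "w' \<iota> = 0"
    obtain p :: "'k poly3 set" where p: "codim_one p" using codim_one_exists by blast
    obtain u where u: "u \<noteq> 0" "u \<in> twist_stalk a p" using twist_stalk_unit[OF codim_one_Proj3[OF p]] by metis
    then have "u * w \<iota> \<in> twist_span b (w' \<iota>) p" using twist_spanI[OF u(2), of "w \<iota>"] eq[OF p] by simp
    then show False using 0 u(1) nz by (auto simp: twist_span_def)
  qed
  then show "b = a" using twist_span_unique[OF eq] nz by blast
qed

lemma top_exterior_stalk_rank_one:
  assumes "module_sheaf N" "p \<in> Proj3" "sheaf_rank N = 1"
  shows "top_exterior_stalk N p = (\<lambda>s \<iota>. s $ \<iota> 0) ` stalk N p"
proof -
  have id: "{\<pi>. \<pi> permutes {..<Suc 0}} = {id}" by (auto simp: lessThan_Suc permutes_sing)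
  have wedge: "wedge 1 v = (\<lambda>\<iota>. v 0 $ \<iota> 0)" for v :: "nat \<Rightarrow> 'a frac3 ^ 3"
    by (simp add: wedge_def id)
  show ?thesis
  proof (intro equalityI subsetI)
    fix x assume "x \<in> top_exterior_stalk N p"
    then obtain n :: nat and c v where v: "x = (\<lambda>\<iota>. \<Sum>j<n. c j * wedge 1 (v j) \<iota>)"
      "\<And>j. j < n \<Longrightarrow> c j \<in> twist_stalk 0 p \<and> v j 0 \<in> stalk N p"
      unfolding top_exterior_stalk_def assms(3) by auto
    have "(\<Sum>j<n. c j *s v j 0) \<in> stalk N p"
      using v(2) stalk_scale[OF assms(1,2)] by (intro stalk_sum[OF assms(1,2)]) simp
    moreover have "x = (\<lambda>\<iota>. (\<Sum>j<n. c j *s v j 0) $ \<iota> 0)" unfolding v(1) wedge by simp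
    ultimately show "x \<in> (\<lambda>s \<iota>. s $ \<iota> 0) ` stalk N p" by blast
  next
    fix x :: "(nat \<Rightarrow> 3) \<Rightarrow> 'a frac3" assume "x \<in> (\<lambda>s \<iota>. s $ \<iota> 0) ` stalk N p"
    then obtain s where s: "s \<in> stalk N p" "x = (\<lambda>\<iota>. s $ \<iota> 0)" by blast
    have "x = (\<lambda>\<iota>. \<Sum>j<(1::nat). 1 * wedge 1 (\<lambda>_. s) \<iota>)" unfolding s(2) wedge by simp
    moreover have "\<forall>j<(1::nat). 1 \<in> twist_stalk 0 p \<and> (\<forall>i<(1::nat). s \<in> stalk N p)"
      using s(1) twist_stalk_one[OF assms(2)] by simp
    ultimately show "x \<in> top_exterior_stalk N p"
      unfolding top_exterior_stalk_def assms(3)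
      by (intro CollectI exI[of _ "1::nat"] exI[of _ "\<lambda>_. 1"] exI[of _ "\<lambda>_ _. s"]) simp
  qed
qed

lemma c1_rank_one:
  assumes "module_sheaf N" "sheaf_rank N = 1" "\<sigma> \<noteq> 0"
    and "\<And>p. codim_one p \<Longrightarrow> stalk N p = {f *s \<sigma> | f. f \<in> twist_stalk a p}"
  shows "c1 N = a"
proof -
  obtain i where i: "\<sigma> $ i \<noteq> 0" using assms(3) by (auto simp: vec_eq_iff)
  show ?thesis
  proof (rule c1_eqI)
    show "\<sigma> $ (\<lambda>_::nat. i) 0 \<noteq> 0" using i .
    fix p :: "'a poly3 set" assume p: "codim_one p"
    have "top_exterior_stalk N p = (\<lambda>s \<iota>. s $ \<iota> 0) ` {f *s \<sigma> | f. f \<in> twist_stalk a p}"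
      using top_exterior_stalk_rank_one[OF assms(1) codim_one_Proj3[OF p] assms(2)] assms(4)[OF p] by simp
    also have "\<dots> = {(\<lambda>\<iota>. f * (\<sigma> $ \<iota> 0)) | f. f \<in> twist_stalk a p}"
      by (simp add: Setcompr_eq_image image_image)
    finally show "top_exterior_stalk N p = {(\<lambda>\<iota>. f * (\<sigma> $ \<iota> 0)) | f. f \<in> twist_stalk a p}" .
  qed
qed

section \<open>Kernel sheaves of three forms\<close>

definition syzygies :: "(3 \<Rightarrow> 'k::field poly3) \<Rightarrow> ('k poly3 ^ 3) set" where
  "syzygies q = {\<theta>. (\<Sum>i\<in>UNIV. \<theta> $ i * q i) = 0}"

lemma Fract_sum: "(\<Sum>i\<in>S. Fract (f i) 1) = Fract (\<Sum>i\<in>S. f i) (1 :: 'a::idom)"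
  by (induction S rule: infinite_finite_induct) (simp_all add: Zero_fract_def)

lemma hom_prime_prod: "hom_prime p \<Longrightarrow> (\<And>i. i \<in> S \<Longrightarrow> f i \<notin> p) \<Longrightarrow> (\<Prod>i\<in>S. f i) \<notin> p"
  by (induction S rule: infinite_finite_induct) (simp_all add: hom_prime_one hom_prime_mult_iff)

text \<open>The stalk is the whole kernel on triples from the local ring. A triple of fractions in
  the kernel is brought to a common denominator, the product of its three denominators; the
  numerators are then a polynomial syzygy of the same degree.\<close>

lemma stalk_associated_syzygies:
  fixes q :: "3 \<Rightarrow> 'k::field poly3"
  assumes p: "p \<in> Proj3"
  shows "s \<in> stalk (associated_sheaf (syzygies q)) p \<longleftrightarrow>
    (\<forall>i. s $ i \<in> twist_stalk 0 p) \<and> (\<Sum>i\<in>UNIV. s $ i * Fract (q i) 1) = 0"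
proof
  assume "s \<in> stalk (associated_sheaf (syzygies q)) p"
  then obtain U where "p \<in> U" "s \<in> associated_sheaf (syzygies q) U" by (rule stalkE)
  then obtain \<theta> h n where \<theta>: "\<theta> \<in> syzygies q" "\<And>i. homogeneous n (\<theta> $ i)" "homogeneous n h" "h \<notin> p"
    "s = (\<chi> i. Fract (\<theta> $ i) h)"
    unfolding associated_sheaf_def by blast
  have "(\<Sum>i\<in>UNIV. s $ i * Fract (q i) 1) = (\<Sum>i\<in>UNIV. Fract (\<theta> $ i * q i) 1 * inverse (Fract h 1))"
    unfolding \<theta>(5) by (rule sum.cong) simp_all
  also have "\<dots> = Fract (\<Sum>i\<in>UNIV. \<theta> $ i * q i) 1 * inverse (Fract h 1)"
    by (simp only: Fract_sum flip: sum_distrib_right)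
  also have "\<dots> = 0" using \<theta>(1) by (simp add: syzygies_def fract_collapse)
  finally show "(\<forall>i. s $ i \<in> twist_stalk 0 p) \<and> (\<Sum>i\<in>UNIV. s $ i * Fract (q i) 1) = 0"
    using twist_stalkI[OF \<theta>(2,3,4), of 0] by (simp add: \<theta>(5))
next
  note hp = Proj3_hom_prime[OF p]
  assume s: "(\<forall>i. s $ i \<in> twist_stalk 0 p) \<and> (\<Sum>i\<in>UNIV. s $ i * Fract (q i) 1) = 0"
  have "\<forall>i. \<exists>u v n. homogeneous n u \<and> homogeneous n v \<and> v \<notin> p \<and> s $ i = Fract u v"
  proof
    fix i
    have "s $ i \<in> twist_stalk 0 p" using s by blast
    then obtain g h m n where "homogeneous m g" "homogeneous n h" "h \<notin> p" "int m = int n + 0" "s $ i = Fract g h"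
      by (rule twist_stalkE)
    then show "\<exists>u v n. homogeneous n u \<and> homogeneous n v \<and> v \<notin> p \<and> s $ i = Fract u v"
      by (intro exI[of _ g] exI[of _ h] exI[of _ n]) simp
  qed
  then obtain u v n where uv: "\<And>i. homogeneous (n i) (u i)" "\<And>i. homogeneous (n i) (v i)" "\<And>i. v i \<notin> p"
    "\<And>i. s $ i = Fract (u i) (v i)" by metis
  define h where "h = (\<Prod>i\<in>UNIV. v i)"
  define \<theta> :: "'k poly3 ^ 3" where "\<theta> = (\<chi> i. u i * (\<Prod>j\<in>UNIV - {i}. v j))"
  define N where "N = (\<Sum>i\<in>UNIV. n i)"
  have h: "homogeneous N h" unfolding h_def N_def using uv(2) by (intro homogeneous_prod)
  have hnp: "h \<notin> p" unfolding h_def using uv(3) by (intro hom_prime_prod[OF hp])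
  have nz: "h \<noteq> 0" "v i \<noteq> 0" for i using hnp uv(3)[of i] hom_prime_zero[OF hp] by auto
  have "homogeneous (n i + (\<Sum>j\<in>UNIV - {i}. n j)) (\<theta> $ i)" for i
    unfolding \<theta>_def vec_lambda_beta using uv(1,2) by (intro homogeneous_mult homogeneous_prod)
  moreover have "n i + (\<Sum>j\<in>UNIV - {i}. n j) = N" for i
    unfolding N_def by (simp add: sum.remove[of UNIV i])
  ultimately have \<theta>h: "homogeneous N (\<theta> $ i)" for i by metis
  have "v i * (\<Prod>j\<in>UNIV - {i}. v j) = h" for i
    unfolding h_def by (simp add: prod.remove[of UNIV i])
  then have s\<theta>: "s $ i = Fract (\<theta> $ i) h" for i
    unfolding uv(4) \<theta>_def vec_lambda_beta using nz by (simp add: eq_fract) (metis mult.assoc mult.commute)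
  have "(\<Sum>i\<in>UNIV. s $ i * Fract (q i) 1) = (\<Sum>i\<in>UNIV. Fract (\<theta> $ i * q i) 1 * inverse (Fract h 1))"
    unfolding s\<theta> by (rule sum.cong) simp_all
  also have "\<dots> = Fract (\<Sum>i\<in>UNIV. \<theta> $ i * q i) 1 * inverse (Fract h 1)"
    by (simp only: Fract_sum flip: sum_distrib_right)
  finally have "Fract (\<Sum>i\<in>UNIV. \<theta> $ i * q i) 1 * inverse (Fract h 1) = 0" using s by simp
  then have "Fract (\<Sum>i\<in>UNIV. \<theta> $ i * q i) 1 = 0"
    using Fract_nonzero[OF nz(1)] by (simp del: inverse_fract mult_fract)
  then have "\<theta> \<in> syzygies q" by (simp add: syzygies_def Fract_eq_0_iff)
  moreover have "s = (\<chi> i. Fract (\<theta> $ i) h)" by (simp add: s\<theta> vec_eq_iff)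
  ultimately have "s \<in> associated_sheaf (syzygies q) (basic_open h)"
    unfolding associated_sheaf_def basic_open_def using \<theta>h h by blast
  then show "s \<in> stalk (associated_sheaf (syzygies q)) p"
    using zopen_basic_open_not_in[OF h hnp p] by (auto intro: stalkI)
qed

section \<open>Bivectors in the kernel of a linear form on a space of dimension three\<close>

lemma wedge_2: "wedge 2 v \<iota> = v 0 $ \<iota> 0 * v 1 $ \<iota> 1 - v 0 $ \<iota> 1 * (v 1 $ \<iota> 0 :: 'a::comm_ring_1)"
proof -
  have "{..<2::nat} = insert 0 {1}" by auto
  moreover have "finite {1::nat}" "(0::nat) \<notin> {1}" by auto
  ultimately show ?thesis
    unfolding wedge_def
    by (simp add: sum_over_permutations_insert permutes_sing sign_swap_id sign_id swap_id_eq mult.commute)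
qed

text \<open>The skew matrix of the cross product with q. Two vectors orthogonal to q have a cross
  product parallel to q, so their bivector is proportional to this one.\<close>

definition dual_bivector :: "(3 \<Rightarrow> 'a::comm_ring_1) \<Rightarrow> 3 \<Rightarrow> 3 \<Rightarrow> 'a" where
  "dual_bivector q a b =
    (if a = 1 \<and> b = 2 then q 3 else if a = 2 \<and> b = 1 then - q 3
     else if a = 2 \<and> b = 3 then q 1 else if a = 3 \<and> b = 2 then - q 1
     else if a = 3 \<and> b = 1 then q 2 else if a = 1 \<and> b = 3 then - q 2 else 0)"

lemma three_distinct: "(1::3) \<noteq> 2" "(1::3) \<noteq> 3" "(2::3) \<noteq> 3" "(2::3) \<noteq> 1" "(3::3) \<noteq> 1" "(3::3) \<noteq> 2"
  by simp_all

lemma dual_bivector_swap: "dual_bivector q b a = - dual_bivector q a b"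
proof -
  have "\<forall>a b. dual_bivector q b a = - dual_bivector q a b"
    unfolding forall_3 dual_bivector_def by (simp add: three_distinct)
  then show ?thesis by blast
qed

text \<open>One coordinate of the statement that u \<times> v is parallel to q, proved without
  division so that it holds in any commutative ring.\<close>

lemma orthogonal_minor:
  fixes u1 :: "'a::comm_ring_1"
  assumes "u1 * q1 + u2 * q2 + u3 * q3 = 0" "v1 * q1 + v2 * q2 + v3 * q3 = 0"
  shows "q1 * (u1 * v2 - u2 * v1) = (u2 * v3 - u3 * v2) * q3"
proof -
  have "q1 * (u1 * v2 - u2 * v1) - (u2 * v3 - u3 * v2) * q3 =
     v2 * (u1 * q1 + u2 * q2 + u3 * q3) - u2 * (v1 * q1 + v2 * q2 + v3 * q3)"
    by (simp add: algebra_simps)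
  then show ?thesis using assms by simp
qed

text \<open>With (i, j, k) cyclic, the first factor on the right is the coordinate i of the cross
  product, so all entries follow from u \<times> v being parallel to q. The statement is free of
  division because it is needed twice: over the fraction field for the Chern class, and over the
  polynomial ring for the restriction to a line.\<close>

lemma kernel_bivector:
  fixes q :: "3 \<Rightarrow> 'a::comm_ring_1"
  assumes "(\<Sum>i\<in>UNIV. u $ i * q i) = 0" "(\<Sum>i\<in>UNIV. v $ i * q i) = 0"
  shows "\<exists>j k. (i = 1 \<longrightarrow> j = 2 \<and> k = 3) \<and> (i = 2 \<longrightarrow> j = 3 \<and> k = 1) \<and> (i = 3 \<longrightarrow> j = 1 \<and> k = 2) \<and>
    (\<forall>a b. q i * (u $ a * v $ b - u $ b * v $ a) = (u $ j * v $ k - u $ k * v $ j) * dual_bivector q a b)"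
proof -
  have u: "u $ 1 * q 1 + u $ 2 * q 2 + u $ 3 * q 3 = 0" and v: "v $ 1 * q 1 + v $ 2 * q 2 + v $ 3 * q 3 = 0"
    using assms by (simp_all add: sum_3)
  \<comment> \<open>The reorderings of the summands supply \<open>orthogonal_minor\<close> for all
    permutations of the coordinates; skew symmetry then reduces all entries to nine.\<close>
  have u': "u $ 2 * q 2 + u $ 3 * q 3 + u $ 1 * q 1 = 0" "u $ 3 * q 3 + u $ 1 * q 1 + u $ 2 * q 2 = 0"
    "u $ 1 * q 1 + u $ 3 * q 3 + u $ 2 * q 2 = 0" "u $ 2 * q 2 + u $ 1 * q 1 + u $ 3 * q 3 = 0"
    "u $ 3 * q 3 + u $ 2 * q 2 + u $ 1 * q 1 = 0"
    using u by (simp_all add: ac_simps)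
  have v': "v $ 2 * q 2 + v $ 3 * q 3 + v $ 1 * q 1 = 0" "v $ 3 * q 3 + v $ 1 * q 1 + v $ 2 * q 2 = 0"
    "v $ 1 * q 1 + v $ 3 * q 3 + v $ 2 * q 2 = 0" "v $ 2 * q 2 + v $ 1 * q 1 + v $ 3 * q 3 = 0"
    "v $ 3 * q 3 + v $ 2 * q 2 + v $ 1 * q 1 = 0"
    using v by (simp_all add: ac_simps)
  note minors = orthogonal_minor[OF u v] orthogonal_minor[OF u'(1) v'(1)] orthogonal_minor[OF u'(2) v'(2)]
    orthogonal_minor[OF u'(3) v'(3)] orthogonal_minor[OF u'(4) v'(4)] orthogonal_minor[OF u'(5) v'(5)]
  define P where "P i j k a b \<longleftrightarrow>
    q i * (u $ a * v $ b - u $ b * v $ a) = (u $ j * v $ k - u $ k * v $ j) * dual_bivector q a b" for i j k a b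
  have swap: "P i j k b a" if "P i j k a b" for i j k a b
  proof -
    have "q i * (u $ b * v $ a - u $ a * v $ b) = - (q i * (u $ a * v $ b - u $ b * v $ a))"
      by (simp add: algebra_simps)
    then show ?thesis using that unfolding P_def dual_bivector_swap[of q b a] by simp
  qed
  have neg: "q i * (u $ a * v $ b - u $ b * v $ a) = (u $ j * v $ k - u $ k * v $ j) * c"
    if "q i * (u $ b * v $ a - u $ a * v $ b) = (u $ k * v $ j - u $ j * v $ k) * c" for i j k a b c
  proof -
    have "q i * (u $ a * v $ b - u $ b * v $ a) = - (q i * (u $ b * v $ a - u $ a * v $ b))"
      "(u $ j * v $ k - u $ k * v $ j) * c = - ((u $ k * v $ j - u $ j * v $ k) * c)"
      by (simp_all add: algebra_simps)
    then show ?thesis using that by simp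
  qed
  have diag: "P i j k a a" for i j k a by (simp add: P_def dual_bivector_def three_distinct) auto
  have all: "\<forall>a b. P i j k a b" if "P i j k 1 2" "P i j k 2 3" "P i j k 3 1" for i j k
    unfolding forall_3 using that swap diag by blast
  have "P 1 2 3 1 2" "P 1 2 3 2 3" "P 1 2 3 3 1" "P 2 3 1 1 2" "P 2 3 1 2 3" "P 2 3 1 3 1"
    "P 3 1 2 1 2" "P 3 1 2 2 3" "P 3 1 2 3 1"
    unfolding P_def dual_bivector_def using minors minors[THEN neg]
    by (simp_all add: three_distinct mult.commute)
  then have "\<forall>a b. P 1 2 3 a b" "\<forall>a b. P 2 3 1 a b" "\<forall>a b. P 3 1 2 a b" using all by blast+
  moreover have "i = 1 \<or> i = 2 \<or> i = 3" using exhaust_3 by blast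
  ultimately show ?thesis unfolding P_def using three_distinct by metis
qed

text \<open>Solve the equation for coordinate i. The entries are listed because they are the only
  quotients that must be regular at a point; the bivector of u and v is normalized to be the dual
  bivector of q divided by \<open>q i\<close>.\<close>

lemma kernel_basis:
  fixes q :: "3 \<Rightarrow> 'a::field"
  assumes "q i \<noteq> 0"
  obtains u v where "(\<Sum>i\<in>UNIV. u $ i * q i) = 0" "(\<Sum>i\<in>UNIV. v $ i * q i) = 0"
    "\<And>j. u $ j \<in> {0, 1} \<union> range (\<lambda>k. - (q k / q i))" "\<And>j. v $ j \<in> {0, 1} \<union> range (\<lambda>k. - (q k / q i))"
    "\<And>a b. q i * (u $ a * v $ b - u $ b * v $ a) = dual_bivector q a b"
    "\<And>s. (\<Sum>i\<in>UNIV. s $ i * q i) = 0 \<Longrightarrow> \<exists>c d. s = c *s u + d *s v"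
    "\<And>c d. c *s u + d *s v = 0 \<Longrightarrow> c = 0 \<and> d = 0"
proof -
  have eqI: "x = y" if "x $ 1 = y $ 1" "x $ 2 = y $ 2" "x $ 3 = y $ 3" for x y :: "'a ^ 3"
    using that by (simp add: vec_eq_iff forall_3)
  consider "i = 1" | "i = 2" | "i = 3" using exhaust_3 by blast
  then show ?thesis
  proof cases
    case 1
    let ?u = "vector [- (q 2 / q 1), 1, 0] :: 'a ^ 3" and ?v = "vector [- (q 3 / q 1), 0, 1] :: 'a ^ 3"
    show ?thesis
    proof (rule that[of ?u ?v])
      fix s :: "'a ^ 3" assume "(\<Sum>i\<in>UNIV. s $ i * q i) = 0"
      then have "s = s $ 2 *s ?u + s $ 3 *s ?v"
        using assms by (intro eqI) (simp_all add: sum_3 1 field_simps eq_neg_iff_add_eq_0)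
      then show "\<exists>c d. s = c *s ?u + d *s ?v" by blast
    next
      fix a b
      have "\<forall>a b. q i * (?u $ a * ?v $ b - ?u $ b * ?v $ a) = dual_bivector q a b"
        unfolding forall_3 dual_bivector_def using assms by (simp add: 1 three_distinct)
      then show "q i * (?u $ a * ?v $ b - ?u $ b * ?v $ a) = dual_bivector q a b" by blast
    next
      fix j :: 3
      show "?u $ j \<in> {0, 1} \<union> range (\<lambda>k. - (q k / q i))"
        using exhaust_3[of j] 1 by auto
      show "?v $ j \<in> {0, 1} \<union> range (\<lambda>k. - (q k / q i))"
        using exhaust_3[of j] 1 by auto
    next
      fix c d assume "c *s ?u + d *s ?v = (0 :: 'a ^ 3)"
      then show "c = 0 \<and> d = 0" by (simp add: vec_eq_iff forall_3)
    qed (use assms 1 in \<open>simp_all add: sum_3\<close>)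
  next
    case 2
    \<comment> \<open>The free coordinates are taken in the cyclic order 3, 1, which gives the
      bivector the positive sign.\<close>
    let ?u = "vector [0, - (q 3 / q 2), 1] :: 'a ^ 3" and ?v = "vector [1, - (q 1 / q 2), 0] :: 'a ^ 3"
    show ?thesis
    proof (rule that[of ?u ?v])
      fix s :: "'a ^ 3" assume "(\<Sum>i\<in>UNIV. s $ i * q i) = 0"
      then have "s = s $ 3 *s ?u + s $ 1 *s ?v"
        using assms by (intro eqI) (simp_all add: sum_3 2 field_simps eq_neg_iff_add_eq_0)
      then show "\<exists>c d. s = c *s ?u + d *s ?v" by blast
    next
      fix a b
      have "\<forall>a b. q i * (?u $ a * ?v $ b - ?u $ b * ?v $ a) = dual_bivector q a b"
        unfolding forall_3 dual_bivector_def using assms by (simp add: 2 three_distinct)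
      then show "q i * (?u $ a * ?v $ b - ?u $ b * ?v $ a) = dual_bivector q a b" by blast
    next
      fix j :: 3
      show "?u $ j \<in> {0, 1} \<union> range (\<lambda>k. - (q k / q i))"
        using exhaust_3[of j] 2 by auto
      show "?v $ j \<in> {0, 1} \<union> range (\<lambda>k. - (q k / q i))"
        using exhaust_3[of j] 2 by auto
    next
      fix c d assume "c *s ?u + d *s ?v = (0 :: 'a ^ 3)"
      then show "c = 0 \<and> d = 0" by (simp add: vec_eq_iff forall_3)
    qed (use assms 2 in \<open>simp_all add: sum_3\<close>)
  next
    case 3
    let ?u = "vector [1, 0, - (q 1 / q 3)] :: 'a ^ 3" and ?v = "vector [0, 1, - (q 2 / q 3)] :: 'a ^ 3"
    show ?thesis
    proof (rule that[of ?u ?v])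
      fix s :: "'a ^ 3" assume "(\<Sum>i\<in>UNIV. s $ i * q i) = 0"
      then have "s = s $ 1 *s ?u + s $ 2 *s ?v"
        using assms by (intro eqI) (simp_all add: sum_3 3 field_simps eq_neg_iff_add_eq_0)
      then show "\<exists>c d. s = c *s ?u + d *s ?v" by blast
    next
      fix a b
      have "\<forall>a b. q i * (?u $ a * ?v $ b - ?u $ b * ?v $ a) = dual_bivector q a b"
        unfolding forall_3 dual_bivector_def using assms by (simp add: 3 three_distinct)
      then show "q i * (?u $ a * ?v $ b - ?u $ b * ?v $ a) = dual_bivector q a b" by blast
    next
      fix j :: 3
      show "?u $ j \<in> {0, 1} \<union> range (\<lambda>k. - (q k / q i))"
        using exhaust_3[of j] 3 by auto
      show "?v $ j \<in> {0, 1} \<union> range (\<lambda>k. - (q k / q i))"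
        using exhaust_3[of j] 3 by auto
    next
      fix c d assume "c *s ?u + d *s ?v = (0 :: 'a ^ 3)"
      then show "c = 0 \<and> d = 0" by (simp add: vec_eq_iff forall_3)
    qed (use assms 3 in \<open>simp_all add: sum_3\<close>)
  qed
qed


section \<open>The rank one subsheaf spanned by a syzygy\<close>

definition fraction_vec :: "'k::field poly3 ^ 3 \<Rightarrow> 'k frac3 ^ 3" where
  "fraction_vec \<theta> = (\<chi> i. Fract (\<theta> $ i) 1)"

lemma fraction_vec_nonzero: "\<theta> \<noteq> 0 \<Longrightarrow> fraction_vec \<theta> \<noteq> 0"
  by (auto simp: fraction_vec_def vec_eq_iff Fract_eq_0_iff)

text \<open>For nonzero \<theta> of degree m this is the image of O(-m) under multiplication by
  \<theta>; the twist brings the entries to degree 0.\<close>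

definition generated_sheaf :: "'k::field poly3 ^ 3 \<Rightarrow> nat \<Rightarrow> 'k sheaf" where
  "generated_sheaf \<theta> m U = {s. \<forall>p\<in>U. \<exists>f\<in>twist_stalk (- int m) p. s = f *s fraction_vec \<theta>}"

lemma module_sheaf_generated: "module_sheaf (generated_sheaf (\<theta> :: 'a::field poly3 ^ 3) m)"
  unfolding module_sheaf_def
proof (intro conjI allI impI ballI)
  fix U :: "'a poly3 set set" assume U: "zopen U"
  have p3: "p \<in> Proj3" if "p \<in> U" for p using zopen_subset_Proj3[OF U] that by blast
  show "0 \<in> generated_sheaf \<theta> m U"
    unfolding generated_sheaf_def using twist_stalk_zero[OF p3]
    by (intro CollectI ballI bexI[of _ 0]) simp_all
  fix s assume s: "s \<in> generated_sheaf \<theta> m U"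
  show "s + t \<in> generated_sheaf \<theta> m U" if t: "t \<in> generated_sheaf \<theta> m U" for t
    unfolding generated_sheaf_def
  proof (intro CollectI ballI)
    fix p assume p: "p \<in> U"
    obtain f where f: "f \<in> twist_stalk (- int m) p" "s = f *s fraction_vec \<theta>"
      using s p unfolding generated_sheaf_def by blast
    obtain g where g: "g \<in> twist_stalk (- int m) p" "t = g *s fraction_vec \<theta>"
      using t p unfolding generated_sheaf_def by blast
    have "s + t = (f + g) *s fraction_vec \<theta>" unfolding f g by (simp add: vec.scale_left_distrib)
    then show "\<exists>f\<in>twist_stalk (- int m) p. s + t = f *s fraction_vec \<theta>"
      using twist_stalk_add[OF p3[OF p] f(1) g(1)] by blast
  qed
  show "c *s s \<in> generated_sheaf \<theta> m U" if c: "c \<in> structure_sheaf U" for c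
    unfolding generated_sheaf_def
  proof (intro CollectI ballI)
    fix p assume p: "p \<in> U"
    obtain f where f: "f \<in> twist_stalk (- int m) p" "s = f *s fraction_vec \<theta>"
      using s p unfolding generated_sheaf_def by blast
    have "c \<in> twist_stalk 0 p" using c p by (simp add: structure_sheaf_def)
    then have "c * f \<in> twist_stalk (- int m) p" by (rule twist_stalk_mult_eq[OF p3[OF p] _ f(1)]) simp
    moreover have "c *s s = (c * f) *s fraction_vec \<theta>" unfolding f by simp
    ultimately show "\<exists>f\<in>twist_stalk (- int m) p. c *s s = f *s fraction_vec \<theta>" by blast
  qed
next
  fix U V :: "'a poly3 set set" assume "U \<subseteq> V"
  then show "generated_sheaf \<theta> m V \<subseteq> generated_sheaf \<theta> m U" unfolding generated_sheaf_def by blast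
next
  fix \<U> s assume "\<forall>U\<in>\<U>. zopen U \<and> s \<in> generated_sheaf \<theta> m U"
  then show "s \<in> generated_sheaf \<theta> m (\<Union>\<U>)" unfolding generated_sheaf_def by blast
qed

lemma stalk_generated:
  assumes "p \<in> Proj3"
  shows "stalk (generated_sheaf \<theta> m) p = {f *s fraction_vec \<theta> | f. f \<in> twist_stalk (- int m) p}"
proof (intro equalityI subsetI)
  fix s assume "s \<in> stalk (generated_sheaf \<theta> m) p"
  then obtain U where "p \<in> U" "s \<in> generated_sheaf \<theta> m U" by (rule stalkE)
  then show "s \<in> {f *s fraction_vec \<theta> | f. f \<in> twist_stalk (- int m) p}"
    unfolding generated_sheaf_def by blast
next
  fix s assume "s \<in> {f *s fraction_vec \<theta> | f. f \<in> twist_stalk (- int m) p}"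
  then obtain f where f: "f \<in> twist_stalk (- int m) p" "s = f *s fraction_vec \<theta>" by blast
  obtain g h i j where gh: "homogeneous i g" "homogeneous j h" "h \<notin> p" "int i = int j + - int m" "f = Fract g h"
    using f(1) by (rule twist_stalkE)
  have "f \<in> twist_stalk (- int m) q" if "q \<in> basic_open h" for q
    unfolding gh(5) using that twist_stalkI[OF gh(1,2) _ gh(4)] by (simp add: basic_open_def)
  then have "s \<in> generated_sheaf \<theta> m (basic_open h)"
    unfolding generated_sheaf_def f(2) by blast
  then show "s \<in> stalk (generated_sheaf \<theta> m) p"
    using zopen_basic_open_not_in[OF gh(2,3) assms] by (auto intro: stalkI)
qed

lemma finite_type_generated:
  fixes \<theta> :: "'k::field poly3 ^ 3"
  assumes nz: "\<theta> \<noteq> 0"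
  shows "finite_type (generated_sheaf \<theta> m)"
  unfolding finite_type_def
proof
  fix p :: "'k poly3 set" assume p: "p \<in> Proj3"
  obtain l where l: "homogeneous m l" "l \<notin> p" using p by (rule Proj3_form)
  \<comment> \<open>A form l of degree m that does not vanish at p makes \<theta>/l a generator on
    the basic open set of l.\<close>
  define G where "G = Fract 1 l *s fraction_vec \<theta>"
  have l0: "l \<noteq> 0" using l(2) hom_prime_zero[OF Proj3_hom_prime[OF p]] by auto
  have U: "zopen (basic_open l)" "p \<in> basic_open l" using zopen_basic_open_not_in[OF l p] by auto
  have G: "{G} \<subseteq> generated_sheaf \<theta> m (basic_open l)"
    unfolding generated_sheaf_def G_def using twist_stalk_inverse_form[OF l(1)]
    by (auto simp: basic_open_def)
  have gen: "\<exists>W c. zopen W \<and> q \<in> W \<and> W \<subseteq> V \<and> (\<forall>g\<in>{G}. c g \<in> structure_sheaf W) \<and> s = (\<Sum>g\<in>{G}. c g *s g)"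
    if V: "zopen V" "V \<subseteq> basic_open l" and s: "s \<in> generated_sheaf \<theta> m V" and q: "q \<in> V" for V s q
  proof -
    obtain f where f: "f \<in> twist_stalk (- int m) q" "s = f *s fraction_vec \<theta>"
      using s q unfolding generated_sheaf_def by blast
    have "f * Fract l 1 \<in> structure_sheaf V"
      unfolding structure_sheaf_def
    proof
      fix r assume r: "r \<in> V"
      have r3: "r \<in> Proj3" using zopen_subset_Proj3[OF V(1)] r by blast
      obtain f' where f': "f' \<in> twist_stalk (- int m) r" "s = f' *s fraction_vec \<theta>"
        using s r unfolding generated_sheaf_def by blast
      \<comment> \<open>The coefficient is determined by s because \<theta> is nonzero, so the
        coefficients chosen at different points agree and define one section.\<close>
      have "f = f'" using f(2) f'(2) fraction_vec_nonzero[OF nz] by (metis vec.scale_cancel_right)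
      then show "f * Fract l 1 \<in> twist_stalk 0 r"
        using twist_stalk_mult[OF r3 f'(1) twist_stalk_form[OF r3 l(1)]] by simp
    qed
    moreover have "s = (f * Fract l 1) *s G"
      unfolding f(2) G_def using l0 by (simp add: One_fract_def eq_fract flip: mult.assoc)
    ultimately show ?thesis
      using V(1) q by (intro exI[of _ V] exI[of _ "\<lambda>_. f * Fract l 1"]) simp
  qed
  show "\<exists>U G. zopen U \<and> p \<in> U \<and> finite G \<and> G \<subseteq> generated_sheaf \<theta> m U \<and>
        (\<forall>V s q. zopen V \<longrightarrow> V \<subseteq> U \<longrightarrow> s \<in> generated_sheaf \<theta> m V \<longrightarrow> q \<in> V \<longrightarrow>
           (\<exists>W c. zopen W \<and> q \<in> W \<and> W \<subseteq> V \<and> (\<forall>g\<in>G. c g \<in> structure_sheaf W) \<and>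
              s = (\<Sum>g\<in>G. c g *s g)))"
    by (rule exI[of _ "basic_open l"], rule exI[of _ "{G}"]) (use U G gen in \<open>intro conjI allI impI; simp\<close>)
qed

lemma sheaf_rank_one_generated:
  assumes "\<theta> \<noteq> 0"
  shows "sheaf_rank (generated_sheaf \<theta> m) = 1"
proof -
  obtain u :: "'a frac3" where u: "u \<noteq> 0" "u \<in> twist_stalk (- int m) {0}"
    using twist_stalk_unit[OF zero_Proj3] by metis
  have nz: "u *s fraction_vec \<theta> \<noteq> 0" using u(1) fraction_vec_nonzero[OF assms] by simp
  have "stalk (generated_sheaf \<theta> m) {0} \<subseteq> vec.span {u *s fraction_vec \<theta>}"
  proof
    fix s assume "s \<in> stalk (generated_sheaf \<theta> m) {0}"
    then obtain f where "s = f *s fraction_vec \<theta>" unfolding stalk_generated[OF zero_Proj3] by blast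
    then have "s = (f / u) *s (u *s fraction_vec \<theta>)" using u(1) by simp
    then show "s \<in> vec.span {u *s fraction_vec \<theta>}"
      by (metis singletonI vec.span_base vec.span_scale)
  qed
  moreover have "{u *s fraction_vec \<theta>} \<subseteq> stalk (generated_sheaf \<theta> m) {0}"
    unfolding stalk_generated[OF zero_Proj3] using u(2) by blast
  moreover have "vec.independent {u *s fraction_vec \<theta>}" using nz by (simp only: vec.dependent_single not_False_eq_True)
  ultimately show ?thesis
    unfolding sheaf_rank_def by (intro vec.dim_unique[of "{u *s fraction_vec \<theta>}"]) simp_all
qed

section \<open>Rank one subsheaves in codimension one\<close>

lemma common_denominator:
  assumes "finite G" "\<And>g. g \<in> G \<Longrightarrow> c g \<in> twist_stalk 0 {0}"
  shows "\<exists>V v. V \<noteq> 0 \<and> homogeneous v (V :: 'k::field poly3) \<and>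
    (\<forall>g\<in>G. \<forall>p\<in>Proj3. Fract V 1 * c g \<in> twist_stalk (int v) p)"
  using assms
proof (induction G rule: finite_induct)
  case empty
  show ?case by (intro exI[of _ 1] exI[of _ 0]) (simp add: homogeneous_one)
next
  case (insert x G)
  obtain V v where V: "V \<noteq> 0" "homogeneous v V"
    "\<forall>g\<in>G. \<forall>p\<in>Proj3. Fract V 1 * c g \<in> twist_stalk (int v) p"
    using insert.IH insert.prems by (metis insertCI)
  have "c x \<in> twist_stalk 0 {0}" using insert.prems by simp
  then obtain P Q m n where PQ: "homogeneous m P" "homogeneous n Q" "Q \<notin> {0}" "int m = int n + 0" "c x = Fract P Q"
    by (rule twist_stalkE)
  have "Q * V \<noteq> 0" using V(1) PQ(3) by simp
  moreover have "homogeneous (n + v) (Q * V)" using homogeneous_mult[OF PQ(2) V(2)] .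
  moreover have "Fract (Q * V) 1 * c g \<in> twist_stalk (int (n + v)) p" if g: "g \<in> insert x G" and p: "p \<in> Proj3" for g p
  proof (cases "g \<in> G")
    case True
    have "Fract Q 1 * (Fract V 1 * c g) \<in> twist_stalk (int (n + v)) p"
      using V(3) True p by (intro twist_stalk_mult_eq[OF p twist_stalk_form[OF p PQ(2)]]) auto
    then show ?thesis by (simp flip: mult.assoc)
  next
    case False
    then have "Fract (Q * V) 1 * c g = Fract (P * V) 1"
      using g PQ(3,5) by (simp add: eq_fract mult_ac)
    moreover have "Fract (P * V) 1 \<in> twist_stalk (int (m + v)) p"
      using twist_stalk_form[OF p homogeneous_mult[OF PQ(1) V(2)]] .
    ultimately show ?thesis using PQ(4) by simp
  qed
  ultimately show ?case by blast
qed

text \<open>The rank is a dimension over the full fraction field, so linear algebra yields a factor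
  there only. Comparing a nonzero coordinate of \<open>s0\<close> shows that the factor has degree
  0.\<close>

lemma rank_one_stalks:
  fixes N :: "'k::field sheaf"
  assumes N: "module_sheaf N" and rank: "sheaf_rank N = 1"
    and K: "\<And>s i. s \<in> stalk N {0} \<Longrightarrow> s $ i \<in> twist_stalk 0 {0}"
    and s0: "s0 \<in> stalk N {0}" "s0 \<noteq> 0" and s: "s \<in> stalk N {0}"
  shows "\<exists>c\<in>twist_stalk 0 {0}. s = c *s s0"
proof -
  have "stalk N {0} \<subseteq> vec.span {s0}"
    using s0 rank by (intro vec.card_ge_dim_independent) (simp_all add: sheaf_rank_def vec.dependent_single)
  then have "s \<in> vec.span {s0}" using s by blast
  then obtain c where c: "s = c *s s0" unfolding vec.span_singleton by blast
  obtain i where i: "s0 $ i \<noteq> 0" using s0(2) by (auto simp: vec_eq_iff)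
  have "c = s $ i * inverse (s0 $ i)" using i c by simp
  also have "\<dots> \<in> twist_stalk 0 {0}"
    using twist_stalk_generic_inverse[OF K[OF s0(1)] i]
    by (intro twist_stalk_mult_eq[OF zero_Proj3 K[OF s]]) simp_all
  finally show ?thesis using c by blast
qed

text \<open>Relative to a generic section \<open>s\<^sub>0\<close> the stalks are fractional ideals \<open>I p\<close>, which are trivial for all but
  finitely many \<open>p\<close> of codimension one.\<close>

lemma rank_one_line_bundle:
  fixes N :: "'k::field sheaf"
  assumes N: "module_sheaf N" "finite_type N" and rank: "sheaf_rank N = 1"
    and K: "\<And>s i. s \<in> stalk N {0} \<Longrightarrow> s $ i \<in> twist_stalk 0 {0}"
  shows "\<exists>\<sigma> a. \<sigma> \<noteq> 0 \<and> (\<exists>w. w \<noteq> 0 \<and> w *s \<sigma> \<in> stalk N {0}) \<and>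
    (\<forall>p. codim_one p \<longrightarrow> stalk N p = {f *s \<sigma> | f. f \<in> twist_stalk a p})"
proof -
  obtain s1 where s1: "s1 \<in> stalk N {0}" "s1 \<noteq> 0"
  proof -
    have "\<not> stalk N {0} \<subseteq> {0}"
    proof
      assume "stalk N {0} \<subseteq> {0}"
      then have "stalk N {0} \<subseteq> vec.span {}" by simp
      then have "vec.dim (stalk N {0}) \<le> card ({} :: ('k frac3 ^ 3) set)" by (rule vec.dim_le_card) simp
      then show False using rank unfolding sheaf_rank_def card.empty by linarith
    qed
    then show ?thesis using that by blast
  qed
  \<comment> \<open>The open set contains the generic point, whose nonzero stalk is generated by
    G.\<close>
  have nonzero_generator: "\<exists>g\<in>G. g \<noteq> 0"
    if gen: "stalk_generators N U G" for U G
  proof (rule ccontr)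
    assume *: "\<not> (\<exists>g\<in>G. g \<noteq> 0)"
    obtain c where "s1 = (\<Sum>g\<in>G. c g *s g)"
      by (rule stalk_generatorsE[OF gen zero_in_zopen[OF stalk_generatorsD(1)[OF gen]] s1(1)])
    also have "\<dots> = 0" by (rule sum.neutral) (use * in simp)
    finally show False using s1(2) by simp
  qed
  obtain U G where gen: "stalk_generators N U G"
    using exists_stalk_generators[OF N zero_Proj3] by metis
  note U = stalk_generatorsD[OF gen]
  \<comment> \<open>Taken among generators over U, so that it is a section at every point of U and
    not only generically.\<close>
  obtain s0 where s0G: "s0 \<in> G" "s0 \<noteq> 0" using nonzero_generator[OF gen] by blast
  have s0U: "s0 \<in> stalk N p" if "p \<in> U" for p using U(1,3) s0G that by (intro stalkI) auto
  have s0: "s0 \<in> stalk N {0}" using s0U zero_in_zopen[OF U(1)] by blast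
  define I where "I p = {c. c *s s0 \<in> stalk N p}" for p
  have mult: "\<exists>c\<in>twist_stalk 0 {0}. s = c *s s0" if "s \<in> stalk N p" for s p
    using rank_one_stalks[OF N(1) rank K s0 s0G(2)] stalk_generic that by blast
  have stalk_I: "stalk N p = {c *s s0 | c. c \<in> I p}" for p
    using mult[of _ p] unfolding I_def by blast
  have I_generic: "I p \<subseteq> twist_stalk 0 {0}" for p
  proof
    fix c assume "c \<in> I p"
    then obtain c' where "c' \<in> twist_stalk 0 {0}" "c *s s0 = c' *s s0" using mult unfolding I_def by blast
    then show "c \<in> twist_stalk 0 {0}" using s0G(2) by (metis vec.scale_cancel_right)
  qed
  have I_mult: "c * x \<in> I p" if "p \<in> Proj3" "c \<in> twist_stalk 0 p" "x \<in> I p" for c x p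
    using stalk_scale[OF N(1) that(1,2), of "x *s s0"] that(3) by (simp add: I_def)
  \<comment> \<open>The finitely many generators are rational multiples of \<open>s0\<close>. One
    form V clears the denominators of these multiples, hence of the ideals at all points of U' at
    once.\<close>
  have bounded: "\<exists>V v. V \<noteq> 0 \<and> homogeneous v V \<and> (\<forall>q\<in>U'. q \<in> Proj3 \<longrightarrow> (\<forall>x\<in>I q. Fract V 1 * x \<in> twist_stalk (int v) q))"
    if gen': "stalk_generators N U' G'" for U' G'
  proof -
    note U' = stalk_generatorsD[OF gen']
    have "\<forall>g\<in>G'. \<exists>c. c \<in> twist_stalk 0 {0} \<and> g = c *s s0"
    proof
      fix g assume "g \<in> G'"
      then have "g \<in> stalk N {0}" using U'(1,3) zero_in_zopen[OF U'(1)] by (intro stalkI) auto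
      then show "\<exists>c. c \<in> twist_stalk 0 {0} \<and> g = c *s s0" using mult by blast
    qed
    then obtain c where c: "\<And>g. g \<in> G' \<Longrightarrow> c g \<in> twist_stalk 0 {0}" "\<And>g. g \<in> G' \<Longrightarrow> g = c g *s s0" by metis
    obtain V v where V: "V \<noteq> 0" "homogeneous v V"
      "\<forall>g\<in>G'. \<forall>p\<in>Proj3. Fract V 1 * c g \<in> twist_stalk (int v) p"
      using common_denominator[of G' c, OF U'(2) c(1)] by blast
    have "Fract V 1 * x \<in> twist_stalk (int v) q" if q: "q \<in> U'" "q \<in> Proj3" and x: "x \<in> I q" for q x
    proof -
      obtain b where b: "\<forall>g\<in>G'. b g \<in> twist_stalk 0 q" "x *s s0 = (\<Sum>g\<in>G'. b g *s g)"
        using stalk_generatorsE[OF gen' q(1), of "x *s s0"] x unfolding I_def by blast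
      have "(\<Sum>g\<in>G'. b g *s g) = (\<Sum>g\<in>G'. (b g * c g) *s s0)"
        using c(2) by (intro sum.cong refl) (metis vec.scale_scale)
      also have "\<dots> = (\<Sum>g\<in>G'. b g * c g) *s s0" by (simp add: vec.scale_sum_left)
      finally have "x *s s0 = (\<Sum>g\<in>G'. b g * c g) *s s0" unfolding b(2) .
      then have "x = (\<Sum>g\<in>G'. b g * c g)" using s0G(2) by (simp only: vec.scale_cancel_right) simp
      then have "Fract V 1 * x = (\<Sum>g\<in>G'. b g * (Fract V 1 * c g))"
        by (simp add: sum_distrib_left mult_ac)
      also have "\<dots> \<in> twist_stalk (int v) q"
      proof (rule twist_stalk_sum[OF q(2)])
        fix g assume g: "g \<in> G'"
        have "b g \<in> twist_stalk 0 q" "Fract V 1 * c g \<in> twist_stalk (int v) q" using b(1) V(3) g q(2) by auto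
        then show "b g * (Fract V 1 * c g) \<in> twist_stalk (int v) q" by (rule twist_stalk_mult_eq[OF q(2)]) simp
      qed
      finally show ?thesis .
    qed
    then show ?thesis using V(1,2) by blast
  qed
  obtain V v where V: "V \<noteq> 0" "homogeneous v V"
    and Vx: "\<forall>q\<in>U. q \<in> Proj3 \<longrightarrow> (\<forall>x\<in>I q. Fract V 1 * x \<in> twist_stalk (int v) q)"
    using bounded[OF gen] by metis
  obtain n f where f: "homogeneous n f" "f \<notin> {0}" "basic_open f \<subseteq> U"
    using zopen_contains_basic_open[OF U(1) zero_in_zopen[OF U(1)]] by metis
  \<comment> \<open>Outside S the form f is nonzero, so p lies in U and \<open>s0\<close> gives one
    inclusion; V is a unit at p up to twist and gives the other.\<close>
  define S where "S = {p. codim_one p \<and> f \<in> p} \<union> {p. codim_one p \<and> V \<in> p}"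
  have "finite S"
    unfolding S_def using finite_codim_one_containing[OF f(1)] finite_codim_one_containing[OF V(2,1)] f(2) by simp
  have good: "I p = twist_stalk 0 p" if p: "codim_one p" "p \<notin> S" for p
  proof (intro equalityI subsetI)
    have p3: "p \<in> Proj3" using codim_one_Proj3[OF p(1)] .
    have nS: "f \<notin> p" "V \<notin> p" using p unfolding S_def by blast+
    then have pU: "p \<in> U" using f(3) p3 unfolding basic_open_def by blast
    show "x \<in> twist_stalk 0 p" if "x \<in> I p" for x
    proof -
      have "Fract 1 V * (Fract V 1 * x) \<in> twist_stalk 0 p"
        using Vx pU p3 that
        by (intro twist_stalk_mult_eq[OF p3 twist_stalk_inverse_form[OF V(2) nS(2)], of _ "int v"]) auto
      moreover have "Fract 1 V * (Fract V 1 * x) = x"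
        using V(1) by (simp add: One_fract_def eq_fract flip: mult.assoc)
      ultimately show ?thesis by simp
    qed
    show "x \<in> I p" if "x \<in> twist_stalk 0 p" for x
      unfolding I_def using stalk_scale[OF N(1) p3 that s0U[OF pU]] by simp
  qed
  have local: "codim_one p \<and> (\<exists>c b. c \<noteq> 0 \<and> I p = twist_span b c p \<and>
      (\<forall>q. codim_one q \<longrightarrow> q \<noteq> p \<longrightarrow> c \<in> twist_stalk (- b) q \<and> inverse c \<in> twist_stalk b q))" if "p \<in> S" for p
  proof -
    have p: "codim_one p" using that by (auto simp: S_def)
    note p3 = codim_one_Proj3[OF p]
    obtain g m where g: "prime_elem g" "homogeneous m g" "0 < m" "p = {f. g dvd f}"
      using p by (rule codim_one_generator)
    obtain U' G' where gen': "stalk_generators N U' G'" and pU': "p \<in> U'"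
      using exists_stalk_generators[OF N p3] by metis
    note U' = stalk_generatorsD[OF gen']
    obtain t where t: "t \<in> G'" "t \<noteq> 0" using nonzero_generator[OF gen'] by blast
    have "t \<in> stalk N p" using U'(1) pU' by (rule stalkI) (use U'(3) t(1) in blast)
    then obtain x0 where x0: "x0 \<in> I p" "t = x0 *s s0" using stalk_I by blast
    then have "x0 \<noteq> 0" using t(2) by auto
    obtain W w where W: "W \<noteq> 0" "homogeneous w W"
      "\<forall>q\<in>U'. q \<in> Proj3 \<longrightarrow> (\<forall>x\<in>I q. Fract W 1 * x \<in> twist_stalk (int w) q)"
      using bounded[OF gen'] by metis
    have W': "Fract W 1 * x \<in> twist_stalk (int w) p" if "x \<in> I p" for x
      using W(3) pU' p3 that by simp
    have "\<exists>k. I p = twist_span (- k * int m) (Fract g 1 powi k) p"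
      by (rule fractional_ideal_codim_one[OF g I_generic I_mult[OF p3] x0(1) \<open>x0 \<noteq> 0\<close> W(1,2) W'])
    then obtain k where k: "I p = twist_span (- k * int m) (Fract g 1 powi k) p" by blast
    have g0: "g \<noteq> 0" using g(1) by auto
    have unit: "Fract g 1 powi j \<in> twist_stalk (j * int m) q" if q: "codim_one q" "q \<noteq> p" for q j
    proof (rule generator_power_int_unit[OF g codim_one_Proj3[OF q(1)]])
      show "g \<notin> q" using codim_one_eq_principal[OF q(1) g(1-3)] q(2) g(4) by blast
    qed
    have "Fract g 1 powi k \<noteq> 0" using Fract_nonzero[OF g0] by simp
    moreover have "inverse (Fract g 1 powi k) = Fract g 1 powi (- k)" by (simp only: power_int_minus)
    ultimately show ?thesis
      using p k unit[of _ k] unit[of _ "- k"]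
      by (intro conjI exI[of _ "Fract g 1 powi k"] exI[of _ "- k * int m"]) auto
  qed
  obtain w a where w: "w \<noteq> 0"
    "\<forall>q. codim_one q \<longrightarrow> twist_span a w q = (if q \<in> S then I q else twist_stalk 0 q)"
    using divisor_principal[OF \<open>finite S\<close> local] by blast
  have "stalk N p = {f *s (w *s s0) | f. f \<in> twist_stalk a p}" if "codim_one p" for p
  proof -
    have "I p = twist_span a w p" using w(2) good that by auto
    then show ?thesis unfolding stalk_I twist_span_def by auto
  qed
  moreover have "w *s s0 \<noteq> 0" using w(1) s0G(2) by simp
  \<comment> \<open>The entries of the generator w \<open>s0\<close> need not have degree 0, but a
    multiple of it is a generic section of N. This lets later arguments transfer linear equations to
    the generator.\<close>
  moreover have "inverse w *s (w *s s0) \<in> stalk N {0}" using w(1) s0 by simp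
  moreover have "inverse w \<noteq> 0" using w(1) by simp
  ultimately show ?thesis
    by (intro exI[of _ "w *s s0"] exI[of _ a] conjI allI impI exI[of _ "inverse w"])
qed

section \<open>Slopes of subsheaves of the kernel of three coprime forms\<close>

context
  fixes q :: "3 \<Rightarrow> 'k::field poly3" and e :: nat
  assumes hom: "\<And>i. homogeneous e (q i)"
    and coprime: "\<And>p. codim_one p \<Longrightarrow> \<exists>i. q i \<notin> p"
begin

abbreviation (input) kernel_sheaf where "kernel_sheaf \<equiv> associated_sheaf (syzygies q)"

lemma exists_nonzero_component: "\<exists>i. q i \<noteq> 0"
  using codim_one_exists[where 'k = 'k] coprime hom_prime_zero Proj3_hom_prime codim_one_Proj3 by metis

lemma ratio_in_stalk: "p \<in> Proj3 \<Longrightarrow> q i \<notin> p \<Longrightarrow> - (Fract (q k) 1 / Fract (q i) 1) \<in> twist_stalk 0 p"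
  using twist_stalkI[OF hom[of k] hom[of i], of p 0] twist_stalk_uminus[of p "Fract (q k) (q i)" 0] by simp

text \<open>Solving for coordinate i divides only by \<open>q i\<close>, which is nonzero at p, so
  the two basis vectors lie in the stalk.\<close>

lemma local_basis:
  assumes p: "p \<in> Proj3" and i: "q i \<notin> p"
  obtains u v where "u \<in> stalk kernel_sheaf p" "v \<in> stalk kernel_sheaf p"
    "\<forall>a b. Fract (q i) 1 * (u $ a * v $ b - u $ b * v $ a) = dual_bivector (\<lambda>i. Fract (q i) 1) a b"
    "\<forall>s\<in>stalk kernel_sheaf p. \<exists>c d. s = c *s u + d *s v"
    "\<forall>c d. c *s u + d *s v = 0 \<longrightarrow> c = 0 \<and> d = 0"
proof -
  have "q i \<noteq> 0" using i hom_prime_zero[OF Proj3_hom_prime[OF p]] by auto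
  then have "Fract (q i) 1 \<noteq> 0" by (rule Fract_nonzero)
  then show ?thesis
  proof (rule kernel_basis[of "\<lambda>i. Fract (q i) 1"])
    fix u v
    assume ker: "(\<Sum>i\<in>UNIV. u $ i * Fract (q i) 1) = 0" "(\<Sum>i\<in>UNIV. v $ i * Fract (q i) 1) = 0"
      and entries: "\<And>j. u $ j \<in> {0, 1} \<union> range (\<lambda>k. - (Fract (q k) 1 / Fract (q i) 1))"
        "\<And>j. v $ j \<in> {0, 1} \<union> range (\<lambda>k. - (Fract (q k) 1 / Fract (q i) 1))"
      and biv: "\<And>a b. Fract (q i) 1 * (u $ a * v $ b - u $ b * v $ a) = dual_bivector (\<lambda>i. Fract (q i) 1) a b"
      and span: "\<And>s. (\<Sum>i\<in>UNIV. s $ i * Fract (q i) 1) = 0 \<Longrightarrow> \<exists>c d. s = c *s u + d *s v"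
      and indep: "\<And>c d. c *s u + d *s v = 0 \<Longrightarrow> c = 0 \<and> d = 0"
    have set: "{0, 1} \<union> range (\<lambda>k. - (Fract (q k) 1 / Fract (q i) 1)) \<subseteq> twist_stalk 0 p"
      using twist_stalk_zero[OF p] twist_stalk_one[OF p] ratio_in_stalk[OF p i] by blast
    have "u \<in> stalk kernel_sheaf p"
      unfolding stalk_associated_syzygies[OF p] using ker(1) entries(1) set by blast
    moreover have "v \<in> stalk kernel_sheaf p"
      unfolding stalk_associated_syzygies[OF p] using ker(2) entries(2) set by blast
    moreover have "\<forall>s\<in>stalk kernel_sheaf p. \<exists>c d. s = c *s u + d *s v"
      unfolding Ball_def stalk_associated_syzygies[OF p] by (intro allI impI span) (elim conjE)
    ultimately show ?thesis using that biv indep by simp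
  qed
qed

lemma sheaf_rank_kernel: "sheaf_rank kernel_sheaf = 2"
proof -
  obtain i where "q i \<notin> {0}" using exists_nonzero_component by blast
  with zero_Proj3 obtain u v where uv: "u \<in> stalk kernel_sheaf {0}" "v \<in> stalk kernel_sheaf {0}"
    and "\<forall>a b. Fract (q i) 1 * (u $ a * v $ b - u $ b * v $ a) = dual_bivector (\<lambda>i. Fract (q i) 1) a b"
    and span: "\<forall>s\<in>stalk kernel_sheaf {0}. \<exists>c d. s = c *s u + d *s v"
    and indep: "\<forall>c d. c *s u + d *s v = 0 \<longrightarrow> c = 0 \<and> d = 0" by (rule local_basis)
  have v0: "v \<noteq> 0" using indep[rule_format, of 0 1] by auto
  have u_span: "u \<notin> vec.span {v}"
  proof
    assume "u \<in> vec.span {v}"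
    then obtain c where "u = c *s v" unfolding vec.span_singleton by blast
    then have "1 *s u + (- c) *s v = 0" by (simp add: vec.scale_minus_left)
    then have "(1 :: 'k frac3) = 0" using indep by blast
    then show False by simp
  qed
  then have "u \<noteq> v" by (metis singletonI vec.span_base)
  have "vec.independent {u, v}"
    using u_span v0 \<open>u \<noteq> v\<close> by (simp add: vec.independent_insert vec.dependent_single)
  moreover have "stalk kernel_sheaf {0} \<subseteq> vec.span {u, v}"
  proof
    fix s assume "s \<in> stalk kernel_sheaf {0}"
    then obtain c d where "s = c *s u + d *s v" using span by blast
    then show "s \<in> vec.span {u, v}"
      by (metis insertI1 insertI2 singletonI vec.span_add vec.span_base vec.span_scale)
  qed
  ultimately show ?thesis
    unfolding sheaf_rank_def using uv \<open>u \<noteq> v\<close> by (intro vec.dim_unique[of "{u, v}"]) auto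
qed

text \<open>The forms define a map from O^3 to O(e) which is surjective in codimension one because
  they are coprime, so the kernel has determinant O(-e). Explicitly, the top exterior power is
  spanned by the dual bivector of q: a bivector of kernel vectors is this one times a minor divided
  by \<open>q i\<close>, of degree -e.\<close>

lemma c1_kernel: "c1 kernel_sheaf = - int e"
proof -
  let ?q = "\<lambda>i. Fract (q i) 1"
  define w where "w \<iota> = dual_bivector ?q (\<iota> 0) (\<iota> 1)" for \<iota> :: "nat \<Rightarrow> 3"
  obtain i where i: "q i \<noteq> 0" using exists_nonzero_component by blast
  then have "?q i \<noteq> 0" by (rule Fract_nonzero)
  moreover have "dual_bivector ?q 2 3 = ?q 1" "dual_bivector ?q 3 1 = ?q 2" "dual_bivector ?q 1 2 = ?q 3"
    by (simp_all add: dual_bivector_def three_distinct)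
  ultimately have "\<exists>a b. dual_bivector ?q a b \<noteq> 0"
    using exhaust_3[of i] by metis
  then obtain a b where "dual_bivector ?q a b \<noteq> 0" by blast
  then have w_nz: "w (\<lambda>n. if n = 0 then a else b) \<noteq> 0" by (simp add: w_def)
  show ?thesis
  proof (rule c1_eqI[where w = w, OF _ w_nz])
    fix p :: "'k poly3 set" assume "codim_one p"
    then have p: "p \<in> Proj3" and "\<exists>i. q i \<notin> p" using codim_one_Proj3 coprime by auto
    then obtain i where i: "q i \<notin> p" by blast
    have q0: "?q i \<noteq> 0" using i hom_prime_zero[OF Proj3_hom_prime[OF p]] by (intro Fract_nonzero) auto
    have wedge: "\<exists>f\<in>twist_stalk (- int e) p. \<forall>\<iota>. wedge 2 v \<iota> = f * w \<iota>"
      if "v 0 \<in> stalk kernel_sheaf p" "v 1 \<in> stalk kernel_sheaf p" for v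
    proof -
      have ker: "(\<Sum>i\<in>UNIV. v 0 $ i * ?q i) = 0" "(\<Sum>i\<in>UNIV. v 1 $ i * ?q i) = 0"
        and tw: "\<And>j. v 0 $ j \<in> twist_stalk 0 p" "\<And>j. v 1 $ j \<in> twist_stalk 0 p"
        using that unfolding stalk_associated_syzygies[OF p] by blast+
      obtain j k where jk: "\<forall>a b. ?q i * (v 0 $ a * v 1 $ b - v 0 $ b * v 1 $ a) =
          (v 0 $ j * v 1 $ k - v 0 $ k * v 1 $ j) * dual_bivector ?q a b"
        using kernel_bivector[where q = ?q and i = i, OF ker] by blast
      define f where "f = (v 0 $ j * v 1 $ k - v 0 $ k * v 1 $ j) * Fract 1 (q i)"
      have "v 0 $ j * v 1 $ k - v 0 $ k * v 1 $ j \<in> twist_stalk 0 p"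
        using twist_stalk_mult[OF p tw(1) tw(2)] by (intro twist_stalk_diff[OF p]) auto
      then have "f \<in> twist_stalk (- int e) p"
        unfolding f_def by (rule twist_stalk_mult_eq[OF p _ twist_stalk_inverse_form[OF hom i]]) simp
      moreover have "wedge 2 v \<iota> = f * w \<iota>" for \<iota>
      proof -
        have "Fract 1 (q i) = inverse (?q i)" by simp
        then have "?q i * (f * w \<iota>) = (v 0 $ j * v 1 $ k - v 0 $ k * v 1 $ j) * w \<iota>"
          unfolding f_def using q0 by (simp only: field_simps) simp
        also have "\<dots> = ?q i * wedge 2 v \<iota>" unfolding w_def wedge_2 using jk by simp
        finally show ?thesis using q0 by (simp only: mult_cancel_left) simp
      qed
      ultimately show ?thesis by blast
    qed
    show "top_exterior_stalk kernel_sheaf p = {(\<lambda>\<iota>. f * w \<iota>) | f. f \<in> twist_stalk (- int e) p}"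
    proof (intro equalityI subsetI)
      fix x assume "x \<in> top_exterior_stalk kernel_sheaf p"
      then obtain n :: nat and c v where x: "x = (\<lambda>\<iota>. \<Sum>j<n. c j * wedge 2 (v j) \<iota>)"
        and cv: "\<forall>j<n. c j \<in> twist_stalk 0 p \<and> (\<forall>i<2. v j i \<in> stalk kernel_sheaf p)"
        unfolding top_exterior_stalk_def sheaf_rank_kernel by auto
      have "\<forall>j<n. \<exists>f. f \<in> twist_stalk (- int e) p \<and> (\<forall>\<iota>. wedge 2 (v j) \<iota> = f * w \<iota>)"
      proof (intro allI impI)
        fix j assume "j < n"
        then have "v j 0 \<in> stalk kernel_sheaf p" "v j 1 \<in> stalk kernel_sheaf p" using cv by auto
        then show "\<exists>f. f \<in> twist_stalk (- int e) p \<and> (\<forall>\<iota>. wedge 2 (v j) \<iota> = f * w \<iota>)"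
          using wedge by blast
      qed
      then obtain f where f: "\<And>j. j < n \<Longrightarrow> f j \<in> twist_stalk (- int e) p"
        "\<And>j \<iota>. j < n \<Longrightarrow> wedge 2 (v j) \<iota> = f j * w \<iota>" by metis
      have "(\<Sum>j<n. c j * f j) \<in> twist_stalk (- int e) p"
      proof (rule twist_stalk_sum[OF p])
        fix j assume "j \<in> {..<n}"
        then show "c j * f j \<in> twist_stalk (- int e) p"
          using cv f(1) by (intro twist_stalk_mult_eq[OF p, of _ 0 _ "- int e"]) auto
      qed
      moreover have "x = (\<lambda>\<iota>. (\<Sum>j<n. c j * f j) * w \<iota>)"
        unfolding x by (intro ext) (simp add: f(2) sum_distrib_right mult.assoc)
      ultimately show "x \<in> {(\<lambda>\<iota>. f * w \<iota>) | f. f \<in> twist_stalk (- int e) p}" by blast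
    next
      fix x assume "x \<in> {(\<lambda>\<iota>. f * w \<iota>) | f. f \<in> twist_stalk (- int e) p}"
      then obtain f where f: "f \<in> twist_stalk (- int e) p" "x = (\<lambda>\<iota>. f * w \<iota>)" by blast
      from p i obtain u v where uv: "u \<in> stalk kernel_sheaf p" "v \<in> stalk kernel_sheaf p"
        "\<forall>a b. ?q i * (u $ a * v $ b - u $ b * v $ a) = dual_bivector ?q a b"
        and "\<forall>s\<in>stalk kernel_sheaf p. \<exists>c d. s = c *s u + d *s v"
        and "\<forall>c d. c *s u + d *s v = 0 \<longrightarrow> c = 0 \<and> d = 0"
        by (rule local_basis)
      define vs where "vs = (\<lambda>n::nat. if n = 0 then u else v)"
      \<comment> \<open>The dual bivector is \<open>q i\<close> times the bivector of the basis u,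
        v, so the coefficient gains the factor \<open>q i\<close> and has degree 0.\<close>
      have "f * ?q i \<in> twist_stalk 0 p"
        using twist_stalk_mult[OF p f(1) twist_stalk_form[OF p hom]] by simp
      moreover have "x = (\<lambda>\<iota>. \<Sum>j<(1::nat). (f * ?q i) * wedge 2 vs \<iota>)"
        unfolding f(2) w_def wedge_2 vs_def by (simp add: mult.assoc flip: uv(3)[rule_format])
      moreover have "\<forall>j<2. vs j \<in> stalk kernel_sheaf p" using uv(1,2) by (simp add: vs_def)
      ultimately show "x \<in> top_exterior_stalk kernel_sheaf p"
        unfolding top_exterior_stalk_def sheaf_rank_kernel
        by (intro CollectI exI[of _ "1::nat"] exI[of _ "\<lambda>_. f * ?q i"] exI[of _ "\<lambda>_. vs"]) simp
    qed
  qed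
qed

lemma slope_kernel: "slope kernel_sheaf = - of_nat e / 2"
  by (simp add: slope_def c1_kernel sheaf_rank_kernel)

lemma generated_subsheaf:
  assumes \<theta>: "\<theta> \<in> syzygies q" "\<theta> \<noteq> 0" "\<And>i. homogeneous m (\<theta> $ i)"
  shows "coherent_subsheaf (generated_sheaf \<theta> m) kernel_sheaf" "slope (generated_sheaf \<theta> m) = - of_nat m"
proof -
  have "generated_sheaf \<theta> m U \<subseteq> kernel_sheaf U" if "zopen U" for U
  proof
    fix s assume s: "s \<in> generated_sheaf \<theta> m U"
    show "s \<in> kernel_sheaf U"
      unfolding associated_sheaf_def
    proof (intro CollectI ballI)
      fix p assume "p \<in> U"
      then obtain f where f: "f \<in> twist_stalk (- int m) p" "s = f *s fraction_vec \<theta>"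
        using s unfolding generated_sheaf_def by blast
      obtain g h i j where gh: "homogeneous i g" "homogeneous j h" "h \<notin> p" "int i = int j + - int m" "f = Fract g h"
        using f(1) by (rule twist_stalkE)
      let ?\<theta> = "\<chi> l. g * \<theta> $ l"
      have "(\<Sum>l\<in>UNIV. ?\<theta> $ l * q l) = g * (\<Sum>l\<in>UNIV. \<theta> $ l * q l)"
        by (simp add: sum_distrib_left mult.assoc)
      then have "?\<theta> \<in> syzygies q" using \<theta>(1) by (simp add: syzygies_def)
      moreover have "i + m = j" using gh(4) by linarith
      then have "\<forall>l. homogeneous j (?\<theta> $ l)"
        using homogeneous_mult[OF gh(1) \<theta>(3)] by auto
      moreover have "s = (\<chi> l. Fract (?\<theta> $ l) h)"
        unfolding f(2) gh(5) by (simp add: fraction_vec_def vec_eq_iff)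
      ultimately show "\<exists>\<theta>\<in>syzygies q. \<exists>h n. (\<forall>i. homogeneous n (\<theta> $ i)) \<and> homogeneous n h \<and> h \<notin> p \<and>
          s = (\<chi> i. Fract (\<theta> $ i) h)"
        using gh(2,3) by blast
    qed
  qed
  then show "coherent_subsheaf (generated_sheaf \<theta> m) kernel_sheaf"
    unfolding coherent_subsheaf_def using module_sheaf_generated finite_type_generated[OF \<theta>(2)] by blast
  have "c1 (generated_sheaf \<theta> m) = - int m"
    by (rule c1_rank_one[OF module_sheaf_generated sheaf_rank_one_generated[OF \<theta>(2)]
        fraction_vec_nonzero[OF \<theta>(2)] stalk_generated[OF codim_one_Proj3]])
  then show "slope (generated_sheaf \<theta> m) = - of_nat m"
    by (simp add: slope_def sheaf_rank_one_generated[OF \<theta>(2)])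
qed

text \<open>In codimension one N is O(a) times a rational vector \<sigma>. As N consists of vectors
  with regular entries, those of \<sigma> are sections of O(-a) without poles, hence forms of degree
  m = -a. N itself may be smaller than the sheaf spanned by \<sigma> at points of codimension two,
  which the slope does not see.\<close>

lemma rank_one_subsheaf:
  assumes N: "coherent_subsheaf N kernel_sheaf" and rank: "sheaf_rank N = 1"
  obtains \<theta> m where "\<theta> \<in> syzygies q" "\<theta> \<noteq> 0" "\<And>i. homogeneous m (\<theta> $ i)" "slope N = - of_nat m"
proof -
  have N': "module_sheaf N" "finite_type N" and sub: "\<And>U. zopen U \<Longrightarrow> N U \<subseteq> kernel_sheaf U"
    using N unfolding coherent_subsheaf_def by blast+
  have stalks: "s \<in> stalk kernel_sheaf p" if "s \<in> stalk N p" for s p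
    using that sub by (elim stalkE) (rule stalkI; blast)
  have tw: "s $ i \<in> twist_stalk 0 p" if "s \<in> stalk N p" "p \<in> Proj3" for s i p
    using stalks[OF that(1)] unfolding stalk_associated_syzygies[OF that(2)] by blast
  have tw0: "s $ i \<in> twist_stalk 0 {0}" if "s \<in> stalk N {0}" for s i
    by (rule tw[OF that zero_Proj3])
  have "\<exists>\<sigma> a. \<sigma> \<noteq> 0 \<and> (\<exists>w. w \<noteq> 0 \<and> w *s \<sigma> \<in> stalk N {0}) \<and>
      (\<forall>p. codim_one p \<longrightarrow> stalk N p = {f *s \<sigma> | f. f \<in> twist_stalk a p})"
    by (rule rank_one_line_bundle[OF N' rank]) (rule tw0)
  then obtain \<sigma> a w where \<sigma>: "\<sigma> \<noteq> 0" "w \<noteq> 0" "w *s \<sigma> \<in> stalk N {0}"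
    "\<forall>p. codim_one p \<longrightarrow> stalk N p = {f *s \<sigma> | f. f \<in> twist_stalk a p}"
    by (elim exE conjE)
  have c1: "c1 N = a" using \<sigma>(4) by (intro c1_rank_one[OF N'(1) rank \<sigma>(1)]) simp
  have \<sigma>_tw: "\<sigma> $ i \<in> twist_stalk (- a) p" if p: "codim_one p" for p i
  proof -
    note p3 = codim_one_Proj3[OF p]
    obtain u where u: "u \<noteq> 0" "u \<in> twist_stalk a p" "inverse u \<in> twist_stalk (- a) p"
      using p3 by (rule twist_stalk_unit)
    have "u *s \<sigma> \<in> stalk N p" using \<sigma>(4) p u(2) by blast
    then have "u * \<sigma> $ i \<in> twist_stalk 0 p" using tw[OF _ p3, of "u *s \<sigma>" i] by simp
    then have "inverse u * (u * \<sigma> $ i) \<in> twist_stalk (- a) p" by (rule twist_stalk_mult_eq[OF p3 u(3)]) simp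
    moreover have "inverse u * (u * \<sigma> $ i) = \<sigma> $ i" using u(1) by simp
    ultimately show ?thesis by (simp only:)
  qed
  have poly: "\<exists>R r. \<sigma> $ i = Fract R 1 \<and> homogeneous r R \<and> int r = - a" if "\<sigma> $ i \<noteq> 0" for i
    using no_poles_imp_polynomial[OF \<sigma>_tw that] by metis
  obtain i0 where "\<sigma> $ i0 \<noteq> 0" using \<sigma>(1) by (auto simp: vec_eq_iff)
  then obtain m where m: "int m = - a" using poly by blast
  have "\<exists>R. \<sigma> $ i = Fract R 1 \<and> homogeneous m R" for i
  proof (cases "\<sigma> $ i = 0")
    case True
    then show ?thesis by (intro exI[of _ 0]) (simp add: Zero_fract_def)
  next
    case False
    then obtain R r where "\<sigma> $ i = Fract R 1" "homogeneous r R" "int r = int m" using poly m by metis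
    then show ?thesis by (metis of_nat_eq_iff)
  qed
  then obtain R where R: "\<And>i. \<sigma> $ i = Fract (R i) 1" "\<And>i. homogeneous m (R i)" by metis
  define \<theta> :: "'k poly3 ^ 3" where "\<theta> = (\<chi> i. R i)"
  have "(\<Sum>i\<in>UNIV. (w *s \<sigma>) $ i * Fract (q i) 1) = 0"
    using stalks[OF \<sigma>(3)] unfolding stalk_associated_syzygies[OF zero_Proj3] by blast
  then have "w * (\<Sum>i\<in>UNIV. \<sigma> $ i * Fract (q i) 1) = 0" by (simp add: sum_distrib_left mult.assoc)
  then have "(\<Sum>i\<in>UNIV. Fract (R i * q i) 1) = 0" using \<sigma>(2) R(1) by simp
  then have "\<theta> \<in> syzygies q" by (simp add: Fract_sum Fract_eq_0_iff syzygies_def \<theta>_def)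
  moreover have "\<theta> \<noteq> 0"
  proof
    assume "\<theta> = 0"
    then have "R i = 0" for i by (simp add: \<theta>_def vec_eq_iff)
    then have "\<sigma> $ i = 0" for i by (simp add: R(1) Fract_eq_0_iff)
    then show False using \<sigma>(1) by (simp add: vec_eq_iff)
  qed
  moreover have "slope N = - of_nat m"
  proof -
    have "c1 N = - int m" using c1 m by simp
    then show ?thesis by (simp add: slope_def rank)
  qed
  moreover have "homogeneous m (\<theta> $ i)" for i using R(2) by (simp add: \<theta>_def)
  ultimately show ?thesis using that[of \<theta> m] by blast
qed

text \<open>Stated for a predicate P on slopes, so that the strict and the weak inequality are
  obtained from the same argument.\<close>

lemma subsheaf_slopes_kernel:
  "(\<forall>N. coherent_subsheaf N kernel_sheaf \<longrightarrow> 0 < sheaf_rank N \<longrightarrow> sheaf_rank N < sheaf_rank kernel_sheaf \<longrightarrow> P (slope N)) \<longleftrightarrow>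
    (\<forall>\<theta> m. \<theta> \<in> syzygies q \<longrightarrow> \<theta> \<noteq> 0 \<longrightarrow> (\<forall>i. homogeneous m (\<theta> $ i)) \<longrightarrow> P (- of_nat m))"
  (is "?L \<longleftrightarrow> ?R")
proof
  assume L: ?L
  show ?R
  proof (intro allI impI)
    fix \<theta> m assume \<theta>: "\<theta> \<in> syzygies q" "\<theta> \<noteq> 0" "\<forall>i. homogeneous m (\<theta> $ i)"
    have "P (slope (generated_sheaf \<theta> m))"
      using L generated_subsheaf(1)[OF \<theta>(1,2)] \<theta>(3) sheaf_rank_one_generated[OF \<theta>(2)] sheaf_rank_kernel by simp
    then show "P (- of_nat m)" using generated_subsheaf(2)[OF \<theta>(1,2)] \<theta>(3) by simp
  qed
next
  assume R: ?R
  show ?L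
  proof (intro allI impI)
    fix N assume N: "coherent_subsheaf N kernel_sheaf" "0 < sheaf_rank N" "sheaf_rank N < sheaf_rank kernel_sheaf"
    then have "sheaf_rank N = 1" by (simp add: sheaf_rank_kernel)
    with N(1) obtain \<theta> m where \<theta>: "\<theta> \<in> syzygies q" "\<theta> \<noteq> 0" "\<And>i. homogeneous m (\<theta> $ i)" "slope N = - of_nat m"
      by (rule rank_one_subsheaf) blast
    then show "P (slope N)" using R by simp
  qed
qed

lemma slope_stable_kernel_iff:
  "slope_stable kernel_sheaf \<longleftrightarrow>
    (\<forall>\<theta> m. \<theta> \<in> syzygies q \<longrightarrow> \<theta> \<noteq> 0 \<longrightarrow> (\<forall>i. homogeneous m (\<theta> $ i)) \<longrightarrow> e < 2 * m)"
proof -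
  have "- of_nat m < (- of_nat e / 2 :: rat) \<longleftrightarrow> (of_nat e :: rat) < of_nat (2 * m)" for m by (simp add: mult.commute)
  then show ?thesis
    unfolding slope_stable_def subsheaf_slopes_kernel[where P = "\<lambda>x. x < slope kernel_sheaf"]
    unfolding slope_kernel by (simp only: of_nat_less_iff)
qed

lemma slope_semistable_kernel_iff:
  "slope_semistable kernel_sheaf \<longleftrightarrow>
    (\<forall>\<theta> m. \<theta> \<in> syzygies q \<longrightarrow> \<theta> \<noteq> 0 \<longrightarrow> (\<forall>i. homogeneous m (\<theta> $ i)) \<longrightarrow> e \<le> 2 * m)"
proof -
  have "- of_nat m \<le> (- of_nat e / 2 :: rat) \<longleftrightarrow> (of_nat e :: rat) \<le> of_nat (2 * m)" for m by (simp add: mult.commute)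
  then show ?thesis
    unfolding slope_semistable_def subsheaf_slopes_kernel[where P = "\<lambda>x. x \<le> slope kernel_sheaf"]
    unfolding slope_kernel by (simp only: of_nat_le_iff)
qed

end

section \<open>Derivations\<close>

lemma pdiff_superset:
  assumes "finite S" "Poly_Mapping.keys f \<subseteq> S"
  shows "pdiff i f = (\<Sum>m\<in>S. Poly_Mapping.single (m - Poly_Mapping.single i 1)
    (of_nat (Poly_Mapping.lookup m i) * Poly_Mapping.lookup f m))"
  unfolding pdiff_def using assms by (intro sum.mono_neutral_left) (auto simp: in_keys_iff)

lemma pdiff_zero [simp]: "pdiff i 0 = 0"
  by (simp add: pdiff_def)

lemma pdiff_single: "pdiff i (Poly_Mapping.single m c) =
  Poly_Mapping.single (m - Poly_Mapping.single i 1) (of_nat (Poly_Mapping.lookup m i) * c)"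
  by (subst pdiff_superset[of "{m}"]) (auto split: if_splits)

lemma pdiff_add: "pdiff i (f + g) = pdiff i f + pdiff i g"
proof -
  let ?S = "Poly_Mapping.keys f \<union> Poly_Mapping.keys g"
  have "pdiff i h = (\<Sum>m\<in>?S. Poly_Mapping.single (m - Poly_Mapping.single i 1)
      (of_nat (Poly_Mapping.lookup m i) * Poly_Mapping.lookup h m))"
    if "Poly_Mapping.keys h \<subseteq> ?S" for h
    using that by (intro pdiff_superset) auto
  note this[of f] this[of g] this[of "f + g"]
  then show ?thesis
    using keys_add[of f g] by (simp add: lookup_add distrib_left single_add sum.distrib)
qed

lemma expo_minus_add:
  "Poly_Mapping.lookup m i \<noteq> 0 \<Longrightarrow> (m - Poly_Mapping.single i 1) + n = (m + n :: expo) - Poly_Mapping.single i 1"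
  by (rule poly_mapping_eqI) (auto simp: lookup_add lookup_minus lookup_single when_def)

text \<open>Each summand carries the exponent of x_i as a coefficient. If it is 0, the truncated
  subtraction is irrelevant; otherwise the subtraction commutes with adding exponents.\<close>

lemma pdiff_mult_single:
  "pdiff i (Poly_Mapping.single m c * Poly_Mapping.single n d) =
    pdiff i (Poly_Mapping.single m c) * Poly_Mapping.single n d +
    Poly_Mapping.single m c * pdiff i (Poly_Mapping.single n (d :: 'k::comm_ring_1))"
proof -
  have left: "Poly_Mapping.single (m - Poly_Mapping.single i 1 + n) (of_nat (Poly_Mapping.lookup m i) * x) =
      Poly_Mapping.single (m + n - Poly_Mapping.single i 1) (of_nat (Poly_Mapping.lookup m i) * x)" for m n and x :: 'k
    by (cases "Poly_Mapping.lookup m i = 0") (simp_all add: expo_minus_add del: One_nat_def)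
  have "pdiff i (Poly_Mapping.single m c * Poly_Mapping.single n d) =
      Poly_Mapping.single (m + n - Poly_Mapping.single i 1) (of_nat (Poly_Mapping.lookup m i) * (c * d)) +
      Poly_Mapping.single (n + m - Poly_Mapping.single i 1) (of_nat (Poly_Mapping.lookup n i) * (c * d))"
    by (simp add: mult_single pdiff_single lookup_add distrib_right add.commute flip: single_add)
  also have "\<dots> = Poly_Mapping.single (m - Poly_Mapping.single i 1 + n) (of_nat (Poly_Mapping.lookup m i) * (c * d)) +
      Poly_Mapping.single (n - Poly_Mapping.single i 1 + m) (of_nat (Poly_Mapping.lookup n i) * (c * d))"
    by (simp only: left)
  also have "\<dots> = pdiff i (Poly_Mapping.single m c) * Poly_Mapping.single n d +
    Poly_Mapping.single m c * pdiff i (Poly_Mapping.single n d)"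
    by (simp add: mult_single pdiff_single add.commute mult_ac del: One_nat_def)
  finally show ?thesis .
qed

lemma pdiff_mult: "pdiff i (f * g) = pdiff i f * g + f * pdiff i (g :: 'k::comm_ring_1 poly3)"
proof (induction f rule: poly_mapping_induct_add)
  case (single m c)
  show ?case
    by (induction g rule: poly_mapping_induct_add)
      (simp_all add: pdiff_mult_single pdiff_add distrib_left)
qed (simp_all add: pdiff_add distrib_right)

lemma homogeneous_pdiff:
  assumes "homogeneous n f"
  shows "homogeneous (n - 1) (pdiff i f)"
  unfolding pdiff_def
proof (rule homogeneous_sum)
  fix m assume m: "m \<in> Poly_Mapping.keys f"
  then have deg: "tdeg m = n" using assms by (simp add: homogeneous_def)
  show "homogeneous (n - 1) (Poly_Mapping.single (m - Poly_Mapping.single i 1)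
      (of_nat (Poly_Mapping.lookup m i) * Poly_Mapping.lookup f m))"
  proof (cases "Poly_Mapping.lookup m i = 0")
    case False
    then have "Poly_Mapping.single i 1 + (m - Poly_Mapping.single i 1) = m"
      by (intro poly_mapping_eqI) (auto simp: lookup_add lookup_minus lookup_single when_def)
    then have "tdeg (Poly_Mapping.single i 1) + tdeg (m - Poly_Mapping.single i 1) = n"
      by (metis deg tdeg_add)
    moreover have "tdeg (Poly_Mapping.single i 1) = 1"
      by (simp add: tdeg_def lookup_single when_def)
    ultimately have "tdeg (m - Poly_Mapping.single i 1) = n - 1" by linarith
    then show ?thesis by (simp add: homogeneous_def del: One_nat_def)
  qed simp
qed

lemma euler_single:
  "(\<Sum>i\<in>UNIV. pvar i * pdiff i (Poly_Mapping.single m c)) =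
    of_nat (tdeg m) * Poly_Mapping.single m (c :: 'k::comm_ring_1)"
proof -
  have "pvar i * pdiff i (Poly_Mapping.single m c) = Poly_Mapping.single m (of_nat (Poly_Mapping.lookup m i) * c)" for i
  proof (cases "Poly_Mapping.lookup m i = 0")
    case False
    then have "Poly_Mapping.single i 1 + (m - Poly_Mapping.single i 1) = m"
      by (intro poly_mapping_eqI) (auto simp: lookup_add lookup_minus lookup_single when_def)
    then show ?thesis by (simp add: pvar_def pdiff_single mult_single del: One_nat_def)
  qed (simp add: pdiff_single)
  then have "(\<Sum>i\<in>UNIV. pvar i * pdiff i (Poly_Mapping.single m c)) =
      (\<Sum>i\<in>UNIV. Poly_Mapping.single m (of_nat (Poly_Mapping.lookup m i) * c))" by simp
  also have "\<dots> = Poly_Mapping.single m (\<Sum>i\<in>UNIV. of_nat (Poly_Mapping.lookup m i) * c)"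
    by (simp add: sum_3 single_add)
  also have "\<dots> = of_nat (tdeg m) * Poly_Mapping.single m c"
    by (simp add: tdeg_def mult_single flip: sum_distrib_right single_of_nat)
  finally show ?thesis .
qed

lemma euler_formula:
  assumes "homogeneous n (f :: 'k::comm_ring_1 poly3)"
  shows "(\<Sum>i\<in>UNIV. pvar i * pdiff i f) = of_nat n * f"
proof -
  have sum: "(\<Sum>i\<in>UNIV. pvar i * pdiff i (\<Sum>m\<in>S. g m)) = (\<Sum>m\<in>S. \<Sum>i\<in>UNIV. pvar i * pdiff i (g m))"
    if "finite S" for S and g :: "expo \<Rightarrow> 'k poly3"
    using that by (induction S) (simp_all add: pdiff_add distrib_left sum.distrib)
  let ?s = "\<lambda>m. Poly_Mapping.single m (Poly_Mapping.lookup f m)"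
  have "(\<Sum>i\<in>UNIV. pvar i * pdiff i (\<Sum>m\<in>Poly_Mapping.keys f. ?s m)) =
      (\<Sum>m\<in>Poly_Mapping.keys f. of_nat (tdeg m) * ?s m)"
    by (simp only: sum finite_keys euler_single)
  also have "\<dots> = (\<Sum>m\<in>Poly_Mapping.keys f. of_nat n * ?s m)"
    using assms by (intro sum.cong) (auto simp: homogeneous_def)
  also have "\<dots> = of_nat n * (\<Sum>m\<in>Poly_Mapping.keys f. ?s m)" by (simp add: sum_distrib_left)
  finally show ?thesis by (simp flip: poly_mapping_sum_single)
qed

definition apply_derivation :: "'k::comm_ring_1 poly3 ^ 3 \<Rightarrow> 'k poly3 \<Rightarrow> 'k poly3" where
  "apply_derivation \<theta> f = (\<Sum>i\<in>UNIV. \<theta> $ i * pdiff i f)"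

lemma apply_derivation_mult:
  "apply_derivation \<theta> (f * g) = apply_derivation \<theta> f * g + f * apply_derivation \<theta> g"
  by (simp add: apply_derivation_def pdiff_mult sum_3 algebra_simps)

text \<open>For \<theta> = c \<eta> + k E with E the Euler derivation, which multiplies a form by
  its degree.\<close>

lemma apply_derivation_combination:
  "(\<And>i. \<theta> $ i = c * \<eta> $ i + k * pvar i) \<Longrightarrow> homogeneous n f \<Longrightarrow>
    apply_derivation \<theta> f = c * apply_derivation \<eta> f + k * (of_nat n * f)"
  by (simp add: apply_derivation_def distrib_right sum.distrib mult.assoc flip: euler_formula sum_distrib_left)

lemma homogeneous_apply_derivation:
  assumes "\<And>i. homogeneous m (\<theta> $ i)" "homogeneous n f"
  shows "homogeneous (m + (n - 1)) (apply_derivation \<theta> f)"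
  unfolding apply_derivation_def
  by (intro homogeneous_sum homogeneous_mult homogeneous_pdiff assms)

lemma D0_iff: "\<theta> \<in> D0 A \<longleftrightarrow> apply_derivation \<theta> (defining_poly A) = 0"
  by (simp add: D0_def apply_derivation_def)

section \<open>Linear forms and arrangements\<close>

lemma linear_form_eq: "linear_form a = (\<Sum>i\<in>UNIV. pconst (a $ i) * pvar i)"
  by (simp add: linear_form_def pvar_def mult_single)

lemma lookup_linear_form: "Poly_Mapping.lookup (linear_form a) (Poly_Mapping.single i 1) = a $ i"
proof -
  have "Poly_Mapping.single j (1::nat) = Poly_Mapping.single i 1 \<longleftrightarrow> j = i" for j :: 3
    by (metis lookup_single_eq lookup_single_not_eq zero_neq_one)
  then show ?thesis
    unfolding linear_form_def lookup_sum lookup_single when_def by simp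
qed

lemma linear_form_inj: "linear_form a = linear_form b \<Longrightarrow> a = b"
  unfolding vec_eq_iff by (metis lookup_linear_form)

lemma linear_form_zero [simp]: "linear_form 0 = 0"
  by (simp add: linear_form_def)

lemma linear_form_nonzero: "a \<noteq> 0 \<Longrightarrow> linear_form a \<noteq> 0"
  using linear_form_inj[of a 0] by auto

lemma homogeneous_linear_form: "homogeneous 1 (linear_form (a :: 'k::field ^ 3))"
  unfolding linear_form_eq
  using homogeneous_mult[OF homogeneous_pconst homogeneous_pvar] by (intro homogeneous_sum) simp

lemma linear_form_scale: "linear_form (c *s a) = pconst c * linear_form a"
  by (simp add: linear_form_def sum_distrib_left mult_single)

lemma linear_form_diff: "linear_form (a - b) = linear_form a - linear_form b"
  by (simp add: linear_form_def single_diff sum_subtractf)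

lemma homogeneous_degree_one_prime:
  assumes "homogeneous 1 (f :: 'k::field poly3)" "f \<noteq> 0"
  shows "prime_elem f"
proof (rule irreducible_imp_prime_elem_poly3, rule irreducibleI)
  show "\<not> f dvd 1" using homogeneous_not_unit[OF assms(1)] by simp
  fix a b assume ab: "f = a * b"
  then have nz: "a \<noteq> 0" "b \<noteq> 0" using assms(2) by auto
  have "homogeneous 1 (a * b)" using assms(1) ab by simp
  then obtain i j where ij: "homogeneous i a" "homogeneous j b" "i + j = 1"
    using nz by (rule homogeneous_factor)
  then consider "i = 0" | "j = 0" by linarith
  then show "a dvd 1 \<or> b dvd 1"
  proof cases
    case 1
    then show ?thesis using homogeneous_0_dvd_1[of a] ij(1) nz(1) by simp
  next
    case 2
    then show ?thesis using homogeneous_0_dvd_1[of b] ij(2) nz(2) by simp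
  qed
qed (rule assms(2))

lemma prime_linear_form: "a \<noteq> 0 \<Longrightarrow> prime_elem (linear_form a)"
  by (intro homogeneous_degree_one_prime homogeneous_linear_form linear_form_nonzero)

lemma line_scale: "c \<noteq> 0 \<Longrightarrow> line (c *s a) = line a"
  unfolding line_def by (simp add: mult.assoc flip: sum_distrib_left)

lemma linear_form_dvd:
  assumes "linear_form a dvd linear_form b" "b \<noteq> 0"
  shows "\<exists>c. c \<noteq> 0 \<and> b = c *s a"
proof -
  obtain c where c: "c \<noteq> 0" "linear_form b = linear_form a * pconst c"
    using homogeneous_linear_form[of b] homogeneous_linear_form[of a] zero_less_Suc[of 0, folded One_nat_def] assms(1)
      linear_form_nonzero[OF assms(2)] by (rule homogeneous_degree_one_dvd)
  then have "linear_form b = linear_form (c *s a)" by (simp add: linear_form_scale mult.commute)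
  then show ?thesis using c(1) linear_form_inj by blast
qed

lemma linear_form_dvd_line: "linear_form a dvd linear_form b \<Longrightarrow> b \<noteq> 0 \<Longrightarrow> line b = line a"
  using linear_form_dvd line_scale by metis

lemma prime_elem_dvd_prod:
  assumes "prime_elem p" "finite S" "p dvd (\<Prod>x\<in>S. f x)"
  shows "\<exists>x\<in>S. p dvd f x"
  using assms(2,3)
proof (induction S rule: finite_induct)
  case empty
  then show ?case using assms(1) by (simp add: prime_elem_def)
next
  case (insert x S)
  then show ?case using assms(1) by (auto simp: prime_elem_dvd_mult_iff)
qed

lemma prod_primes_dvd:
  assumes "finite S" "\<And>x. x \<in> S \<Longrightarrow> prime_elem (f x)" "\<And>x. x \<in> S \<Longrightarrow> f x dvd g"
    and "\<And>x y. x \<in> S \<Longrightarrow> y \<in> S \<Longrightarrow> x \<noteq> y \<Longrightarrow> \<not> f x dvd f y"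
  shows "(\<Prod>x\<in>S. f x) dvd g"
  using assms
proof (induction S rule: finite_induct)
  case (insert x S)
  then have "(\<Prod>x\<in>S. f x) dvd g" by simp
  then obtain r where r: "g = (\<Prod>x\<in>S. f x) * r" by (elim dvdE)
  have "f x dvd (\<Prod>x\<in>S. f x) * r" using insert.prems(2)[of x] r by simp
  moreover have px: "prime_elem (f x)" using insert.prems(1) by simp
  ultimately have "f x dvd (\<Prod>x\<in>S. f x) \<or> f x dvd r" by (simp add: prime_elem_dvd_mult_iff)
  moreover have "\<not> f x dvd (\<Prod>x\<in>S. f x)"
  proof
    assume "f x dvd (\<Prod>x\<in>S. f x)"
    then obtain y where "y \<in> S" "f x dvd f y" using prime_elem_dvd_prod[OF px insert.hyps(1)] by blast
    moreover have "x \<noteq> y" using \<open>y \<in> S\<close> insert.hyps(2) by auto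
    ultimately show False using insert.prems(3)[of x y] by simp
  qed
  ultimately have "f x dvd r" by simp
  then show ?case unfolding r by (simp add: insert.hyps mult.commute mult_dvd_mono)
qed simp

lemma arrangement_subset: "arrangement A \<Longrightarrow> B \<subseteq> A \<Longrightarrow> arrangement B"
  unfolding arrangement_def by (meson finite_subset inj_on_subset subsetD)

lemma arrangement_not_dvd:
  assumes "arrangement A" "a \<in> A" "b \<in> A" "a \<noteq> b"
  shows "\<not> linear_form a dvd linear_form b"
  using assms linear_form_dvd_line[of a b] unfolding arrangement_def by (metis inj_onD)

lemma arrangement_prime: "arrangement A \<Longrightarrow> a \<in> A \<Longrightarrow> prime_elem (linear_form a)"
  unfolding arrangement_def using prime_linear_form by metis

lemma homogeneous_defining_poly: "homogeneous (card A) (defining_poly (A :: ('k::field ^ 3) set))"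
proof -
  have "homogeneous (\<Sum>a\<in>A. 1) (\<Prod>a\<in>A. linear_form a)"
    by (intro homogeneous_prod homogeneous_linear_form)
  then show ?thesis by (simp add: defining_poly_def)
qed

lemma defining_poly_nonzero: "arrangement A \<Longrightarrow> defining_poly A \<noteq> 0"
  unfolding defining_poly_def arrangement_def using linear_form_nonzero by (metis prod_zero_iff)

lemma defining_poly_remove:
  "arrangement A \<Longrightarrow> h \<in> A \<Longrightarrow> defining_poly A = linear_form h * defining_poly (A - {h})"
  unfolding defining_poly_def arrangement_def by (simp add: prod.remove)

lemma not_dvd_defining_poly_remove:
  assumes "arrangement A" "h \<in> A"
  shows "\<not> linear_form h dvd defining_poly (A - {h})"
proof
  assume "linear_form h dvd defining_poly (A - {h})"
  moreover have "finite (A - {h})" using assms(1) by (simp add: arrangement_def)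
  ultimately obtain b where "b \<in> A - {h}" "linear_form h dvd linear_form b"
    using prime_elem_dvd_prod[OF arrangement_prime[OF assms]] unfolding defining_poly_def by blast
  then show False using arrangement_not_dvd[OF assms(1,2)] by auto
qed

text \<open>Leibniz on Q = \<alpha> Q' shows that the prime \<alpha> divides \<theta>(\<alpha>) Q',
  and not Q' since the lines are distinct. So \<theta> is tangent to every line; cancelling \<alpha>
  leaves \<theta>(Q') = -k Q', the form in which \<open>euler_correction\<close> takes its
  input.\<close>

lemma linear_form_dvd_derivation:
  assumes "arrangement A" "h \<in> A" "\<theta> \<in> D0 A"
  shows "\<exists>k. apply_derivation \<theta> (linear_form h) = linear_form h * k \<and>
    k * defining_poly (A - {h}) + apply_derivation \<theta> (defining_poly (A - {h})) = 0"
proof -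
  let ?\<alpha> = "linear_form h" and ?Q = "defining_poly (A - {h})"
  have eq: "apply_derivation \<theta> ?\<alpha> * ?Q + ?\<alpha> * apply_derivation \<theta> ?Q = 0"
    using assms(3) unfolding D0_iff defining_poly_remove[OF assms(1,2)] apply_derivation_mult .
  then have "apply_derivation \<theta> ?\<alpha> * ?Q = ?\<alpha> * (- apply_derivation \<theta> ?Q)"
    by (simp add: eq_neg_iff_add_eq_0)
  then have "?\<alpha> dvd apply_derivation \<theta> ?\<alpha> * ?Q" by simp
  then have "?\<alpha> dvd apply_derivation \<theta> ?\<alpha>"
    using arrangement_prime[OF assms(1,2)] not_dvd_defining_poly_remove[OF assms(1,2)]
    by (simp add: prime_elem_dvd_mult_iff)
  then obtain k where k: "apply_derivation \<theta> ?\<alpha> = ?\<alpha> * k" by (elim dvdE)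
  have "?\<alpha> * (k * ?Q + apply_derivation \<theta> ?Q) = 0" using eq unfolding k by (simp add: algebra_simps)
  moreover have "?\<alpha> \<noteq> 0" using arrangement_prime[OF assms(1,2)] by auto
  ultimately show ?thesis using k by auto
qed

lemma pdiff_linear_form: "pdiff i (linear_form a) = pconst (a $ i)"
proof -
  have "pdiff i (linear_form a) = (\<Sum>j\<in>UNIV. pdiff i (Poly_Mapping.single (Poly_Mapping.single j 1) (a $ j)))"
    by (simp add: linear_form_def sum_3 pdiff_add)
  also have "\<dots> = (\<Sum>j\<in>UNIV. if j = i then pconst (a $ i) else 0)"
    by (intro sum.cong) (simp_all add: pdiff_single lookup_single when_def)
  finally show ?thesis by simp
qed

lemma apply_derivation_linear_form: "apply_derivation \<theta> (linear_form a) = (\<Sum>i\<in>UNIV. pconst (a $ i) * \<theta> $ i)"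
  by (simp add: apply_derivation_def pdiff_linear_form mult.commute)

text \<open>By the Euler formula a common prime factor divides the defining polynomial, which would then contain
  a line twice.\<close>

lemma partials_coprime:
  fixes A :: "('k::field_char_0 ^ 3) set"
  assumes A: "arrangement A" "A \<noteq> {}" and p: "codim_one p"
  shows "\<exists>i. pdiff i (defining_poly A) \<notin> p"
proof (rule ccontr)
  assume "\<nexists>i. pdiff i (defining_poly A) \<notin> p"
  then have all: "pdiff i (defining_poly A) \<in> p" for i by blast
  have hp: "hom_prime p" using p by (intro Proj3_hom_prime codim_one_Proj3)
  have fin: "finite A" using A(1) by (simp add: arrangement_def)
  have sum_in: "(\<Sum>i\<in>UNIV. f i) \<in> p" if "\<And>i::3. f i \<in> p" for f
    using that by (simp add: sum_3 hom_prime_add[OF hp])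
  have unit: "f \<notin> p" if f: "f dvd 1" for f
  proof -
    obtain k where "1 = f * k" using f by (elim dvdE)
    then show ?thesis using hom_prime_mult_iff[OF hp, of f k] hom_prime_one[OF hp] by auto
  qed
  have "(\<Sum>i\<in>UNIV. pvar i * pdiff i (defining_poly A)) \<in> p"
    using all by (intro sum_in) (simp add: hom_prime_mult_iff[OF hp])
  then have "of_nat (card A) * defining_poly A \<in> p"
    unfolding euler_formula[OF homogeneous_defining_poly] .
  \<comment> \<open>In characteristic 0 the number of lines is a nonzero constant, so the Euler
    formula puts the defining polynomial itself into p.\<close>
  moreover have "homogeneous 0 (of_nat (card A) :: 'k poly3)"
    using homogeneous_pconst[of "of_nat (card A) :: 'k"] by simp
  then have "(of_nat (card A) :: 'k poly3) \<notin> p"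
    using A(2) fin by (intro unit homogeneous_0_dvd_1) auto
  ultimately have "defining_poly A \<in> p" by (simp add: hom_prime_mult_iff[OF hp])
  then obtain a where a: "a \<in> A" "linear_form a \<in> p"
    unfolding defining_poly_def using hom_prime_prod[OF hp, of A linear_form] by auto
  have p_eq: "p = {f. linear_form a dvd f}"
    using codim_one_eq_principal[OF p arrangement_prime[OF A(1) a(1)] homogeneous_linear_form _ a(2)] by simp
  let ?Q = "defining_poly (A - {a})"
  have "a \<noteq> 0" using A(1) a(1) unfolding arrangement_def by metis
  then obtain i where i: "a $ i \<noteq> 0" by (auto simp: vec_eq_iff)
  \<comment> \<open>With Q = \<alpha> Q', the partial derivative is a_i Q' + \<alpha> times a
    derivative of Q'. A coordinate with a_i nonzero leaves \<alpha> dividing Q'.\<close>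
  have "linear_form a dvd pconst (a $ i) * ?Q + linear_form a * pdiff i ?Q"
    using all[of i] p_eq by (simp add: defining_poly_remove[OF A(1) a(1)] pdiff_mult pdiff_linear_form)
  then have "linear_form a dvd pconst (a $ i) * ?Q"
    by (simp add: dvd_add_left_iff)
  then have "pconst (a $ i) * ?Q \<in> p" by (simp add: p_eq)
  moreover have "pconst (a $ i) \<notin> p"
    using i by (intro unit homogeneous_0_dvd_1 homogeneous_pconst) (metis lookup_single_eq lookup_zero)
  ultimately have "linear_form a dvd ?Q" by (simp add: hom_prime_mult_iff[OF hp]) (simp add: p_eq)
  then show False using not_dvd_defining_poly_remove[OF A(1) a(1)] by simp
qed

lemma D_sheaf_eq: "D_sheaf A = associated_sheaf (syzygies (\<lambda>i. pdiff i (defining_poly A)))"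
  by (simp add: D_sheaf_def D0_def syzygies_def)

lemma stable_D_sheaf_iff:
  fixes A :: "('k::field_char_0 ^ 3) set"
  assumes A: "arrangement A" "A \<noteq> {}"
  shows "slope_stable (D_sheaf A) \<longleftrightarrow>
      (\<forall>\<theta> m. \<theta> \<in> D0 A \<longrightarrow> \<theta> \<noteq> 0 \<longrightarrow> (\<forall>i. homogeneous m (\<theta> $ i)) \<longrightarrow> card A - 1 < 2 * m)"
    and "slope_semistable (D_sheaf A) \<longleftrightarrow>
      (\<forall>\<theta> m. \<theta> \<in> D0 A \<longrightarrow> \<theta> \<noteq> 0 \<longrightarrow> (\<forall>i. homogeneous m (\<theta> $ i)) \<longrightarrow> card A - 1 \<le> 2 * m)"
proof -
  let ?q = "\<lambda>i. pdiff i (defining_poly A)"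
  have D0: "D0 A = syzygies ?q" by (simp add: D0_def syzygies_def)
  have hom: "homogeneous (card A - 1) (?q i)" for i by (rule homogeneous_pdiff[OF homogeneous_defining_poly])
  show "slope_stable (D_sheaf A) \<longleftrightarrow>
      (\<forall>\<theta> m. \<theta> \<in> D0 A \<longrightarrow> \<theta> \<noteq> 0 \<longrightarrow> (\<forall>i. homogeneous m (\<theta> $ i)) \<longrightarrow> card A - 1 < 2 * m)"
    unfolding D_sheaf_eq D0 by (rule slope_stable_kernel_iff[OF hom partials_coprime[OF A]])
  show "slope_semistable (D_sheaf A) \<longleftrightarrow>
      (\<forall>\<theta> m. \<theta> \<in> D0 A \<longrightarrow> \<theta> \<noteq> 0 \<longrightarrow> (\<forall>i. homogeneous m (\<theta> $ i)) \<longrightarrow> card A - 1 \<le> 2 * m)"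
    unfolding D_sheaf_eq D0 by (rule slope_semistable_kernel_iff[OF hom partials_coprime[OF A]])
qed


section \<open>Deletion and restriction\<close>

text \<open>The Euler derivation multiplies the defining polynomial by the number of lines, so no
  nonzero multiple of it annihilates that polynomial. The factor e spares the division by an integer
  in the applications.\<close>

lemma euler_multiple_not_in_D0:
  fixes A :: "('k::field_char_0 ^ 3) set"
  assumes A: "arrangement A" "A \<noteq> {}" and "\<theta> \<in> D0 A" and e: "e \<noteq> 0"
    and eq: "\<And>i. of_nat e * \<theta> $ i = f * pvar i"
  shows "\<theta> = 0"
proof -
  let ?Q = "defining_poly A"
  have "of_nat e * apply_derivation \<theta> ?Q = (\<Sum>i\<in>UNIV. (of_nat e * \<theta> $ i) * pdiff i ?Q)"
    by (simp add: apply_derivation_def sum_distrib_left mult.assoc)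
  also have "\<dots> = f * (\<Sum>i\<in>UNIV. pvar i * pdiff i ?Q)"
    unfolding eq by (simp add: sum_distrib_left mult.assoc)
  also have "\<dots> = f * (of_nat (card A) * ?Q)"
    unfolding euler_formula[OF homogeneous_defining_poly] ..
  finally have "f * (of_nat (card A) * ?Q) = 0" using assms(3) by (simp add: D0_iff)
  moreover have "card A \<noteq> 0" using A by (simp add: arrangement_def)
  ultimately have "f = 0" using defining_poly_nonzero[OF A(1)] by simp
  then have "\<theta> $ i = 0" for i using eq[of i] e by simp
  then show ?thesis by (simp add: vec_eq_iff)
qed

text \<open>With e the number of lines and E the Euler derivation, E(Q) = e Q, so e \<eta> + k E
  annihilates Q when \<eta>(Q) = -k Q. It vanishes only if e \<eta> = -k E.\<close>

lemma euler_correction: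
  fixes A :: "('k::field_char_0 ^ 3) set"
  assumes A: "arrangement A" "A \<noteq> {}" and hom: "\<And>i. homogeneous m (\<eta> $ i)"
    and k: "k * defining_poly A + apply_derivation \<eta> (defining_poly A) = 0"
    and not_euler: "\<exists>i. of_nat (card A) * \<eta> $ i \<noteq> - k * pvar i"
  shows "\<exists>\<theta>\<in>D0 A. \<theta> \<noteq> 0 \<and> (\<forall>i. homogeneous m (\<theta> $ i))"
proof -
  let ?Q = "defining_poly A" and ?e = "card A"
  have e: "?e \<noteq> 0" using A by (simp add: arrangement_def)
  define \<theta> :: "'k poly3 ^ 3" where "\<theta> = (\<chi> i. of_nat ?e * \<eta> $ i + k * pvar i)"
  have "apply_derivation \<theta> ?Q = of_nat ?e * apply_derivation \<eta> ?Q + k * (of_nat ?e * ?Q)"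
    by (rule apply_derivation_combination) (simp_all add: \<theta>_def homogeneous_defining_poly)
  also have "\<dots> = of_nat ?e * (k * ?Q + apply_derivation \<eta> ?Q)" by (simp add: algebra_simps)
  finally have D0: "\<theta> \<in> D0 A" using k by (simp add: D0_iff)
  have "\<theta> \<noteq> 0"
  proof
    assume "\<theta> = 0"
    then have "of_nat ?e * \<eta> $ i + k * pvar i = 0" for i
      by (simp add: \<theta>_def vec_eq_iff)
    then show False using not_euler by (simp add: eq_neg_iff_add_eq_0)
  qed
  \<comment> \<open>Compare degrees in k Q = -\<eta>(Q): a nonzero k has degree m - 1, so the
    correction keeps the degree m.\<close>
  moreover have "homogeneous m (k * pvar i)" for i
  proof (cases "k = 0")
    case False
    have "k * ?Q = - apply_derivation \<eta> ?Q" using k by (simp add: eq_neg_iff_add_eq_0)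
    then have "homogeneous (m + (?e - 1)) (k * ?Q)"
      using homogeneous_uminus[OF homogeneous_apply_derivation[OF hom homogeneous_defining_poly]] by simp
    then obtain r s where rs: "homogeneous r k" "homogeneous s ?Q" "r + s = m + (?e - 1)"
      using False defining_poly_nonzero[OF A(1)] by (rule homogeneous_factor)
    have "s = ?e" using homogeneous_unique[OF rs(2) homogeneous_defining_poly defining_poly_nonzero[OF A(1)]] .
    then have "r + 1 = m" using rs(3) e by linarith
    then show ?thesis using homogeneous_mult[OF rs(1) homogeneous_pvar[of i]] by simp
  qed simp
  moreover have "homogeneous m (of_nat ?e * \<eta> $ i)" for i
    using homogeneous_mult[OF homogeneous_pconst[of "of_nat ?e :: 'k"] hom[of i]] by simp
  ultimately show ?thesis using D0
    by (intro bexI[of _ \<theta>] conjI allI) (simp_all add: \<theta>_def homogeneous_add)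
qed

text \<open>Apply \<open>euler_correction\<close> to \<theta> itself. A vanishing result would make
  a nonzero multiple of \<theta> a multiple of the Euler derivation, impossible in
  \<open>D0 A\<close>.\<close>

lemma D0_deletion:
  fixes A :: "('k::field_char_0 ^ 3) set"
  assumes A: "arrangement A" "h \<in> A" "A - {h} \<noteq> {}"
    and \<theta>: "\<theta> \<in> D0 A" "\<theta> \<noteq> 0" "\<And>i. homogeneous m (\<theta> $ i)"
  shows "\<exists>\<eta>\<in>D0 (A - {h}). \<eta> \<noteq> 0 \<and> (\<forall>i. homogeneous m (\<eta> $ i))"
proof -
  have A': "arrangement (A - {h})" using arrangement_subset[OF A(1)] by blast
  obtain k where k: "k * defining_poly (A - {h}) + apply_derivation \<theta> (defining_poly (A - {h})) = 0"
    using linear_form_dvd_derivation[OF A(1,2) \<theta>(1)] by blast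
  have e: "card (A - {h}) \<noteq> 0" using A' A(3) by (simp add: arrangement_def)
  show ?thesis
  proof (rule euler_correction[OF A' A(3) \<theta>(3) k])
    show "\<exists>i. of_nat (card (A - {h})) * \<theta> $ i \<noteq> - k * pvar i"
      using euler_multiple_not_in_D0[OF A(1) _ \<theta>(1) e, of "- k"] A(2) \<theta>(2) by blast
  qed
qed

text \<open>Reduction modulo the linear form of \<open>h\<close>, for \<open>h $ i \<noteq> 0\<close>, as an endomorphism of the polynomial ring.\<close>

definition restrict_form :: "'k::field ^ 3 \<Rightarrow> 3 \<Rightarrow> 'k poly3 \<Rightarrow> 'k poly3" where
  "restrict_form h i = insertion pconst (\<lambda>j. if j = i then pvar i - pconst (1 / h $ i) * linear_form h else pvar j)"

lemma dvd_diff_mult: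
  "(d :: 'a::comm_ring_1) dvd x - x' \<Longrightarrow> d dvd y - y' \<Longrightarrow> d dvd x * y - x' * y'"
proof -
  assume "d dvd x - x'" "d dvd y - y'"
  then have "d dvd (x - x') * y + x' * (y - y')" by (intro dvd_add) auto
  then show ?thesis by (simp add: algebra_simps)
qed

lemma dvd_diff_power: "(d :: 'a::comm_ring_1) dvd x - x' \<Longrightarrow> d dvd x ^ n - x' ^ n"
  by (induction n) (simp_all add: dvd_diff_mult)

lemma insertion_pvar: "insertion pconst y (pvar i) = (y i :: 'k::comm_ring_1 poly3)"
proof -
  have "(\<Prod>j\<in>UNIV. y j ^ Poly_Mapping.lookup (Poly_Mapping.single i 1) j) = (\<Prod>j\<in>UNIV. if j = i then y i else 1)"
    by (intro prod.cong) (simp_all add: lookup_single when_def)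
  then show ?thesis
    unfolding pvar_def insertion_single[OF comm_ring_hom_pconst] by simp
qed

lemma insertion_pconst: "insertion pconst y (pconst c) = (pconst c :: 'k::comm_ring_1 poly3)"
  by (simp add: insertion_single[OF comm_ring_hom_pconst])

context
  fixes h :: "'k::field ^ 3" and i :: 3
  assumes hi: "h $ i \<noteq> 0"
begin

interpretation rho: comm_ring_hom "restrict_form h i"
  unfolding restrict_form_def by (intro comm_ring_hom_insertion comm_ring_hom_pconst)

lemma restrict_form_hom: "comm_ring_hom (restrict_form h i)"
  by (rule rho.comm_ring_hom_axioms)

lemma restrict_form_pvar:
  "restrict_form h i (pvar j) = (if j = i then pvar i - pconst (1 / h $ i) * linear_form h else pvar j)"
  by (simp add: restrict_form_def insertion_pvar)

lemma restrict_form_pconst: "restrict_form h i (pconst c) = pconst c"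
  by (simp add: restrict_form_def insertion_pconst)

text \<open>The image is the linear form congruent to b modulo h in which the variable i no longer
  occurs.\<close>

lemma restrict_form_linear: "restrict_form h i (linear_form b) = linear_form (b - (b $ i / h $ i) *s h)"
proof -
  have "restrict_form h i (linear_form b) = (\<Sum>j\<in>UNIV. pconst (b $ j) * restrict_form h i (pvar j))"
    unfolding linear_form_eq by (simp add: rho.hom_sum rho.hom_mult restrict_form_pconst)
  also have "\<dots> = (\<Sum>j\<in>UNIV. pconst (b $ j) * pvar j -
      (if j = i then pconst (b $ i) * (pconst (1 / h $ i) * linear_form h) else 0))"
    by (intro sum.cong) (simp_all add: restrict_form_pvar algebra_simps)
  also have "\<dots> = linear_form b - pconst (b $ i) * (pconst (1 / h $ i) * linear_form h)"
    by (simp add: sum_subtractf linear_form_eq)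
  also have "\<dots> = linear_form (b - (b $ i / h $ i) *s h)"
    by (simp add: linear_form_diff linear_form_scale mult_single flip: mult.assoc)
  finally show ?thesis .
qed

lemma restrict_form_self: "restrict_form h i (linear_form h) = 0"
  using hi by (simp add: restrict_form_linear)

text \<open>Each variable differs from its image by a multiple of the form of h, and congruences are
  compatible with products and sums. So the kernel of the restriction is the ideal of that
  form.\<close>

lemma restrict_form_congruent: "linear_form h dvd f - restrict_form h i f"
proof (induction f rule: poly_mapping_induct_add)
  case (single m c)
  let ?y = "\<lambda>j. restrict_form h i (pvar j)"
  have y: "linear_form h dvd pvar j - ?y j" for j by (simp add: restrict_form_pvar)
  have "Poly_Mapping.single m c = pconst c * (\<Prod>j\<in>UNIV. pvar j ^ Poly_Mapping.lookup m j)"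
    by (simp add: prod_pvar_power mult_single)
  then have s: "Poly_Mapping.single m c = pconst c * (pvar 1 ^ Poly_Mapping.lookup m 1 *
      pvar 2 ^ Poly_Mapping.lookup m 2 * pvar 3 ^ Poly_Mapping.lookup m 3)"
    by (simp add: prod_UNIV_3)
  have "linear_form h dvd pconst c * (pvar 1 ^ Poly_Mapping.lookup m 1 *
      pvar 2 ^ Poly_Mapping.lookup m 2 * pvar 3 ^ Poly_Mapping.lookup m 3) -
      pconst c * (?y 1 ^ Poly_Mapping.lookup m 1 * ?y 2 ^ Poly_Mapping.lookup m 2 * ?y 3 ^ Poly_Mapping.lookup m 3)"
    by (intro dvd_diff_mult dvd_diff_power y) simp
  then show ?case
    unfolding s by (simp add: rho.hom_mult rho.hom_power restrict_form_pconst)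
next
  case (add f g)
  then have "linear_form h dvd (f - restrict_form h i f) + (g - restrict_form h i g)" by (rule dvd_add)
  then show ?case by (simp add: rho.hom_add algebra_simps)
qed simp

lemma restrict_form_eq_0_iff: "restrict_form h i f = 0 \<longleftrightarrow> linear_form h dvd f"
proof
  assume "restrict_form h i f = 0"
  then show "linear_form h dvd f" using restrict_form_congruent[of f] by simp
next
  assume "linear_form h dvd f"
  then show "restrict_form h i f = 0" by (auto elim!: dvdE simp: rho.hom_mult restrict_form_self)
qed

lemma homogeneous_restrict_form:
  assumes "homogeneous n f"
  shows "homogeneous n (restrict_form h i f)"
proof -
  let ?y = "\<lambda>j. if j = i then pvar i - pconst (1 / h $ i) * linear_form h else pvar j"
  have y: "homogeneous 1 (?y j)" for j
    using homogeneous_mult[OF homogeneous_pconst homogeneous_linear_form, of "1 / h $ i" h] homogeneous_pvar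
    by (auto intro!: homogeneous_diff)
  show ?thesis
    unfolding restrict_form_def insertion_def
  proof (rule homogeneous_sum)
    fix m assume "m \<in> Poly_Mapping.keys f"
    then have "(\<Sum>j\<in>UNIV. Poly_Mapping.lookup m j * 1) = n" using assms by (simp add: homogeneous_def tdeg_def)
    moreover have "homogeneous (0 + (\<Sum>j\<in>UNIV. Poly_Mapping.lookup m j * 1))
        (pconst (Poly_Mapping.lookup f m) * (\<Prod>j\<in>UNIV. ?y j ^ Poly_Mapping.lookup m j))"
      by (intro homogeneous_mult homogeneous_pconst homogeneous_prod homogeneous_power y)
    ultimately show "homogeneous n (pconst (Poly_Mapping.lookup f m) * (\<Prod>j\<in>UNIV. ?y j ^ Poly_Mapping.lookup m j))"
      by simp
  qed
qed

end

lemma pvar_not_dvd_pvar: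
  assumes "i \<noteq> j"
  shows "\<not> pvar i dvd (pvar j :: 'k::field poly3)"
proof
  assume dvd: "pvar i dvd (pvar j :: 'k poly3)"
  have "(0::nat) < 1" by simp
  with homogeneous_pvar[of j] homogeneous_pvar[of i] obtain c :: 'k where "c \<noteq> 0" "pvar j = pvar i * pconst c"
    using dvd pvar_nonzero[of j] by (rule homogeneous_degree_one_dvd)
  then have "Poly_Mapping.lookup (pvar j * pconst (1::'k)) (Poly_Mapping.single j 1) =
      Poly_Mapping.lookup (pvar i * pconst c) (Poly_Mapping.single j 1)" by simp
  then show False using assms by (simp only: lookup_pvar_mult_pconst) simp
qed

text \<open>A multiple of h vanishes on its line, so the projected forms still cut out the points of
  the restriction.\<close>

lemma line_Int_line_diff:
  "line h \<inter> line (b - c *s h) = line h \<inter> line (b :: 'k::field ^ 3)"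
proof -
  have "(\<Sum>i\<in>UNIV. (b - c *s h) $ i * v $ i) = (\<Sum>i\<in>UNIV. b $ i * v $ i) - c * (\<Sum>i\<in>UNIV. h $ i * v $ i)" for v
    by (simp add: sum_3 algebra_simps)
  then show ?thesis unfolding line_def by auto
qed

lemma dual_bivector_pconst:
  "dual_bivector (\<lambda>j. pconst (h j)) a b = (pconst (dual_bivector h a b) :: 'k::comm_ring_1 poly3)"
  by (simp add: dual_bivector_def single_uminus)

text \<open>The contraction is the cross product of b and h up to sign, which vanishes only for
  proportional vectors.\<close>

lemma dual_bivector_contraction_nonzero:
  assumes "h $ i \<noteq> (0 :: 'k::field)" "b \<noteq> (b $ i / h $ i) *s h"
  shows "\<exists>c. (\<Sum>a\<in>UNIV. b $ a * dual_bivector (\<lambda>j. h $ j) a c) \<noteq> 0"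
proof (rule ccontr)
  assume "\<not> ?thesis"
  then have 0: "(\<Sum>a\<in>UNIV. b $ a * dual_bivector (\<lambda>j. h $ j) a c) = 0" for c by blast
  have "b $ 2 * h $ 3 = b $ 3 * h $ 2" "b $ 1 * h $ 3 = b $ 3 * h $ 1" "b $ 1 * h $ 2 = b $ 2 * h $ 1"
    using 0[of 1] 0[of 2] 0[of 3] by (simp_all add: sum_3 dual_bivector_def three_distinct)
  then have "\<forall>j l. b $ j * h $ l = b $ l * h $ j" by (simp add: forall_3)
  then have "b $ j = ((b $ i / h $ i) *s h) $ j" for j using assms(1) by (simp add: field_simps)
  then have "b = (b $ i / h $ i) *s h" unfolding vec_eq_iff by blast
  then show False using assms(2) by contradiction
qed

text \<open>On the line, \<open>\<theta>\<close> and the Euler derivation are both tangent to it, so their bivector is given by one form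
  \<open>\<Lambda>\<close> of degree \<open>m + 1\<close>, which vanishes at all points of the restriction.\<close>

lemma restriction_euler_multiple:
  fixes A :: "('k::field_char_0 ^ 3) set"
  assumes A: "arrangement A" "h \<in> A" and hi: "h $ i \<noteq> 0"
    and \<theta>: "\<theta> \<in> D0 A" "\<And>l. homogeneous m (\<theta> $ l)"
    and m: "m + 1 < card (restriction A h)"
  shows "\<exists>g. (\<forall>l. homogeneous m (g * pvar l)) \<and> (\<forall>l. linear_form h dvd \<theta> $ l - g * pvar l)"
proof -
  interpret rho: comm_ring_hom "restrict_form h i" by (rule restrict_form_hom[OF hi])
  let ?R = "restrict_form h i"
  \<comment> \<open>X and T are the coefficient vectors of the Euler derivation and of \<theta> on
    the line.\<close>
  define X :: "'k poly3 ^ 3" where "X = (\<chi> l. ?R (pvar l))"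
  define T :: "'k poly3 ^ 3" where "T = (\<chi> l. ?R (\<theta> $ l))"
  have fin: "finite A" using A(1) by (simp add: arrangement_def)
  have X_sum: "(\<Sum>l\<in>UNIV. pconst (b $ l) * X $ l) = ?R (linear_form b)" for b
    unfolding linear_form_eq X_def by (simp add: rho.hom_sum rho.hom_mult restrict_form_pconst[OF hi])
  have T_sum: "\<exists>k. (\<Sum>l\<in>UNIV. pconst (b $ l) * T $ l) = ?R (linear_form b) * k" if b: "b \<in> A" for b
  proof -
    obtain k where k: "apply_derivation \<theta> (linear_form b) = linear_form b * k"
      using linear_form_dvd_derivation[OF A(1) b \<theta>(1)] by blast
    have "(\<Sum>l\<in>UNIV. pconst (b $ l) * T $ l) = ?R (apply_derivation \<theta> (linear_form b))"
      unfolding apply_derivation_linear_form T_def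
      by (simp add: rho.hom_sum rho.hom_mult restrict_form_pconst[OF hi])
    then show ?thesis unfolding k rho.hom_mult by blast
  qed
  have X0: "(\<Sum>l\<in>UNIV. X $ l * pconst (h $ l)) = 0"
    using X_sum[of h] restrict_form_self[OF hi] by (simp add: mult.commute)
  have T0: "(\<Sum>l\<in>UNIV. T $ l * pconst (h $ l)) = 0"
    using T_sum[OF A(2)] restrict_form_self[OF hi] by (simp add: mult.commute)
  obtain j k where jk: "i = 1 \<longrightarrow> j = 2 \<and> k = 3" "i = 2 \<longrightarrow> j = 3 \<and> k = 1" "i = 3 \<longrightarrow> j = 1 \<and> k = 2"
    and biv: "\<forall>a b. pconst (h $ i) * (X $ a * T $ b - X $ b * T $ a) =
      (X $ j * T $ k - X $ k * T $ j) * dual_bivector (\<lambda>l. pconst (h $ l)) a b"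
    using kernel_bivector[where q = "\<lambda>l. pconst (h $ l)" and i = i, OF X0 T0] by (elim exE conjE)
  have distinct: "j \<noteq> i" "k \<noteq> i" "j \<noteq> k"
    using jk exhaust_3[of i] three_distinct by metis+
  have X_jk: "X $ j = pvar j" "X $ k = pvar k"
    using distinct by (simp_all add: X_def restrict_form_pvar[OF hi])
  \<comment> \<open>j and k are the coordinates other than i. Both X and T are orthogonal to h, so
    this single minor determines their whole bivector.\<close>
  define \<Lambda> where "\<Lambda> = X $ j * T $ k - X $ k * T $ j"
  have hX: "homogeneous 1 (X $ l)" and hT: "homogeneous m (T $ l)" for l
    unfolding X_def T_def using homogeneous_restrict_form[OF hi homogeneous_pvar] homogeneous_restrict_form[OF hi \<theta>(2)]
    by simp_all
  have h\<Lambda>: "homogeneous (1 + m) \<Lambda>"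
    unfolding \<Lambda>_def by (intro homogeneous_diff homogeneous_mult hX hT)
  define proj where "proj b = b - (b $ i / h $ i) *s h" for b :: "'k ^ 3"
  have proj_form: "?R (linear_form b) = linear_form (proj b)" for b
    unfolding proj_def by (rule restrict_form_linear[OF hi])
  have proj_nz: "proj b \<noteq> 0" if "b \<in> A - {h}" for b
  proof
    assume "proj b = 0"
    then have "linear_form h dvd linear_form b"
      using proj_form[of b] restrict_form_eq_0_iff[OF hi] by simp
    then show False using arrangement_not_dvd[OF A, of b] that by auto
  qed
  \<comment> \<open>Contract the bivector identity with b. One side becomes \<Lambda> times a
    nonzero constant; the other is divisible by b restricted to the line, since the Euler derivation
    and \<theta> both map the form of b into its ideal.\<close>
  have dvd\<Lambda>: "linear_form (proj b) dvd \<Lambda>" if b: "b \<in> A - {h}" for b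
  proof -
    obtain kb where kb: "(\<Sum>l\<in>UNIV. pconst (b $ l) * T $ l) = ?R (linear_form b) * kb"
      using T_sum b by blast
    have "b \<noteq> (b $ i / h $ i) *s h" using proj_nz[OF b] by (simp add: proj_def)
    then obtain c where c: "(\<Sum>a\<in>UNIV. b $ a * dual_bivector (\<lambda>l. h $ l) a c) \<noteq> 0"
      using dual_bivector_contraction_nonzero[OF hi] by blast
    define D where "D = (\<Sum>a\<in>UNIV. b $ a * dual_bivector (\<lambda>l. h $ l) a c)"
    have "\<Lambda> * pconst D = (\<Sum>a\<in>UNIV. pconst (b $ a) * (\<Lambda> * dual_bivector (\<lambda>l. pconst (h $ l)) a c))"
      unfolding D_def dual_bivector_pconst by (simp add: sum_3 single_add algebra_simps mult_single flip: mult.assoc)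
    also have "\<dots> = (\<Sum>a\<in>UNIV. pconst (b $ a) * (pconst (h $ i) * (X $ a * T $ c - X $ c * T $ a)))"
      using biv by (simp add: \<Lambda>_def)
    also have "\<dots> = pconst (h $ i) * ((\<Sum>a\<in>UNIV. pconst (b $ a) * X $ a) * T $ c -
        X $ c * (\<Sum>a\<in>UNIV. pconst (b $ a) * T $ a))"
      by (simp add: sum_3 algebra_simps)
    also have "\<dots> = linear_form (proj b) * (pconst (h $ i) * (T $ c - X $ c * kb))"
      unfolding kb X_sum proj_form by (simp add: algebra_simps)
    finally have "linear_form (proj b) dvd \<Lambda> * pconst D" by simp
    then have "linear_form (proj b) dvd \<Lambda> * pconst D * pconst (inverse D)" by (rule dvd_mult2)
    also have "\<Lambda> * pconst D * pconst (inverse D) = \<Lambda>"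
      using c by (simp add: D_def[symmetric] mult.assoc mult_single)
    finally show ?thesis .
  qed
  have "restriction A h = (\<lambda>b. line h \<inter> line b) ` proj ` (A - {h})"
    unfolding restriction_def deletion_def proj_def image_image line_Int_line_diff by blast
  \<comment> \<open>C picks one projected form for each point of the restriction. Distinct points
    make these forms pairwise nonproportional, so their product divides \<Lambda>.\<close>
  moreover from this obtain C where C: "C \<subseteq> proj ` (A - {h})" "inj_on (\<lambda>b. line h \<inter> line b) C"
    "restriction A h = (\<lambda>b. line h \<inter> line b) ` C"
    using subset_image_inj[of "restriction A h" "\<lambda>b. line h \<inter> line b" "proj ` (A - {h})"] by auto
  have finC: "finite C" using C(1) fin by (meson finite_Diff finite_imageI finite_subset)
  have card: "card (restriction A h) = card C" using card_image[OF C(2)] C(3) by simp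
  have C_proj: "x \<noteq> 0 \<and> linear_form x dvd \<Lambda>" if x: "x \<in> C" for x
  proof -
    obtain b where "b \<in> A - {h}" "x = proj b" using C(1) x by blast
    then show ?thesis using proj_nz dvd\<Lambda> by metis
  qed
  have prod: "(\<Prod>b\<in>C. linear_form b) dvd \<Lambda>"
  proof (rule prod_primes_dvd[OF finC])
    show "prime_elem (linear_form x)" if "x \<in> C" for x
      using C_proj[OF that] by (intro prime_linear_form) simp
    show "linear_form x dvd \<Lambda>" if "x \<in> C" for x using C_proj[OF that] by simp
    show "\<not> linear_form x dvd linear_form y" if "x \<in> C" "y \<in> C" "x \<noteq> y" for x y
    proof
      assume "linear_form x dvd linear_form y"
      moreover have "y \<noteq> 0" using C_proj[OF that(2)] by simp
      ultimately have "line y = line x" by (rule linear_form_dvd_line)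
      then show False using C(2) that by (auto simp: inj_on_def)
    qed
  qed
  \<comment> \<open>A nonzero form of degree m + 1 cannot be divisible by the product of more than m
    + 1 linear forms.\<close>
  have "\<Lambda> = 0"
  proof (rule ccontr)
    assume nz: "\<Lambda> \<noteq> 0"
    obtain r where r: "\<Lambda> = (\<Prod>b\<in>C. linear_form b) * r" using prod by (elim dvdE)
    have nz': "(\<Prod>b\<in>C. linear_form b) \<noteq> 0" "r \<noteq> 0" using nz unfolding r by auto
    have "homogeneous (\<Sum>b\<in>C. 1) (\<Prod>b\<in>C. linear_form b)"
      by (intro homogeneous_prod homogeneous_linear_form)
    then have hC: "homogeneous (card C) (\<Prod>b\<in>C. linear_form b)" by simp
    have "homogeneous (1 + m) ((\<Prod>b\<in>C. linear_form b) * r)" using h\<Lambda> unfolding r .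
    then obtain s t where "homogeneous s (\<Prod>b\<in>C. linear_form b)" "s + t = 1 + m"
      using nz' by (rule homogeneous_factor)
    moreover from this have "s = card C" using homogeneous_unique[OF _ hC nz'(1)] by blast
    ultimately show False using m card by linarith
  qed
  then have comm: "X $ a * T $ b = X $ b * T $ a" for a b
  proof -
    have "pconst (h $ i) \<noteq> 0" using hi by (metis lookup_single_eq lookup_zero)
    moreover have "pconst (h $ i) * (X $ a * T $ b - X $ b * T $ a) = 0"
      using biv[rule_format, of a b] \<open>\<Lambda> = 0\<close> by (simp only: \<Lambda>_def[symmetric] mult_zero_left)
    ultimately show ?thesis by simp
  qed
  \<comment> \<open>Now X and T are parallel, and X contains the coprime entries x_j and x_k. So x_j
    divides the entry j of T, and the quotient is the factor g.\<close>
  have "pvar j dvd pvar k * T $ j"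
    using comm[of j k] X_jk by (metis dvd_triv_left)
  moreover have "prime_elem (pvar j :: 'k poly3)"
    by (rule homogeneous_degree_one_prime[OF homogeneous_pvar pvar_nonzero])
  ultimately have "pvar j dvd T $ j"
    using pvar_not_dvd_pvar[OF distinct(3), where 'k = 'k] by (simp add: prime_elem_dvd_mult_iff)
  then obtain g where g: "T $ j = pvar j * g" by (elim dvdE)
  have T_eq: "T $ l = X $ l * g" for l
  proof -
    have "pvar j * T $ l = pvar j * (X $ l * g)" using comm[of j l] X_jk(1) g by (simp add: mult_ac)
    then show ?thesis using pvar_nonzero[of j, where 'k = 'k] by simp
  qed
  have "homogeneous m (g * pvar l)" for l
  proof (cases "g = 0")
    case False
    have "homogeneous m (pvar j * g)" using hT[of j] g by simp
    then obtain s t where st: "homogeneous s (pvar j :: 'k poly3)" "homogeneous t g" "s + t = m"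
      using pvar_nonzero False by (rule homogeneous_factor)
    have "s = 1" using homogeneous_unique[OF st(1) homogeneous_pvar pvar_nonzero] .
    then show ?thesis using homogeneous_mult[OF st(2) homogeneous_pvar[of l]] st(3) by (simp add: add.commute)
  qed simp
  moreover have "linear_form h dvd \<theta> $ l - g * pvar l" for l
  proof -
    have "\<theta> $ l - g * pvar l = (\<theta> $ l - T $ l) - g * (pvar l - X $ l)"
      unfolding T_eq by (simp add: algebra_simps)
    moreover have "linear_form h dvd \<theta> $ l - T $ l" "linear_form h dvd pvar l - X $ l"
      unfolding T_def X_def using restrict_form_congruent[OF hi] by simp_all
    then have "linear_form h dvd (\<theta> $ l - T $ l) - g * (pvar l - X $ l)"
      by (rule dvd_diff[OF _ dvd_mult])
    ultimately show ?thesis by (simp only:)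
  qed
  ultimately show ?thesis by blast
qed

text \<open>Write \<theta> = \<alpha> \<eta> + g E. Inserting this in \<theta>(Q) = 0 and cancelling
  twice the equation \<alpha> of the line gives \<eta>(Q') = -k Q', so \<eta> becomes a syzygy of
  the deletion after the Euler correction. Dividing by \<alpha> has lowered the degree by
  one.\<close>

lemma D0_restriction:
  fixes A :: "('k::field_char_0 ^ 3) set"
  assumes A: "arrangement A" "h \<in> A" "A - {h} \<noteq> {}"
    and \<theta>: "\<theta> \<in> D0 A" "\<theta> \<noteq> 0" "\<And>l. homogeneous m (\<theta> $ l)"
    and m: "m + 1 < card (restriction A h)"
  shows "\<exists>n. m = Suc n \<and> (\<exists>\<eta>\<in>D0 (A - {h}). \<eta> \<noteq> 0 \<and> (\<forall>i. homogeneous n (\<eta> $ i)))"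
proof -
  let ?\<alpha> = "linear_form h" and ?Q = "defining_poly (A - {h})"
  have A': "arrangement (A - {h})" using arrangement_subset[OF A(1)] by blast
  have "h \<noteq> 0" using A(1,2) unfolding arrangement_def by metis
  then obtain i where hi: "h $ i \<noteq> 0" by (auto simp: vec_eq_iff)
  obtain g where g: "\<forall>l. homogeneous m (g * pvar l)" "\<forall>l. ?\<alpha> dvd \<theta> $ l - g * pvar l"
    using restriction_euler_multiple[OF A(1,2) hi \<theta>(1,3) m] by blast
  have "\<forall>l. \<exists>y. \<theta> $ l - g * pvar l = ?\<alpha> * y" using g(2) by (simp add: dvd_def)
  then obtain y where y: "\<And>l. \<theta> $ l - g * pvar l = ?\<alpha> * y l" by metis
  define \<eta> :: "'k poly3 ^ 3" where "\<eta> = (\<chi> l. y l)"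
  have \<eta>: "\<theta> $ l = ?\<alpha> * \<eta> $ l + g * pvar l" for l
    using y[of l] by (simp add: \<eta>_def algebra_simps)
  have \<alpha>0: "?\<alpha> \<noteq> 0" using linear_form_nonzero[OF \<open>h \<noteq> 0\<close>] .
  have deg: "\<exists>s. homogeneous s (\<eta> $ l) \<and> m = Suc s" if nz: "\<eta> $ l \<noteq> 0" for l
  proof -
    have "homogeneous m (?\<alpha> * \<eta> $ l)"
      using homogeneous_diff[OF \<theta>(3) g(1)[rule_format], of l l] y[of l] by (simp add: \<eta>_def)
    then obtain r s where rs: "homogeneous r ?\<alpha>" "homogeneous s (\<eta> $ l)" "r + s = m"
      using \<alpha>0 nz by (rule homogeneous_factor)
    have "r = 1" using homogeneous_unique[OF rs(1) homogeneous_linear_form \<alpha>0] .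
    then show ?thesis using rs by auto
  qed
  \<comment> \<open>In degree 0 both \<alpha> \<eta> and g E would vanish, since each has a factor
    of degree 1.\<close>
  have "m \<noteq> 0"
  proof
    assume m0: "m = 0"
    then have "\<eta> $ l = 0" for l using deg[of l] by auto
    moreover have "g = 0"
    proof (rule ccontr)
      assume g0: "g \<noteq> 0"
      have "homogeneous 0 (g * pvar 1)" using g(1) m0 by simp
      then obtain r s where rs: "homogeneous s (pvar 1 :: 'k poly3)" "r + s = 0"
        using g0 pvar_nonzero by (rule homogeneous_factor)
      then show False using homogeneous_unique[OF rs(1) homogeneous_pvar pvar_nonzero] by simp
    qed
    ultimately have "\<theta> $ l = 0" for l using \<eta>[of l] by simp
    then show False using \<theta>(2) by (simp add: vec_eq_iff)
  qed
  then obtain n where n: "m = Suc n" by (cases m) auto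
  have hom\<eta>: "homogeneous n (\<eta> $ l)" for l
    using deg[of l] n by (cases "\<eta> $ l = 0") auto
  have "0 = apply_derivation \<theta> (defining_poly A)" using \<theta>(1) by (simp add: D0_iff)
  also have "\<dots> = ?\<alpha> * apply_derivation \<eta> (defining_poly A) + g * (of_nat (card A) * defining_poly A)"
    by (rule apply_derivation_combination[OF \<eta> homogeneous_defining_poly])
  also have "\<dots> = ?\<alpha> * ((apply_derivation \<eta> ?\<alpha> + of_nat (card A) * g) * ?Q + ?\<alpha> * apply_derivation \<eta> ?Q)"
    unfolding defining_poly_remove[OF A(1,2)] apply_derivation_mult by (simp add: algebra_simps)
  finally have eq: "(apply_derivation \<eta> ?\<alpha> + of_nat (card A) * g) * ?Q + ?\<alpha> * apply_derivation \<eta> ?Q = 0"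
    using \<alpha>0 by simp
  then have "(apply_derivation \<eta> ?\<alpha> + of_nat (card A) * g) * ?Q = ?\<alpha> * (- apply_derivation \<eta> ?Q)"
    by (simp add: eq_neg_iff_add_eq_0)
  then have "?\<alpha> dvd (apply_derivation \<eta> ?\<alpha> + of_nat (card A) * g) * ?Q" by simp
  \<comment> \<open>The cancellation of Leibniz type as in
    \<open>linear_form_dvd_derivation\<close>, with the additional term from the Euler part of
    \<theta>.\<close>
  then have "?\<alpha> dvd apply_derivation \<eta> ?\<alpha> + of_nat (card A) * g"
    using arrangement_prime[OF A(1,2)] not_dvd_defining_poly_remove[OF A(1,2)]
    by (simp add: prime_elem_dvd_mult_iff)
  then obtain k where k: "apply_derivation \<eta> ?\<alpha> + of_nat (card A) * g = ?\<alpha> * k" by (elim dvdE)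
  have "?\<alpha> * (k * ?Q + apply_derivation \<eta> ?Q) = 0" using eq unfolding k by (simp add: algebra_simps)
  then have kQ: "k * ?Q + apply_derivation \<eta> ?Q = 0" using \<alpha>0 by simp
  have e: "card (A - {h}) \<noteq> 0" using A' A(3) by (simp add: arrangement_def)
  \<comment> \<open>If the correction of \<eta> vanished, e \<eta> would be a multiple of the Euler
    derivation, and by \<theta> = \<alpha> \<eta> + g E so would e \<theta>.\<close>
  have "\<exists>i. of_nat (card (A - {h})) * \<eta> $ i \<noteq> - k * pvar i"
  proof (rule ccontr)
    let ?e = "of_nat (card (A - {h})) :: 'k poly3"
    assume "\<not> ?thesis"
    then have eq: "?e * \<eta> $ l = - k * pvar l" for l by blast
    have "?e * \<theta> $ l = (?e * g - ?\<alpha> * k) * pvar l" for l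
    proof -
      have "?e * \<theta> $ l = ?\<alpha> * (?e * \<eta> $ l) + ?e * (g * pvar l)" unfolding \<eta> by (simp add: algebra_simps)
      also have "\<dots> = (?e * g - ?\<alpha> * k) * pvar l" unfolding eq by (simp add: algebra_simps)
      finally show ?thesis .
    qed
    then have "\<theta> = 0" using A(2) by (intro euler_multiple_not_in_D0[OF A(1) _ \<theta>(1) e]) auto
    then show False using \<theta>(2) by simp
  qed
  from euler_correction[OF A' A(3) hom\<eta> kQ this] show ?thesis using n by blast
qed

text \<open>A single line contains a point, so an essential arrangement has at least two lines. This
  keeps the deletion nonempty and its defining polynomial nonconstant.\<close>

lemma essential_deletion_nonempty:
  assumes "essential (A :: ('k::field ^ 3) set)" "h \<in> A"
  shows "A - {h} \<noteq> {}"
proof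
  assume "A - {h} = {}"
  then have A: "A = {h}" using assms(2) by blast
  have "\<exists>v. v \<noteq> 0 \<and> v \<in> line h"
  proof (cases "h $ 1 = 0 \<and> h $ 2 = 0")
    case True
    then have "vector [1, 0, 0] \<in> line h" by (simp add: line_def sum_3)
    moreover have "vector [1, 0, 0 :: 'k] \<noteq> (0 :: 'k ^ 3)"
      by (simp add: vec_eq_iff forall_3)
    ultimately show ?thesis by blast
  next
    case False
    have "vector [h $ 2, - h $ 1, 0] \<in> line h" by (simp add: line_def sum_3)
    moreover have "vector [h $ 2, - h $ 1, 0 :: 'k] \<noteq> (0 :: 'k ^ 3)"
      using False by (auto simp: vec_eq_iff forall_3)
    ultimately show ?thesis by blast
  qed
  then show False using assms(1) unfolding essential_def A by blast
qed

theorem theorem4p5: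
  fixes A :: "('k::field_char_0 ^ 3) set" and h :: "'k ^ 3" and d :: nat
  assumes "arrangement A" and "essential A" and "card A = d" and "h \<in> A"
  shows "(odd d \<longrightarrow> slope_stable (D_sheaf (deletion A h)) \<longrightarrow>
            real (card (restriction A h)) > (real d + 1) / 2 \<longrightarrow> slope_stable (D_sheaf A)) \<and>
         (odd d \<longrightarrow> slope_semistable (D_sheaf (deletion A h)) \<longrightarrow>
            real (card (restriction A h)) > (real d - 1) / 2 \<longrightarrow> slope_semistable (D_sheaf A)) \<and>
         (even d \<longrightarrow> slope_semistable (D_sheaf (deletion A h)) \<longrightarrow>
            real (card (restriction A h)) > real d / 2 \<longrightarrow> slope_stable (D_sheaf A))"
proof -
  let ?A' = "A - {h}"
  have ne: "?A' \<noteq> {}" using essential_deletion_nonempty[OF assms(2,4)] .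
  have A': "arrangement ?A'" using arrangement_subset[OF assms(1)] by blast
  have fin: "finite A" using assms(1) by (simp add: arrangement_def)
  have card': "card ?A' = d - 1" using assms(3,4) fin by simp
  moreover have "card ?A' \<noteq> 0" using ne fin by simp
  \<comment> \<open>Hence the differences d - 1 and d - 1 - 1 below are not truncated.\<close>
  ultimately have d: "2 \<le> d" by linarith
  have "A \<noteq> {}" using assms(4) by blast
  note iff = stable_D_sheaf_iff[OF assms(1) this, unfolded assms(3)]
  note iff' = stable_D_sheaf_iff[OF A' ne, unfolded card']
  have del: "\<exists>\<eta>\<in>D0 ?A'. \<eta> \<noteq> 0 \<and> (\<forall>i. homogeneous m (\<eta> $ i))"
    if "\<theta> \<in> D0 A" "\<theta> \<noteq> 0" "\<forall>i. homogeneous m (\<theta> $ i)" for \<theta> m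
    using D0_deletion[OF assms(1,4) ne that(1,2)] that(3) by blast
  have res: "\<exists>n. m = Suc n \<and> (\<exists>\<eta>\<in>D0 ?A'. \<eta> \<noteq> 0 \<and> (\<forall>i. homogeneous n (\<eta> $ i)))"
    if "\<theta> \<in> D0 A" "\<theta> \<noteq> 0" "\<forall>i. homogeneous m (\<theta> $ i)" "m + 1 < card (restriction A h)" for \<theta> m
    using D0_restriction[OF assms(1,4) ne that(1,2) _ that(4)] that(3) by blast
  show ?thesis
  proof (intro conjI impI)
    assume odd: "odd d" and stable: "slope_stable (D_sheaf (deletion A h))"
      and points: "real (card (restriction A h)) > (real d + 1) / 2"
    have min: "d - 1 - 1 < 2 * m" if "\<eta> \<in> D0 ?A'" "\<eta> \<noteq> 0" "\<forall>i. homogeneous m (\<eta> $ i)" for \<eta> m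
      using stable that unfolding deletion_def iff'(1) by blast
    show "slope_stable (D_sheaf A)"
      unfolding iff(1)
    proof (intro allI impI)
      fix \<theta> m assume \<theta>: "\<theta> \<in> D0 A" "\<theta> \<noteq> 0" "\<forall>i. homogeneous m (\<theta> $ i)"
      show "d - 1 < 2 * m"
      proof (rule ccontr)
        assume "\<not> d - 1 < 2 * m"
        moreover have "d - 1 - 1 < 2 * m" using del[OF \<theta>] min by blast
        \<comment> \<open>The failure gives 2m \<le> d - 1 and the deletion gives 2m > d - 2. So m +
          1 = (d + 1)/2, the assumed lower bound for the points.\<close>
        ultimately have m: "d = 2 * m + 1" using odd d by presburger
        then have "real (m + 1) < real (card (restriction A h))" using points by simp
        then have "m + 1 < card (restriction A h)" by (simp only: of_nat_less_iff)
        \<comment> \<open>The degree m - 1 has 2(m - 1) = d - 3, below the bound for the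
          deletion.\<close>
        then obtain n where "m = Suc n" "d - 1 - 1 < 2 * n" using res[OF \<theta>] min by blast
        then show False using m by linarith
      qed
    qed
  next
    assume odd: "odd d" and stable: "slope_semistable (D_sheaf (deletion A h))"
    have min: "d - 1 - 1 \<le> 2 * m" if "\<eta> \<in> D0 ?A'" "\<eta> \<noteq> 0" "\<forall>i. homogeneous m (\<eta> $ i)" for \<eta> m
      using stable that unfolding deletion_def iff'(2) by blast
    show "slope_semistable (D_sheaf A)"
      unfolding iff(2)
    proof (intro allI impI)
      fix \<theta> m assume \<theta>: "\<theta> \<in> D0 A" "\<theta> \<noteq> 0" "\<forall>i. homogeneous m (\<theta> $ i)"
      have "d - 1 - 1 \<le> 2 * m" using del[OF \<theta>] min by blast
      \<comment> \<open>For odd d the number d - 2 is odd, so an even number that is at least d - 2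
        is at least d - 1.\<close>
      then show "d - 1 \<le> 2 * m" using odd d by presburger
    qed
  next
    assume even: "even d" and stable: "slope_semistable (D_sheaf (deletion A h))"
      and points: "real (card (restriction A h)) > real d / 2"
    have min: "d - 1 - 1 \<le> 2 * m" if "\<eta> \<in> D0 ?A'" "\<eta> \<noteq> 0" "\<forall>i. homogeneous m (\<eta> $ i)" for \<eta> m
      using stable that unfolding deletion_def iff'(2) by blast
    show "slope_stable (D_sheaf A)"
      unfolding iff(1)
    proof (intro allI impI)
      fix \<theta> m assume \<theta>: "\<theta> \<in> D0 A" "\<theta> \<noteq> 0" "\<forall>i. homogeneous m (\<theta> $ i)"
      show "d - 1 < 2 * m"
      proof (rule ccontr)
        assume "\<not> d - 1 < 2 * m"
        moreover have "d - 1 - 1 \<le> 2 * m" using del[OF \<theta>] min by blast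
        \<comment> \<open>Now d - 2 \<le> 2m \<le> d - 1 with d even, so m + 1 = d/2.\<close>
        ultimately have m: "d = 2 * m + 2" using even d by presburger
        then have "real (m + 1) < real (card (restriction A h))" using points by simp
        then have "m + 1 < card (restriction A h)" by (simp only: of_nat_less_iff)
        \<comment> \<open>Here 2(m - 1) = d - 4, which even semistability of the deletion
          excludes.\<close>
        then obtain n where "m = Suc n" "d - 1 - 1 \<le> 2 * n" using res[OF \<theta>] min by blast
        then show False using m by linarith
      qed
    qed
  qed
qed

end
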